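(* Let $0<p<\infty$ and $\mathbf w\in\mathcal W$. A basic sequence $\mathcal B$ (in some quasi-Banach space) is equivalent to a subsymmetric basic sequence of the Garling sequence space $g(\mathbf w,p)$ if and only if at least one of the following holds: (a) $\mathcal B$ is equivalent to a basic sequence generated on $\mathbb Q$ (regarded in $g(\mathbb Q,\mathbf w,p)$) by a seed $(f,\eta)$ with $E_\infty[f,\eta]=0$; (b) $\mathcal B$ is equivalent to the unit vector system of $\ell_p$.
   Context: Scalars: $\mathbb F=\mathbb R$ or $\mathbb C$; $\mathbb N=\{1,2,\dots\}$, $\mathbb N[n]=\{1,\dots,n\}$; $\mathcal O$ is the set of (strictly) increasing maps $\mathbb N\to\mathbb N$. A basic sequence in a quasi-Banach space is a sequence that is a Schauder basis of its closed linear span. Basic sequences $(x_j)$, $(y_j)$ (possibly in different spaces) are equivalent if $\sum a_jx_j$ converges iff $\sum a_jy_j$ does. A basic sequence $(x_j)$ is subsymmetric if it is unconditional (every permutation of it is a basic sequence) and $(x_{\phi(j)})_j$ is equivalent to $(x_j)_j$ for every $\phi\in\mathcal O$. Garling spaces: $\mathcal W$ is the set of sequences $\mathbf w=(w_j)_{j=1}^\infty\in c_0\setminus\ell_1$ with $1=w_1\ge w_2\ge\cdots>0$. $g(\mathbf w,p)$ is the space of scalar sequences $x=(a_j)$ with $\|x\|_g=\sup_{\phi\in\mathcal O}\big(\sum_j|a_{\phi(j)}|^pw_j\big)^{1/p}<\infty$; $(s_j)_{j=1}^\infty$ denotes its unit vector system. $g(\mathbb Q,\mathbf w,p)$ is the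 quasi-Banach space of families $y=(a_q)_{q\in\mathbb Q}$ with $\|y\|_g^p=\sup\{\sum_{i=1}^N|a_{q_i}|^pw_i: q_1<\cdots<q_N \text{ in }\mathbb Q,\ N\in\mathbb N\}<\infty$; $(e_q)_{q\in\mathbb Q}$ denotes its unit vectors. Seeds: a positioning is a sequence $\eta=(d_n)_{n=1}^\infty$ with $d_n\in\mathbb N[n]$. It determines permutations $\pi_n$ of $\mathbb N[n]$ recursively (starting from the empty $\pi_0$): $\pi_n(n)=d_n$ and, for $j<n$, $\pi_n(j)=\pi_{n-1}(j)$ if $\pi_{n-1}(j)<d_n$, and $\pi_n(j)=1+\pi_{n-1}(j)$ if $\pi_{n-1}(j)\ge d_n$. A seed is a pair $(f,\eta)$ with $f=(a_j)_{j=1}^\infty\in\mathbb F^{\mathbb N}$ and $\eta$ a positioning. In $g(\mathbf w,p)$ put $u_{m,n}=\sum_{j=1}^ma_js_{\pi_n(j)}$ for $0\le m\le n$, $u_n=u_{n,n}$, $E_m[f,\eta]=\sup_{n\ge m,\,n\ge1}\|u_n-u_{m,n}\|_g\in[0,\infty]$, and $E_\infty[f,\eta]=\inf_{m\ge0}E_m[f,\eta]$. Generation on $\mathbb Q$: a sequence $(r_n)_{n=1}^\infty$ in $\mathbb Q$ is compatible with $\eta$ if $r_{\pi_n^{-1}(1)}<\cdots<r_{\pi_n^{-1}(n)}$ for every $n$. A vector $y\in\mathbb F^{\mathbb Q}$ is compatible with the seed $(f,\eta)$ if $y=\sum_{n=1}^\infty a_ne_{q_n}$ (formal sum, i.e.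 $y$ has entry $a_n$ at $q_n$ and $0$ elsewhere) for some $(q_n)$ compatible with $\eta$. A sequence $(y_k)_{k=1}^\infty$ in $\mathbb F^{\mathbb Q}$ is generated on $\mathbb Q$ by $(f,\eta)$ if every $y_k$ is compatible with $(f,\eta)$ and every element of $\operatorname{supp}(y_k)$ is smaller than every element of $\operatorname{supp}(y_{k+1})$, for all $k$. (When $E_\infty[f,\eta]=0$ such a sequence lies in $g(\mathbb Q,\mathbf w,p)$; for it to be a basic sequence one needs $f\ne0$.) *)

theory Defs
  imports "HOL-Analysis.Analysis" "HOL-Library.Function_Algebras"
begin

text \<open>
  Scalars. The type variable \<open>'k\<close> of sort \<open>{real_normed_field, euclidean_space}\<close> stands for the
  scalar field \<open>\<real>\<close> or \<open>\<complex>\<close>: both types are instances, and a finite-dimensional commutative real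
  division algebra with a multiplicative norm is isometrically one of them.

  Indexing. All sequences are indexed by \<^typ>\<open>nat\<close> starting from 0. Hence \<open>w 0\<close> is the first
  weight, \<open>d 0\<close> the first entry of a positioning, and the set of the first \<open>n\<close> indices is \<open>{..<n}\<close>.

  Vector space structure on families of scalars is pointwise, from
  \<^theory>\<open>HOL-Library.Function_Algebras\<close>.
\<close>

text \<open>
  The carrier \<open>vecs\<close> is a linear subspace of an ambient vector space (a whole type). This lets
  sequence spaces be subspaces of the space of all scalar families; the values of \<open>qnorm\<close>
  outside the carrier are irrelevant.
\<close>

record ('k, 'v) qspace =
  scl :: "'k \<Rightarrow> 'v \<Rightarrow> 'v"
  vecs :: "'v set"
  qnorm :: "'v \<Rightarrow> real"

definition qlim ::
  "('k::real_normed_field, 'v::ab_group_add) qspace \<Rightarrow> (nat \<Rightarrow> 'v) \<Rightarrow> 'v \<Rightarrow> bool" where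
  "qlim X s y \<longleftrightarrow> range s \<subseteq> vecs X \<and> y \<in> vecs X \<and> (\<lambda>n. qnorm X (s n - y)) \<longlonglongrightarrow> 0"

definition qCauchy ::
  "('k::real_normed_field, 'v::ab_group_add) qspace \<Rightarrow> (nat \<Rightarrow> 'v) \<Rightarrow> bool" where
  "qCauchy X s \<longleftrightarrow> range s \<subseteq> vecs X \<and>
     (\<forall>\<epsilon>>0. \<exists>n0. \<forall>m\<ge>n0. \<forall>n\<ge>n0. qnorm X (s m - s n) < \<epsilon>)"

definition quasi_banach :: "('k::real_normed_field, 'v::ab_group_add) qspace \<Rightarrow> bool" where
  "quasi_banach X \<longleftrightarrow>
     vector_space (scl X) \<and>
     module.subspace (scl X) (vecs X) \<and>
     (\<forall>x\<in>vecs X. 0 \<le> qnorm X x) \<and>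
     (\<forall>x\<in>vecs X. qnorm X x = 0 \<longleftrightarrow> x = 0) \<and>
     (\<forall>c. \<forall>x\<in>vecs X. qnorm X (scl X c x) = norm c * qnorm X x) \<and>
     (\<exists>K. \<forall>x\<in>vecs X. \<forall>y\<in>vecs X. qnorm X (x + y) \<le> K * (qnorm X x + qnorm X y)) \<and>
     (\<forall>s. qCauchy X s \<longrightarrow> (\<exists>y. qlim X s y))"

definition closed_span ::
  "('k::real_normed_field, 'v::ab_group_add) qspace \<Rightarrow> 'v set \<Rightarrow> 'v set" where
  "closed_span X S =
     {y \<in> vecs X. \<forall>\<epsilon>>0. \<exists>z\<in>module.span (scl X) S. qnorm X (y - z) < \<epsilon>}"

definition qsums ::
  "('k::real_normed_field, 'v::ab_group_add) qspace \<Rightarrow> (nat \<Rightarrow> 'k) \<Rightarrow> (nat \<Rightarrow> 'v) \<Rightarrow> 'v \<Rightarrow> bool" where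
  "qsums X a x y \<longleftrightarrow> qlim X (\<lambda>n. \<Sum>j<n. scl X (a j) (x j)) y"

definition basic_seq ::
  "('k::real_normed_field, 'v::ab_group_add) qspace \<Rightarrow> (nat \<Rightarrow> 'v) \<Rightarrow> bool" where
  "basic_seq X x \<longleftrightarrow> range x \<subseteq> vecs X \<and>
     (\<forall>y\<in>closed_span X (range x). \<exists>!a. qsums X a x y)"

definition equivalent_seqs ::
  "('k::real_normed_field, 'v::ab_group_add) qspace \<Rightarrow> (nat \<Rightarrow> 'v) \<Rightarrow>
   ('k, 'u::ab_group_add) qspace \<Rightarrow> (nat \<Rightarrow> 'u) \<Rightarrow> bool" where
  "equivalent_seqs X x Y y \<longleftrightarrow> (\<forall>a. (\<exists>v. qsums X a x v) \<longleftrightarrow> (\<exists>u. qsums Y a y u))"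

definition subsymmetric ::
  "('k::real_normed_field, 'v::ab_group_add) qspace \<Rightarrow> (nat \<Rightarrow> 'v) \<Rightarrow> bool" where
  "subsymmetric X x \<longleftrightarrow> basic_seq X x \<and>
     (\<forall>\<sigma>. bij \<sigma> \<longrightarrow> basic_seq X (x \<circ> \<sigma>)) \<and>
     (\<forall>\<phi>. strict_mono \<phi> \<longrightarrow> equivalent_seqs X (x \<circ> \<phi>) X x)"

definition unit_vec :: "'i \<Rightarrow> 'i \<Rightarrow> 'k::real_normed_field" where
  "unit_vec i = (\<lambda>j. if j = i then 1 else 0)"

definition fscl :: "'k::real_normed_field \<Rightarrow> ('i \<Rightarrow> 'k) \<Rightarrow> 'i \<Rightarrow> 'k" where
  "fscl c x = (\<lambda>i. c * x i)"

definition lp_space :: "real \<Rightarrow> ('k::real_normed_field, nat \<Rightarrow> 'k) qspace" where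
  "lp_space p =
     \<lparr>scl = fscl,
      vecs = {x. summable (\<lambda>j. norm (x j) powr p)},
      qnorm = (\<lambda>x. (\<Sum>j. norm (x j) powr p) powr (1 / p))\<rparr>"

definition garling_weight :: "(nat \<Rightarrow> real) \<Rightarrow> bool" where
  "garling_weight w \<longleftrightarrow>
     w 0 = 1 \<and> decseq w \<and> (\<forall>j. 0 < w j) \<and> w \<longlonglongrightarrow> 0 \<and> \<not> summable w"

definition ennroot :: "real \<Rightarrow> ennreal \<Rightarrow> ennreal" where
  "ennroot p s = (if s = \<infinity> then \<infinity> else ennreal (enn2real s powr (1 / p)))"

definition gnorm :: "(nat \<Rightarrow> real) \<Rightarrow> real \<Rightarrow> (nat \<Rightarrow> 'k::real_normed_field) \<Rightarrow> ennreal" where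
  "gnorm w p x =
     (SUP \<phi>\<in>{\<phi>. strict_mono \<phi>}. ennroot p (\<Sum>j. ennreal (norm (x (\<phi> j)) powr p * w j)))"

definition garling_space ::
  "(nat \<Rightarrow> real) \<Rightarrow> real \<Rightarrow> ('k::real_normed_field, nat \<Rightarrow> 'k) qspace" where
  "garling_space w p =
     \<lparr>scl = fscl, vecs = {x. gnorm w p x < \<infinity>}, qnorm = (\<lambda>x. enn2real (gnorm w p x))\<rparr>"

definition gQnorm :: "(nat \<Rightarrow> real) \<Rightarrow> real \<Rightarrow> (rat \<Rightarrow> 'k::real_normed_field) \<Rightarrow> ennreal" where
  "gQnorm w p y =
     ennroot p (Sup {\<Sum>i<N. ennreal (norm (y (q i)) powr p * w i) |N q.
                     1 \<le> N \<and> strict_mono_on {..<N} q})"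

definition garlingQ_space ::
  "(nat \<Rightarrow> real) \<Rightarrow> real \<Rightarrow> ('k::real_normed_field, rat \<Rightarrow> 'k) qspace" where
  "garlingQ_space w p =
     \<lparr>scl = fscl, vecs = {y. gQnorm w p y < \<infinity>}, qnorm = (\<lambda>y. enn2real (gQnorm w p y))\<rparr>"

text \<open>With indices and values counted from 0, the condition \<open>1 \<le> d\<^sub>n \<le> n\<close> on 1-based positionings
  becomes \<open>0 \<le> d n \<le> n\<close>.\<close>

definition positioning :: "(nat \<Rightarrow> nat) \<Rightarrow> bool" where
  "positioning d \<longleftrightarrow> (\<forall>n. d n \<le> n)"

text \<open>\<open>pos_perm d n\<close> is a permutation of \<open>{..<n}\<close> if \<open>d\<close> is a positioning; its values outside that set are irrelevant.\<close>

primrec pos_perm :: "(nat \<Rightarrow> nat) \<Rightarrow> nat \<Rightarrow> nat \<Rightarrow> nat" where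
  "pos_perm d 0 = (\<lambda>j. j)"
| "pos_perm d (Suc n) =
     (\<lambda>j. if j = n then d n
          else if pos_perm d n j < d n then pos_perm d n j
          else 1 + pos_perm d n j)"

definition seed_vec ::
  "(nat \<Rightarrow> 'k::real_normed_field) \<Rightarrow> (nat \<Rightarrow> nat) \<Rightarrow> nat \<Rightarrow> nat \<Rightarrow> nat \<Rightarrow> 'k" where
  "seed_vec f d m n = (\<Sum>j<m. fscl (f j) (unit_vec (pos_perm d n j)))"

definition seed_tail ::
  "(nat \<Rightarrow> real) \<Rightarrow> real \<Rightarrow> (nat \<Rightarrow> 'k::real_normed_field) \<Rightarrow> (nat \<Rightarrow> nat) \<Rightarrow> nat \<Rightarrow> ennreal" where
  "seed_tail w p f d m =
     (SUP n\<in>{n. m \<le> n \<and> 1 \<le> n}. gnorm w p (seed_vec f d n n - seed_vec f d m n))"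

definition seed_tail_inf ::
  "(nat \<Rightarrow> real) \<Rightarrow> real \<Rightarrow> (nat \<Rightarrow> 'k::real_normed_field) \<Rightarrow> (nat \<Rightarrow> nat) \<Rightarrow> ennreal" where
  "seed_tail_inf w p f d = (INF m. seed_tail w p f d m)"

definition compatible_seq :: "(nat \<Rightarrow> nat) \<Rightarrow> (nat \<Rightarrow> rat) \<Rightarrow> bool" where
  "compatible_seq d r \<longleftrightarrow>
     (\<forall>n. strict_mono_on {..<n} (\<lambda>i. r (inv_into {..<n} (pos_perm d n) i)))"

definition compatible_vec ::
  "(nat \<Rightarrow> 'k::real_normed_field) \<Rightarrow> (nat \<Rightarrow> nat) \<Rightarrow> (rat \<Rightarrow> 'k) \<Rightarrow> bool" where
  "compatible_vec f d y \<longleftrightarrow>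
     (\<exists>q. compatible_seq d q \<and> (\<forall>n. y (q n) = f n) \<and> (\<forall>r. r \<notin> range q \<longrightarrow> y r = 0))"

definition generated_on_Q ::
  "(nat \<Rightarrow> 'k::real_normed_field) \<Rightarrow> (nat \<Rightarrow> nat) \<Rightarrow> (nat \<Rightarrow> rat \<Rightarrow> 'k) \<Rightarrow> bool" where
  "generated_on_Q f d y \<longleftrightarrow>
     (\<forall>k. compatible_vec f d (y k)) \<and>
     (\<forall>k. \<forall>q r. y k q \<noteq> 0 \<longrightarrow> y (Suc k) r \<noteq> 0 \<longrightarrow> q < r)"

end

(*
  Write gpow x for the p-th power of the Garling norm, a supremum over finite subsets of an arbitrary
  linearly ordered index set. It only depends on the order in which the nonzero coordinates occur, so
  vectors can be moved freely between the natural numbers and the rationals. Moreover, successive flat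
  vectors of norm bounded away from 0 have a subsequence equivalent to the unit vectors of l_p.

  A subsymmetric basic sequence z of g(w,p) has, up to equivalence, a coordinatewise null model: a
  subsequence converges coordinatewise to some v, and if v is not 0 then v stays away from the spans of
  the tails of z (this uses boundedness of the basis projections), which makes (z_j - v) equivalent to
  (z_j). A gliding hump argument turns this model into a sequence of successive blocks. List the
  coordinates of each block by decreasing modulus and pass to a subsequence along which the values and
  the relative positions converge; the limit is a seed (f, d). Either the remainders after the first m
  coordinates tend to 0 uniformly as m grows, and then the blocks are a perturbation of a sequence
  generated by (f, d) on the rationals, or they yield flat vectors of large norm, and then the blocks are
  equivalent to the l_p basis.

  Conversely, truncating the vectors of a generated sequence gives an equivalent sequence of finite
  blocks, which can be moved back to the natural numbers.
*)
theory Submission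
  imports Defs "HOL-Library.Diagonal_Subsequence"
begin

section \<open>The p-th power of the Garling norm over a linear order\<close>

text \<open>The Garling norm respects the order of the coordinates but is not invariant under
  permutations, so a limit of blocks has to remember the relative position of every coordinate; this
  is what a positioning records. In the limit new coordinates may keep falling between old ones, and
  such an order need not embed in the natural numbers, while it always embeds in the rationals.
  Listing by modulus serves another purpose: as the partial sums of \<open>w\<close> are unbounded,
  the \<open>m\<close>-th largest coordinate of a vector of bounded norm is small uniformly as
  \<open>m\<close> grows, so what is left after \<open>m\<close> coordinates is flat. Flatness
  matters because concatenation pushes the later vectors to smaller weights; along a sparse
  subsequence of flat vectors this costs at most half of the norm. The upper \<open>l_p\<close>
  estimate is free, since p-th powers of the norm are subadditive on disjoint supports, for p < 1 as
  well as for p \<ge> 1. Boundedness of the basis projections is derived from unique expansions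
  alone, as \<open>basic_seq\<close> provides nothing more. For the converse of (b), a subsequence
  of normalized constant blocks of growing length is a copy of the \<open>l_p\<close> basis.\<close>

definition idx :: "'i::linorder set \<Rightarrow> 'i \<Rightarrow> nat" where
  "idx A a = card {b \<in> A. b < a}"

lemma idx_mono: "finite A \<Longrightarrow> B \<subseteq> A \<Longrightarrow> idx B a \<le> idx A a"
  unfolding idx_def by (rule card_mono) auto

lemma idx_less_iff:
  assumes "finite A" "a \<in> A" "b \<in> A"
  shows "idx A a < idx A b \<longleftrightarrow> a < b"
proof -
  have *: "idx A c < idx A e" if "c \<in> A" "c < e" for c e
    unfolding idx_def by (rule psubset_card_mono) (use that assms in auto)
  show ?thesis
    using *[of a b] *[of b a] assms by (metis less_asym' linorder_neqE)
qed

lemma inj_on_idx: "finite A \<Longrightarrow> inj_on (idx A) A"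
  by (rule inj_onI) (metis less_irrefl linorder_neqE idx_less_iff)

lemma bij_betw_idx:
  assumes "finite A"
  shows "bij_betw (idx A) A {..<card A}"
proof -
  have sub: "idx A ` A \<subseteq> {..<card A}"
    unfolding idx_def using assms by (auto intro!: psubset_card_mono)
  have "idx A ` A = {..<card A}"
    by (rule card_subset_eq) (use sub assms in \<open>auto simp: card_image inj_on_idx\<close>)
  then show ?thesis
    by (simp add: bij_betw_def inj_on_idx assms)
qed

lemma idx_image:
  assumes "\<And>b. b \<in> A \<Longrightarrow> h b < h a \<longleftrightarrow> b < a" "inj_on h A"
  shows "idx (h ` A) (h a) = idx A a"
proof -
  have "{b \<in> h ` A. b < h a} = h ` {b \<in> A. b < a}"
    using assms(1) by auto
  then show ?thesis
    unfolding idx_def by (simp add: card_image inj_on_subset[OF assms(2)])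
qed

text \<open>Uses only that a sum is at most twice the maximum; convexity would give a better
  constant but only for p \<ge> 1.\<close>

lemma add_powr_le:
  fixes a b p :: real
  assumes "0 \<le> a" "0 \<le> b" "0 < p"
  shows "(a + b) powr p \<le> 2 powr p * (a powr p + b powr p)"
proof -
  have "(a + b) powr p \<le> (2 * max a b) powr p"
    using assms by (intro powr_mono2) auto
  also have "\<dots> = 2 powr p * (max a b) powr p"
    using assms by (simp add: powr_mult)
  also have "\<dots> \<le> 2 powr p * (a powr p + b powr p)"
    by (intro mult_left_mono) (auto simp: max_def)
  finally show ?thesis .
qed

lemma fscl_apply: "fscl c x i = c * x i"
  by (simp add: fscl_def)

lemma sum_fscl_apply: "(\<Sum>k\<in>F. fscl (a k) (y k)) i = (\<Sum>k\<in>F. a k * y k i)"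
  by (induct F rule: infinite_finite_induct) (auto simp: fscl_def)

locale garling =
  fixes w :: "nat \<Rightarrow> real" and p :: real
  assumes weight: "garling_weight w" and p_pos: "0 < p"
begin

lemma w0: "w 0 = 1" and w_pos: "0 < w n" and w_le: "m \<le> n \<Longrightarrow> w n \<le> w m"
  and w_not_summable: "\<not> summable w"
  using weight unfolding garling_weight_def by (auto simp: decseq_def)

lemma w_nonneg: "0 \<le> w n" and w_le_1: "w n \<le> 1"
  using w_pos[of n] w_le[of 0 n] w0 by auto

text \<open>Weighting each element by its rank replaces the increasing maps of the original
  definition by plain finite sets; \<open>gsum_enumeration\<close> links the two.\<close>

definition gsum :: "('i::linorder \<Rightarrow> 'k::real_normed_field) \<Rightarrow> 'i set \<Rightarrow> real" where
  "gsum x A = (\<Sum>a\<in>A. norm (x a) powr p * w (idx A a))"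

text \<open>Taken over an arbitrary linear order, so that the sequence space and the space over the
  rationals are treated at once; the value \<open>top\<close> marks vectors outside the
  space.\<close>

definition gpow :: "('i::linorder \<Rightarrow> 'k::real_normed_field) \<Rightarrow> ennreal" where
  "gpow x = (SUP A\<in>{A. finite A}. ennreal (gsum x A))"

lemma gsum_nonneg: "0 \<le> gsum x A"
  unfolding gsum_def by (intro sum_nonneg mult_nonneg_nonneg) (auto simp: w_nonneg)

lemma gsum_le_gpow: "finite A \<Longrightarrow> ennreal (gsum x A) \<le> gpow x"
  unfolding gpow_def by (intro SUP_upper) auto

lemma gpow_leI: "(\<And>A. finite A \<Longrightarrow> ennreal (gsum x A) \<le> c) \<Longrightarrow> gpow x \<le> c"
  unfolding gpow_def by (intro SUP_least) auto

lemma less_gpowE: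
  assumes "c < gpow x"
  obtains A where "finite A" "c < ennreal (gsum x A)"
  using assms unfolding gpow_def less_SUP_iff by auto

lemma gsum_mono: "(\<And>a. a \<in> A \<Longrightarrow> norm (x a) \<le> norm (y a)) \<Longrightarrow> gsum x A \<le> gsum y A"
  unfolding gsum_def using p_pos
  by (intro sum_mono mult_right_mono powr_mono2) (auto simp: w_nonneg)

lemma gpow_mono: "(\<And>a. norm (x a) \<le> norm (y a)) \<Longrightarrow> gpow x \<le> gpow y"
  by (rule gpow_leI, rule order_trans[OF ennreal_leI gsum_le_gpow], rule gsum_mono) auto

text \<open>Passing to a subset lowers ranks and therefore raises weights.\<close>

lemma sum_le_gsum_subset:
  assumes "finite A" "B \<subseteq> A"
  shows "(\<Sum>a\<in>B. norm (x a) powr p * w (idx A a)) \<le> gsum x B"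
  unfolding gsum_def using assms
  by (intro sum_mono mult_left_mono w_le idx_mono) auto

lemma gsum_split:
  assumes "finite A" "A = B \<union> C"
  shows "gsum x A \<le> gsum x B + gsum x C"
proof -
  define g where "g = (\<lambda>a. norm (x a) powr p * w (idx A a))"
  have fin: "finite B" "finite C" and g: "\<And>a. 0 \<le> g a"
    using assms by (auto simp: g_def w_nonneg)
  have "gsum x A = sum g (B \<union> C)"
    unfolding gsum_def g_def assms(2)[symmetric] ..
  also have "\<dots> \<le> sum g B + sum g C"
    using sum.union_inter[OF fin, of g] sum_nonneg[of "B \<inter> C" g] g by auto
  also have "\<dots> \<le> gsum x B + gsum x C"
    unfolding g_def using assms by (intro add_mono sum_le_gsum_subset) auto
  finally show ?thesis .
qed

text \<open>Zeros contribute nothing and only push the other elements to higher ranks, so deleting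
  them can only help.\<close>

lemma gsum_le_subset:
  assumes "finite A" "B \<subseteq> A" "\<And>a. a \<in> A - B \<Longrightarrow> x a = 0"
  shows "gsum x A \<le> gsum x B"
proof -
  have "gsum x (A - B) = 0"
    unfolding gsum_def using assms(3) by (intro sum.neutral) auto
  with gsum_split[OF assms(1), of B "A - B" x] assms(2) show ?thesis by auto
qed

lemma gsum_cong: "(\<And>a. a \<in> A \<Longrightarrow> norm (x a) = norm (y a)) \<Longrightarrow> gsum x A = gsum y A"
  unfolding gsum_def by (intro sum.cong) auto

lemma gpow_cong: "(\<And>a. norm (x a) = norm (y a)) \<Longrightarrow> gpow x = gpow y"
  by (intro antisym gpow_mono) auto

text \<open>The quasi-triangle constant for p-th powers, taken from
  \<open>add_powr_le\<close>.\<close>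

definition K :: real where "K = 2 powr p"

lemma K_gt_1: "1 < K"
  unfolding K_def using p_pos by simp

lemma gpow_add_le:
  fixes x y :: "'i::linorder \<Rightarrow> 'k::real_normed_field"
  shows "gpow (x + y) \<le> ennreal K * (gpow x + gpow y)"
proof (rule gpow_leI)
  fix A :: "'i set" assume A: "finite A"
  have "gsum (x + y) A \<le> (\<Sum>a\<in>A. (K * (norm (x a) powr p + norm (y a) powr p)) * w (idx A a))"
    unfolding gsum_def
  proof (intro sum_mono mult_right_mono)
    fix a
    have "norm ((x + y) a) powr p \<le> (norm (x a) + norm (y a)) powr p"
      using p_pos by (intro powr_mono2) (auto intro: norm_triangle_ineq)
    then show "norm ((x + y) a) powr p \<le> K * (norm (x a) powr p + norm (y a) powr p)"
      unfolding K_def using add_powr_le[of "norm (x a)" "norm (y a)" p] p_pos by simp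
  qed (auto simp: w_nonneg)
  also have "\<dots> = K * (gsum x A + gsum y A)"
    unfolding gsum_def by (simp add: algebra_simps sum.distrib sum_distrib_left)
  finally have "ennreal (gsum (x + y) A) \<le> ennreal (K * (gsum x A + gsum y A))"
    by (rule ennreal_leI)
  also have "\<dots> = ennreal K * (ennreal (gsum x A) + ennreal (gsum y A))"
    using K_gt_1 by (simp add: ennreal_mult gsum_nonneg)
  also have "\<dots> \<le> ennreal K * (gpow x + gpow y)"
    by (intro mult_left_mono add_mono gsum_le_gpow A) auto
  finally show "ennreal (gsum (x + y) A) \<le> ennreal K * (gpow x + gpow y)" .
qed

text \<open>Any finite set splits along the two supports, and each half gains weight when counted
  alone. The constant is 1 instead of \<open>K\<close>, which is the source of all upper
  \<open>l_p\<close> estimates.\<close>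

lemma gpow_add_disjoint_le:
  fixes x y :: "'i::linorder \<Rightarrow> 'k::real_normed_field"
  assumes "\<And>i. x i = 0 \<or> y i = 0"
  shows "gpow (x + y) \<le> gpow x + gpow y"
proof (rule gpow_leI)
  fix A :: "'i set" assume A: "finite A"
  define B where "B = {a \<in> A. y a = 0}"
  define C where "C = A - B"
  have BC: "A = B \<union> C" "finite B" "finite C" using A by (auto simp: B_def C_def)
  have "gsum (x + y) A \<le> gsum (x + y) B + gsum (x + y) C"
    by (rule gsum_split[OF A BC(1)])
  also have "gsum (x + y) B = gsum x B"
    by (rule gsum_cong) (auto simp: B_def)
  also have "gsum (x + y) C = gsum y C"
  proof (rule gsum_cong)
    fix a assume "a \<in> C"
    with assms[of a] have "x a = 0" by (auto simp: B_def C_def)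
    then show "norm ((x + y) a) = norm (y a)" by simp
  qed
  finally have "ennreal (gsum (x + y) A) \<le> ennreal (gsum x B + gsum y C)"
    by (rule ennreal_leI)
  also have "\<dots> = ennreal (gsum x B) + ennreal (gsum y C)"
    by (rule ennreal_plus) (rule gsum_nonneg)+
  also have "\<dots> \<le> gpow x + gpow y"
    by (intro add_mono gsum_le_gpow BC)
  finally show "ennreal (gsum (x + y) A) \<le> gpow x + gpow y" .
qed

lemma gpow_fscl: "gpow (fscl c x) = ennreal (norm c powr p) * gpow x"
proof -
  have "gsum (fscl c x) A = norm c powr p * gsum x A" for A
    unfolding gsum_def fscl_def
    by (simp add: norm_mult powr_mult sum_distrib_left mult.assoc)
  then show ?thesis
    unfolding gpow_def by (simp add: ennreal_mult gsum_nonneg SUP_mult_left_ennreal)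
qed

lemma gpow_0 [simp]: "gpow 0 = 0"
  by (rule antisym, rule gpow_leI) (auto simp: gsum_def p_pos)

text \<open>A singleton has rank 0, and \<open>w 0 = 1\<close>.\<close>

lemma coord_le_gpow: "ennreal (norm (x i) powr p) \<le> gpow x"
  using gsum_le_gpow[of "{i}" x] by (auto simp: gsum_def idx_def w0 cong: conj_cong)

lemma gpow_eq_0_iff: "gpow x = 0 \<longleftrightarrow> x = 0"
proof
  assume "gpow x = 0"
  then have "norm (x i) powr p \<le> 0" for i
    using coord_le_gpow[of x i] by (simp add: ennreal_eq_0_iff)
  then have "norm (x i) powr p = 0" for i
    by (meson antisym powr_ge_zero)
  then show "x = 0" by (intro ext) simp
qed simp

lemma gpow_uminus: "gpow (- x) = gpow x"
  by (rule gpow_cong) simp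

lemma gpow_diff_le: "gpow (x - y) \<le> ennreal K * (gpow x + gpow y)"
  using gpow_add_le[of x "- y"] by (simp add: gpow_uminus)

lemma gpow_add_less_top: "gpow x < top \<Longrightarrow> gpow y < top \<Longrightarrow> gpow (x + y) < top"
  by (rule le_less_trans[OF gpow_add_le]) (simp add: ennreal_mult_less_top)

lemma gpow_diff_less_top: "gpow x < top \<Longrightarrow> gpow y < top \<Longrightarrow> gpow (x - y) < top"
  by (rule le_less_trans[OF gpow_diff_le]) (simp add: ennreal_mult_less_top)

lemma gpow_sum_disjoint_le:
  assumes "\<And>k l i. k \<noteq> l \<Longrightarrow> y k i = 0 \<or> y l i = 0"
  shows "gpow (\<Sum>k\<in>F. fscl (a k) (y k)) \<le> (\<Sum>k\<in>F. ennreal (norm (a k) powr p) * gpow (y k))"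
proof (induct F rule: infinite_finite_induct)
  case (insert l F)
  have "gpow (\<Sum>k\<in>insert l F. fscl (a k) (y k)) \<le> gpow (fscl (a l) (y l)) + gpow (\<Sum>k\<in>F. fscl (a k) (y k))"
    unfolding sum.insert[OF insert(1,2)]
  proof (rule gpow_add_disjoint_le)
    fix i
    have "(\<Sum>k\<in>F. a k * y k i) = 0" if "y l i \<noteq> 0"
      using assms[of l _ i] that insert(2) by (intro sum.neutral) fastforce
    then show "fscl (a l) (y l) i = 0 \<or> (\<Sum>k\<in>F. fscl (a k) (y k)) i = 0"
      by (auto simp: sum_fscl_apply fscl_apply)
  qed
  also have "\<dots> \<le> gpow (fscl (a l) (y l)) + (\<Sum>k\<in>F. ennreal (norm (a k) powr p) * gpow (y k))"
    by (intro add_left_mono insert)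
  finally show ?case unfolding gpow_fscl sum.insert[OF insert(1,2)] .
qed (simp_all only: sum.infinite sum.empty gpow_0 order.refl not_False_eq_True)

lemma gpow_le_sum_support:
  fixes x :: "'i::linorder \<Rightarrow> 'k::real_normed_field"
  assumes "finite A" "\<And>i. i \<notin> A \<Longrightarrow> x i = 0"
  shows "gpow x \<le> ennreal (\<Sum>i\<in>A. norm (x i) powr p)"
proof (intro gpow_leI ennreal_leI)
  fix B :: "'i set" assume B: "finite B"
  have "gsum x B \<le> gsum x (A \<inter> B)"
    using assms B by (intro gsum_le_subset) auto
  also have "\<dots> \<le> (\<Sum>i\<in>A \<inter> B. norm (x i) powr p)"
    unfolding gsum_def by (intro sum_mono mult_left_le) (auto simp: w_le_1 w_nonneg)
  also have "\<dots> \<le> (\<Sum>i\<in>A. norm (x i) powr p)"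
    using assms by (intro sum_mono2) auto
  finally show "gsum x B \<le> (\<Sum>i\<in>A. norm (x i) powr p)" .
qed

text \<open>\<open>U\<close> indexes the support abstractly, and \<alpha>, \<beta> realize it in two
  possibly different linear orders. A finite set is carried from one to the other with all ranks
  kept. Injectivity is not assumed: equivalence of the orders makes both maps identify the same
  pairs.\<close>

lemma gpow_order_iso_le:
  fixes x :: "'i::linorder \<Rightarrow> 'k::real_normed_field" and y :: "'j::linorder \<Rightarrow> 'k"
  assumes norm: "\<And>u. u \<in> U \<Longrightarrow> norm (x (\<alpha> u)) = norm (y (\<beta> u))"
    and order: "\<And>u v. u \<in> U \<Longrightarrow> v \<in> U \<Longrightarrow> \<alpha> u < \<alpha> v \<longleftrightarrow> \<beta> u < \<beta> v"
    and supp: "\<And>i. i \<notin> \<alpha> ` U \<Longrightarrow> x i = 0"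
  shows "gpow x \<le> gpow y"
proof (rule gpow_leI)
  fix A :: "'i set" assume A: "finite A"
  define A' where "A' = A \<inter> \<alpha> ` U"
  have A': "finite A'" "A' \<subseteq> \<alpha> ` U" "A' \<subseteq> A" using A by (auto simp: A'_def)
  have "\<forall>a\<in>A'. \<exists>u\<in>U. \<alpha> u = a" using A' by auto
  then obtain g where g: "\<And>a. a \<in> A' \<Longrightarrow> g a \<in> U" "\<And>a. a \<in> A' \<Longrightarrow> \<alpha> (g a) = a"
    by metis
  define h where "h = (\<lambda>a. \<beta> (g a))"
  have ord: "h a < h b \<longleftrightarrow> a < b" if "a \<in> A'" "b \<in> A'" for a b
    using order[of "g a" "g b"] g that by (simp add: h_def)
  then have inj: "inj_on h A'"
    by (metis inj_onI less_irrefl linorder_neqE)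
  have "gsum x A \<le> gsum x A'"
    by (rule gsum_le_subset[OF A A'(3)]) (use supp in \<open>auto simp: A'_def\<close>)
  also have "\<dots> = gsum y (h ` A')"
    unfolding gsum_def sum.reindex[OF inj]
  proof (rule sum.cong[OF refl])
    fix a assume a: "a \<in> A'"
    have "norm (x a) = norm (y (h a))" using norm[of "g a"] g[OF a] by (simp add: h_def)
    moreover have "idx (h ` A') (h a) = idx A' a"
      by (rule idx_image[OF _ inj]) (use ord a in auto)
    ultimately show "norm (x a) powr p * w (idx A' a) =
        ((\<lambda>a. norm (y a) powr p * w (idx (h ` A') a)) \<circ> h) a" by simp
  qed
  also have "ennreal \<dots> \<le> gpow y" using A' by (intro gsum_le_gpow) auto
  finally show "ennreal (gsum x A) \<le> gpow y" by (simp add: ennreal_leI)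
qed

lemma gpow_order_iso:
  fixes x :: "'i::linorder \<Rightarrow> 'k::real_normed_field" and y :: "'j::linorder \<Rightarrow> 'k"
  assumes "\<And>u. u \<in> U \<Longrightarrow> norm (x (\<alpha> u)) = norm (y (\<beta> u))"
    and "\<And>u v. u \<in> U \<Longrightarrow> v \<in> U \<Longrightarrow> \<alpha> u < \<alpha> v \<longleftrightarrow> \<beta> u < \<beta> v"
    and "\<And>i. i \<notin> \<alpha> ` U \<Longrightarrow> x i = 0" "\<And>i. i \<notin> \<beta> ` U \<Longrightarrow> y i = 0"
  shows "gpow x = gpow y"
proof (rule antisym)
  show "gpow x \<le> gpow y"
    by (rule gpow_order_iso_le[where U=U and \<alpha>=\<alpha> and \<beta>=\<beta>]) (simp_all add: assms)
  show "gpow y \<le> gpow x"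
    by (rule gpow_order_iso_le[where U=U and \<alpha>=\<beta> and \<beta>=\<alpha>]) (simp_all add: assms)
qed

text \<open>For each fixed finite set \<open>gsum\<close> is continuous in finitely many
  coordinates, and a supremum of such functionals is lower semicontinuous for coordinatewise
  convergence.\<close>

lemma gpow_fatou:
  fixes x :: "nat \<Rightarrow> 'i::linorder \<Rightarrow> 'k::real_normed_field"
  assumes lim: "\<And>i. (\<lambda>n. x n i) \<longlonglongrightarrow> y i" and bd: "eventually (\<lambda>n. gpow (x n) \<le> c) sequentially"
  shows "gpow y \<le> c"
proof (rule gpow_leI)
  fix A :: "'i set" assume A: "finite A"
  have "(\<lambda>n. gsum (x n) A) \<longlonglongrightarrow> gsum y A"
    unfolding gsum_def using p_pos
    by (intro tendsto_sum tendsto_mult tendsto_const tendsto_powr' tendsto_norm lim) auto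
  then have "(\<lambda>n. ennreal (gsum (x n) A)) \<longlonglongrightarrow> ennreal (gsum y A)"
    by (rule tendsto_ennrealI)
  moreover have "eventually (\<lambda>n. ennreal (gsum (x n) A) \<le> c) sequentially"
    using bd by eventually_elim (use gsum_le_gpow[OF A] order_trans in blast)
  ultimately show "ennreal (gsum y A) \<le> c"
    by (rule tendsto_upperbound) simp
qed

section \<open>Partial sums of the weights and the number of large coordinates\<close>

lemma sum_weights: "finite A \<Longrightarrow> (\<Sum>i<card A. w i) = (\<Sum>a\<in>A. w (idx A a))"
  by (rule sum.reindex_bij_betw[OF bij_betw_idx, symmetric])

lemma gsum_ge_const:
  assumes "finite A" "\<And>a. a \<in> A \<Longrightarrow> \<delta> \<le> norm (x a) powr p"
  shows "\<delta> * (\<Sum>i<card A. w i) \<le> gsum x A"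
  unfolding gsum_def sum_weights[OF assms(1)]
  by (auto intro!: sum_mono mult_right_mono assms simp: w_nonneg sum_distrib_left)

lemma gsum_le_const:
  assumes "finite A" "\<And>a. a \<in> A \<Longrightarrow> norm (x a) powr p \<le> \<delta>"
  shows "gsum x A \<le> \<delta> * (\<Sum>i<card A. w i)"
  unfolding gsum_def sum_weights[OF assms(1)]
  by (auto intro!: sum_mono mult_right_mono assms simp: w_nonneg sum_distrib_left)

text \<open>The place where non-summability of \<open>w\<close> enters; all flatness arguments rest
  on it.\<close>

lemma W_unbounded: "\<exists>n0. \<forall>n\<ge>n0. B < (\<Sum>i<n. w i)"
proof -
  have "\<exists>n. B < (\<Sum>i<n. w i)"
  proof (rule ccontr)
    assume "\<not> ?thesis"
    then have "summable w"
      by (intro summableI_nonneg_bounded[of w B]) (simp_all add: w_nonneg not_less)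
    then show False using w_not_summable by contradiction
  qed
  then obtain n where n: "B < (\<Sum>i<n. w i)" by blast
  have "(\<Sum>i<n. w i) \<le> (\<Sum>i<m. w i)" if "n \<le> m" for m
    using that by (intro sum_mono2) (auto simp: w_nonneg)
  then show ?thesis using n by (meson less_le_trans)
qed

lemma W_pos: "0 < (\<Sum>i<Suc n. w i)"
  by (intro sum_pos) (auto simp: w_pos)

text \<open>Any \<open>n\<close> coordinates above the threshold, wherever they sit, contribute at
  least \<delta> times the sum of the first \<open>n\<close> weights, which is unbounded in
  \<open>n\<close>.\<close>

lemma finite_large_coords:
  assumes "gpow x < \<infinity>" "0 < \<delta>"
  shows "finite {i. \<delta> \<le> norm (x i) powr p}"
proof (rule ccontr)
  assume inf: "infinite {i. \<delta> \<le> norm (x i) powr p}"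
  obtain n where n: "enn2real (gpow x) / \<delta> < (\<Sum>i<n. w i)" using W_unbounded by blast
  obtain A where A: "finite A" "card A = n" "A \<subseteq> {i. \<delta> \<le> norm (x i) powr p}"
    using infinite_arbitrarily_large[OF inf] by blast
  have "\<delta> * (\<Sum>i<n. w i) \<le> gsum x A" using gsum_ge_const[of A \<delta> x] A by auto
  also have "\<dots> \<le> enn2real (gpow x)"
    using enn2real_mono[OF gsum_le_gpow[OF A(1), of x]] assms gsum_nonneg[of x A] by (simp add: less_top)
  finally show False using n assms by (simp add: field_simps)
qed

end

section \<open>Series in quasi-Banach spaces\<close>

lemma equivalent_seqs_sym: "equivalent_seqs X x Y y \<Longrightarrow> equivalent_seqs Y y X x"
  unfolding equivalent_seqs_def by simp

lemma equivalent_seqs_trans [trans]: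
  "equivalent_seqs X x Y y \<Longrightarrow> equivalent_seqs Y y Z z \<Longrightarrow> equivalent_seqs X x Z z"
  unfolding equivalent_seqs_def by simp

lemma ex_strict_mono_frequently:
  assumes "\<And>k m::nat. \<exists>j>m. Q k j"
  shows "\<exists>\<phi>::nat\<Rightarrow>nat. strict_mono \<phi> \<and> (\<forall>k. Q k (\<phi> k))"
proof -
  have "\<exists>\<phi>. \<forall>n. Q n (\<phi> n) \<and> \<phi> n < \<phi> (Suc n)"
    by (rule dependent_nat_choice) (use assms in blast)+
  then show ?thesis by (auto simp: strict_mono_Suc_iff)
qed

lemma ex_strict_mono_selection:
  assumes "\<And>k::nat. eventually (Q k) sequentially"
  shows "\<exists>\<phi>::nat\<Rightarrow>nat. strict_mono \<phi> \<and> (\<forall>k. Q k (\<phi> k))"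
proof (rule ex_strict_mono_frequently)
  fix k m
  have "eventually (\<lambda>j. Q k j \<and> m < j) sequentially"
    by (intro eventually_conj assms eventually_gt_at_top)
  then show "\<exists>j>m. Q k j" using eventually_happens by fastforce
qed

text \<open>Here the condition ties each chosen index to the preceding choice, not to its number in
  the subsequence.\<close>

lemma ex_strict_mono_chain:
  assumes "\<And>k::nat. eventually (R k) sequentially"
  shows "\<exists>\<phi>::nat\<Rightarrow>nat. strict_mono \<phi> \<and> (\<forall>k. R (\<phi> k) (\<phi> (Suc k)))"
proof -
  have "\<exists>\<phi>. \<forall>n. True \<and> (R (\<phi> n) (\<phi> (Suc n)) \<and> \<phi> n < \<phi> (Suc n))"
  proof (rule dependent_nat_choice)
    fix x n :: nat
    have "eventually (\<lambda>y. R x y \<and> x < y) sequentially"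
      by (intro eventually_conj assms eventually_gt_at_top)
    then show "\<exists>y. True \<and> R x y \<and> x < y" using eventually_happens by fastforce
  qed auto
  then show ?thesis by (auto simp: strict_mono_Suc_iff)
qed

lemma sum_extend_strict_mono:
  fixes g :: "nat \<Rightarrow> 'k::real_normed_field" and \<psi> :: "nat \<Rightarrow> nat"
  assumes "strict_mono \<psi>" "\<And>v. s 0 v = (0::'v::ab_group_add)"
  shows "(\<Sum>k<\<psi> n. s (if k \<in> range \<psi> then g (inv \<psi> k) else 0) (x k)) = (\<Sum>j<n. s (g j) (x (\<psi> j)))"
proof -
  have inj: "inj \<psi>" using assms(1) by (rule strict_mono_imp_inj_on)
  have "(\<Sum>j<n. s (g j) (x (\<psi> j))) = (\<Sum>k\<in>\<psi> ` {..<n}. s (if k \<in> range \<psi> then g (inv \<psi> k) else 0) (x k))"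
    using inj by (subst sum.reindex) (auto intro: inj_on_subset)
  also have "\<dots> = (\<Sum>k<\<psi> n. s (if k \<in> range \<psi> then g (inv \<psi> k) else 0) (x k))"
    using assms by (intro sum.mono_neutral_left) (auto simp: strict_mono_less)
  finally show ?thesis by simp
qed

text \<open>A series along a subsequence is a series along the whole sequence with zero coefficients
  elsewhere: the partial sums run through the same vectors, with repetitions.\<close>

lemma qsums_subseq:
  fixes X :: "('k::real_normed_field, 'v::ab_group_add) qspace"
  assumes "vector_space (scl X)" and \<psi>: "strict_mono \<psi>"
  shows "qsums X g (x \<circ> \<psi>) v \<longleftrightarrow> qsums X (\<lambda>k. if k \<in> range \<psi> then g (inv \<psi> k) else 0) x v"
proof -
  interpret vector_space "scl X" by fact
  define h where "h = (\<lambda>k. if k \<in> range \<psi> then g (inv \<psi> k) else 0)"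
  define s where "s = (\<lambda>n. \<Sum>j<n. scl X (g j) ((x \<circ> \<psi>) j))"
  define t where "t = (\<lambda>n. \<Sum>k<n. scl X (h k) (x k))"
  have st: "t (\<psi> n) = s n" for n
    unfolding s_def t_def h_def using sum_extend_strict_mono[OF \<psi>, of "scl X"] by simp
  \<comment> \<open>\<open>c n\<close> is the number of elements of \<open>range \<psi>\<close>
    below \<open>n\<close>, so it tells which partial sum of the sparse series has been
    reached.\<close>
  define c where "c = (\<lambda>n. LEAST m. n \<le> \<psi> m)"
  have c: "n \<le> \<psi> (c n)" for n
    unfolding c_def by (rule LeastI[of _ n]) (rule strict_mono_imp_increasing[OF \<psi>])
  have c2: "\<psi> m < n" if "m < c n" for m n
    using not_less_Least[of m "\<lambda>m. n \<le> \<psi> m"] that by (auto simp: c_def)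
  have ts: "t n = s (c n)" for n
  proof -
    have "h k = 0" if "n \<le> k" "k < \<psi> (c n)" for k
      using that c2[of _ n] by (fastforce simp: h_def strict_mono_less[OF \<psi>])
    then have "t (\<psi> (c n)) = t n"
      unfolding t_def using c[of n] by (intro sum.mono_neutral_right) auto
    then show ?thesis by (simp add: st)
  qed
  have c_lim: "filterlim c at_top sequentially"
    unfolding filterlim_at_top
  proof
    fix m
    show "eventually (\<lambda>n. m \<le> c n) sequentially"
      using eventually_gt_at_top[of "\<psi> m"]
    proof eventually_elim
      case (elim n)
      then show ?case using c[of n] strict_mono_less[OF \<psi>, of m "c n"] by linarith
    qed
  qed
  have ran: "range s = range t"
    using st ts by (metis (mono_tags, lifting) image_cong rangeE rangeI subsetI subset_antisym)
  have "(\<lambda>n. qnorm X (s n - v)) \<longlonglongrightarrow> 0 \<longleftrightarrow> (\<lambda>n. qnorm X (t n - v)) \<longlonglongrightarrow> 0"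
  proof
    assume "(\<lambda>n. qnorm X (s n - v)) \<longlonglongrightarrow> 0"
    from filterlim_compose[OF this c_lim] show "(\<lambda>n. qnorm X (t n - v)) \<longlonglongrightarrow> 0"
      by (simp add: ts)
  next
    assume "(\<lambda>n. qnorm X (t n - v)) \<longlonglongrightarrow> 0"
    from LIMSEQ_subseq_LIMSEQ[OF this \<psi>] show "(\<lambda>n. qnorm X (s n - v)) \<longlonglongrightarrow> 0"
      by (simp add: st o_def)
  qed
  then show ?thesis
    unfolding qsums_def qlim_def s_def[symmetric] t_def[symmetric] h_def[symmetric] ran by simp
qed

lemma equivalent_seqs_subseq:
  assumes "vector_space (scl X)" "vector_space (scl Y)" "strict_mono \<psi>" "equivalent_seqs X x Y y"
  shows "equivalent_seqs X (x \<circ> \<psi>) Y (y \<circ> \<psi>)"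
  using assms(4) unfolding equivalent_seqs_def qsums_subseq[OF assms(1,3)] qsums_subseq[OF assms(2,3)]
  by simp

text \<open>Completeness of the scalars is used when infinitely many coefficients are added up in
  \<open>basic_seq_expands_norm\<close>.\<close>

locale quasi_banach_space =
  fixes X :: "('k::{real_normed_field, banach}, 'v::ab_group_add) qspace"
  assumes qb: "quasi_banach X"
begin

abbreviation V where "V \<equiv> vecs X"
abbreviation N where "N \<equiv> qnorm X"
abbreviation sc where "sc \<equiv> scl X"

lemma vs: "vector_space (scl X)"
  using qb unfolding quasi_banach_def by (rule conjunct1)

sublocale vector_space "scl X"
  by (rule vs)

lemmas qb_unfolded = qb[unfolded quasi_banach_def]

lemma V: "subspace V"
  using qb_unfolded by (elim conjE)

lemma N_nonneg: "v \<in> V \<Longrightarrow> 0 \<le> N v"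
  using conjunct1[OF conjunct2[OF conjunct2[OF qb_unfolded]]] by (rule bspec)

lemma N_eq_0: "v \<in> V \<Longrightarrow> N v = 0 \<longleftrightarrow> v = 0"
  using conjunct1[OF conjunct2[OF conjunct2[OF conjunct2[OF qb_unfolded]]]] by (rule bspec)

lemma N_scale: "v \<in> V \<Longrightarrow> N (sc c v) = norm c * N v"
  using conjunct1[OF conjunct2[OF conjunct2[OF conjunct2[OF conjunct2[OF qb_unfolded]]]]] by (elim allE) (rule bspec)

lemma complete: "qCauchy X s \<Longrightarrow> \<exists>y. qlim X s y"
  using conjunct2[OF conjunct2[OF conjunct2[OF conjunct2[OF conjunct2[OF conjunct2[OF qb_unfolded]]]]]] by (elim allE) (rule mp)

lemmas V_simps = subspace_0[OF V] subspace_add[OF V] subspace_diff[OF V] subspace_scale[OF V]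
  subspace_sum[OF V] subspace_neg[OF V]

text \<open>Chosen at least 1, so that enlarging a bound by \<open>C\<close> is harmless and
  \<open>1 / (2 * C)\<close> is at most one half.\<close>

definition C :: real where
  "C = (SOME K. 1 \<le> K \<and> (\<forall>x\<in>V. \<forall>y\<in>V. N (x + y) \<le> K * (N x + N y)))"

lemma C_ge_1: "1 \<le> C" and N_add: "x \<in> V \<Longrightarrow> y \<in> V \<Longrightarrow> N (x + y) \<le> C * (N x + N y)"
proof -
  obtain K where K: "\<forall>x\<in>V. \<forall>y\<in>V. N (x + y) \<le> K * (N x + N y)"
    using qb_unfolded by (elim conjE exE)
  have "1 \<le> max 1 K \<and> (\<forall>x\<in>V. \<forall>y\<in>V. N (x + y) \<le> max 1 K * (N x + N y))"
  proof (intro conjI ballI)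
    fix x y assume xy: "x \<in> V" "y \<in> V"
    then have "N (x + y) \<le> K * (N x + N y)" using K by blast
    also have "\<dots> \<le> max 1 K * (N x + N y)"
      using xy by (intro mult_right_mono) (auto intro: add_nonneg_nonneg N_nonneg)
    finally show "N (x + y) \<le> max 1 K * (N x + N y)" .
  qed simp
  then have *: "1 \<le> C \<and> (\<forall>x\<in>V. \<forall>y\<in>V. N (x + y) \<le> C * (N x + N y))"
    unfolding C_def by (rule someI)
  show "1 \<le> C" using * by blast
  show "x \<in> V \<Longrightarrow> y \<in> V \<Longrightarrow> N (x + y) \<le> C * (N x + N y)" using * by blast
qed

lemma N_0 [simp]: "N 0 = 0"
  using N_eq_0 V_simps(1) by blast

lemma N_minus: "v \<in> V \<Longrightarrow> N (- v) = N v"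
  using N_scale[of v "-1"] by simp

lemma N_minus_commute: "x \<in> V \<Longrightarrow> y \<in> V \<Longrightarrow> N (x - y) = N (y - x)"
  using N_minus[of "x - y"] V_simps by simp

lemma N_diff: "x \<in> V \<Longrightarrow> y \<in> V \<Longrightarrow> N (x - y) \<le> C * (N x + N y)"
  using N_add[of x "- y"] by (simp add: N_minus V_simps)

lemma N_add_le: "x \<in> V \<Longrightarrow> y \<in> V \<Longrightarrow> N x \<le> a \<Longrightarrow> N y \<le> b \<Longrightarrow> N (x + y) \<le> C * (a + b)"
  using C_ge_1 by (intro order_trans[OF N_add]) (auto intro!: mult_left_mono)

lemma N_diff_le: "x \<in> V \<Longrightarrow> y \<in> V \<Longrightarrow> N x \<le> a \<Longrightarrow> N y \<le> b \<Longrightarrow> N (x - y) \<le> C * (a + b)"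
  using C_ge_1 by (intro order_trans[OF N_diff]) (auto intro!: mult_left_mono)

text \<open>Splitting off the first term costs a factor \<open>C\<close> each time. The ratio
  \<open>1 / (2 * C)\<close> pays for it: in the induction the bound on the head and the bound on
  the rest become equal, and the factor 2 reappears.\<close>

lemma N_sum_geometric:
  assumes "\<And>j. m \<le> j \<Longrightarrow> j < n \<Longrightarrow> u j \<in> V" "\<And>j. m \<le> j \<Longrightarrow> j < n \<Longrightarrow> N (u j) \<le> B * (1 / (2 * C)) ^ j" "0 \<le> B"
  shows "N (\<Sum>j\<in>{m..<n}. u j) \<le> 2 * C * B * (1 / (2 * C)) ^ m"
proof (cases "m \<le> n")
  case True
  then show ?thesis using assms(1,2)
  proof (induct rule: inc_induct)
    case base
    then show ?case using C_ge_1 assms(3) by simp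
  next
    case (step m)
    have "N (\<Sum>j\<in>{m..<n}. u j) = N (u m + (\<Sum>j\<in>{Suc m..<n}. u j))"
      using step by (simp add: sum.atLeast_Suc_lessThan)
    also have "\<dots> \<le> C * (B * (1 / (2 * C)) ^ m + 2 * C * B * (1 / (2 * C)) ^ Suc m)"
      using step by (intro N_add_le V_simps) auto
    also have "\<dots> = 2 * C * B * (1 / (2 * C)) ^ m"
      using C_ge_1 by (simp add: field_simps)
    finally show ?case .
  qed
qed (use C_ge_1 assms(3) in simp)

lemma geometric_tendsto_0: "(\<lambda>n. c * (1 / (2 * C)) ^ n) \<longlonglongrightarrow> 0"
  using C_ge_1 by (intro tendsto_mult_right_zero LIMSEQ_realpow_zero) auto

lemma qlim_V: "qlim X s y \<Longrightarrow> s n \<in> V" "qlim X s y \<Longrightarrow> y \<in> V"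
  unfolding qlim_def by auto

lemma qlim_add: "qlim X s y \<Longrightarrow> qlim X t z \<Longrightarrow> qlim X (\<lambda>n. s n + t n) (y + z)"
  unfolding qlim_def
proof (safe intro!: V_simps)
  assume *: "range s \<subseteq> V" "range t \<subseteq> V" "y \<in> V" "z \<in> V"
    "(\<lambda>n. N (s n - y)) \<longlonglongrightarrow> 0" "(\<lambda>n. N (t n - z)) \<longlonglongrightarrow> 0"
  have "(\<lambda>n. C * (N (s n - y) + N (t n - z))) \<longlonglongrightarrow> C * (0 + 0)"
    using * by (intro tendsto_intros)
  then have "(\<lambda>n. C * (N (s n - y) + N (t n - z))) \<longlonglongrightarrow> 0" by simp
  then show "(\<lambda>n. N (s n + t n - (y + z))) \<longlonglongrightarrow> 0"
  proof (rule tendsto_sandwich[OF _ _ tendsto_const, rotated 2])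
    show "\<forall>\<^sub>F n in sequentially. N (s n + t n - (y + z)) \<le> C * (N (s n - y) + N (t n - z))"
    proof (intro always_eventually allI)
      fix n
      have "s n - y \<in> V" "t n - z \<in> V" using * by (auto intro!: V_simps)
      from N_add[OF this] show "N (s n + t n - (y + z)) \<le> C * (N (s n - y) + N (t n - z))"
        by (simp add: algebra_simps)
    qed
    show "\<forall>\<^sub>F n in sequentially. 0 \<le> N (s n + t n - (y + z))"
      using * by (intro always_eventually allI N_nonneg V_simps) auto
  qed
qed auto

lemma qlim_scale: "qlim X s y \<Longrightarrow> qlim X (\<lambda>n. sc c (s n)) (sc c y)"
  unfolding qlim_def
proof (safe intro!: V_simps)
  assume *: "range s \<subseteq> V" "y \<in> V" "(\<lambda>n. N (s n - y)) \<longlonglongrightarrow> 0"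
  have "N (sc c (s n) - sc c y) = norm c * N (s n - y)" for n
  proof -
    have "s n - y \<in> V" using * by (intro V_simps) auto
    from N_scale[OF this, of c] show ?thesis by (simp add: scale_right_diff_distrib)
  qed
  with * show "(\<lambda>n. N (sc c (s n) - sc c y)) \<longlonglongrightarrow> 0"
    by (simp add: tendsto_mult_right_zero)
qed auto

lemma qlim_const: "y \<in> V \<Longrightarrow> qlim X (\<lambda>n. y) y"
  unfolding qlim_def by auto

lemma qlim_sum: "(\<And>i. i \<in> I \<Longrightarrow> qlim X (s i) (y i)) \<Longrightarrow> qlim X (\<lambda>n. \<Sum>i\<in>I. s i n) (\<Sum>i\<in>I. y i)"
  by (induct I rule: infinite_finite_induct) (auto intro!: qlim_add qlim_const V_simps)

lemma qlim_imp_bounded: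
  assumes "qlim X s y"
  shows "\<exists>B. \<forall>n. N (s n) \<le> B"
proof -
  have "Bseq (\<lambda>n. N (s n - y))"
    using assms by (intro convergent_imp_Bseq convergentI) (auto simp: qlim_def)
  then obtain B where B: "\<And>n. N (s n - y) \<le> B"
    unfolding Bseq_def real_norm_def by (meson abs_le_D1)
  have "N (s n) \<le> C * (B + N y)" for n
    using N_add_le[of "s n - y" y B "N y"] B qlim_V[OF assms] by (simp add: V_simps)
  then show ?thesis by blast
qed

lemma qsums_add: "qsums X a x y \<Longrightarrow> qsums X b x z \<Longrightarrow> qsums X (\<lambda>n. a n + b n) x (y + z)"
  unfolding qsums_def using qlim_add by (simp add: scale_left_distrib sum.distrib)

lemma qsums_scale: "qsums X a x y \<Longrightarrow> qsums X (\<lambda>n. c * a n) x (sc c y)"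
  unfolding qsums_def using qlim_scale[of _ y c] by (fastforce simp: scale_sum_right)

lemma qsums_diff: "qsums X a x y \<Longrightarrow> qsums X b x z \<Longrightarrow> qsums X (\<lambda>n. a n - b n) x (y - z)"
  using qsums_add[of a x y "\<lambda>n. -1 * b n" "sc (-1) z"] qsums_scale[of b x z "-1"] by simp

lemma partial_sum_in_V: "range x \<subseteq> V \<Longrightarrow> (\<Sum>j\<in>F. sc (a j) (x j)) \<in> V"
  by (intro V_simps) auto

lemma qsums_finite:
  assumes "range x \<subseteq> V" "finite F" "\<And>j. j \<notin> F \<Longrightarrow> a j = 0"
  shows "qsums X a x (\<Sum>j\<in>F. sc (a j) (x j))"
proof -
  obtain n0 where n0: "\<And>j. j \<in> F \<Longrightarrow> j < n0" using assms(2) finite_nat_bounded by blast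
  have "(\<Sum>j<n. sc (a j) (x j)) = (\<Sum>j\<in>F. sc (a j) (x j))" if "n0 \<le> n" for n
    using that n0 assms by (intro sum.mono_neutral_right) (auto intro: less_le_trans)
  then have "(\<lambda>n. N ((\<Sum>j<n. sc (a j) (x j)) - (\<Sum>j\<in>F. sc (a j) (x j)))) \<longlonglongrightarrow> 0"
    by (intro tendsto_eventually eventually_sequentiallyI[of n0]) simp
  then show ?thesis
    unfolding qsums_def qlim_def using partial_sum_in_V[OF assms(1)] by auto
qed

lemma qCauchyI:
  assumes s: "\<And>n. s n \<in> V"
    and le: "\<And>\<epsilon>. 0 < \<epsilon> \<Longrightarrow> \<exists>n0. \<forall>m n. n0 \<le> m \<longrightarrow> m \<le> n \<longrightarrow> N (s n - s m) < \<epsilon>"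
  shows "qCauchy X s"
  unfolding qCauchy_def
proof (intro conjI allI impI)
  show "range s \<subseteq> V" using s by auto
  fix \<epsilon> :: real assume "0 < \<epsilon>"
  from le[OF this] obtain n0 where n0: "\<And>m n. n0 \<le> m \<Longrightarrow> m \<le> n \<Longrightarrow> N (s n - s m) < \<epsilon>"
    by blast
  have "N (s m - s n) < \<epsilon>" if "n0 \<le> m" "n0 \<le> n" for m n
  proof (cases "m \<le> n")
    case True
    then show ?thesis using n0[of m n] that N_minus_commute[OF s s, of m n] by simp
  next
    case False
    then show ?thesis using n0[of n m] that by simp
  qed
  then show "\<exists>n0. \<forall>m\<ge>n0. \<forall>n\<ge>n0. N (s m - s n) < \<epsilon>" by blast
qed

lemma convergent_series_iff:
  assumes x: "range x \<subseteq> V"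
  shows "(\<exists>y. qsums X a x y) \<longleftrightarrow>
    (\<forall>\<epsilon>>0. \<exists>n0. \<forall>m n. n0 \<le> m \<longrightarrow> m \<le> n \<longrightarrow> N (\<Sum>j\<in>{m..<n}. sc (a j) (x j)) < \<epsilon>)"
proof -
  define s where "s = (\<lambda>n. \<Sum>j<n. sc (a j) (x j))"
  have s: "s n \<in> V" for n unfolding s_def by (rule partial_sum_in_V[OF x])
  have diff: "(\<Sum>j\<in>{m..<n}. sc (a j) (x j)) = s n - s m" if "m \<le> n" for m n
    unfolding s_def using that by (simp add: lessThan_atLeast0 sum_diff_nat_ivl)
  show ?thesis
  proof safe
    fix y \<epsilon> :: _ assume y: "qsums X a x y" and e: "0 < (\<epsilon>::real)"
    have lim: "(\<lambda>n. N (s n - y)) \<longlonglongrightarrow> 0" and yV: "y \<in> V"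
      using y unfolding s_def qsums_def qlim_def by auto
    have "0 < \<epsilon> / (4 * C)" using C_ge_1 e by simp
    from order_tendstoD(2)[OF lim this] obtain n0 where n0: "\<And>n. n0 \<le> n \<Longrightarrow> N (s n - y) < \<epsilon> / (4 * C)"
      unfolding eventually_sequentially by blast
    show "\<exists>n0. \<forall>m n. n0 \<le> m \<longrightarrow> m \<le> n \<longrightarrow> N (\<Sum>j = m..<n. sc (a j) (x j)) < \<epsilon>"
    proof (intro exI[of _ n0] allI impI)
      fix m n assume mn: "n0 \<le> m" "m \<le> n"
      have "N ((s n - y) - (s m - y)) \<le> C * (\<epsilon> / (4 * C) + \<epsilon> / (4 * C))"
        using n0[of n] n0[of m] mn s yV by (intro N_diff_le V_simps) auto
      also have "\<dots> < \<epsilon>" using C_ge_1 e by (simp add: field_simps)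
      finally show "N (\<Sum>j = m..<n. sc (a j) (x j)) < \<epsilon>" using diff[OF mn(2)] by simp
    qed
  next
    assume *: "\<forall>\<epsilon>>0. \<exists>n0. \<forall>m n. n0 \<le> m \<longrightarrow> m \<le> n \<longrightarrow> N (\<Sum>j = m..<n. sc (a j) (x j)) < \<epsilon>"
    have "qCauchy X s"
    proof (rule qCauchyI[OF s])
      fix \<epsilon> :: real assume "0 < \<epsilon>"
      with * obtain n0 where n0: "\<And>m n. n0 \<le> m \<Longrightarrow> m \<le> n \<Longrightarrow> N (\<Sum>j = m..<n. sc (a j) (x j)) < \<epsilon>"
        by blast
      then have "N (s n - s m) < \<epsilon>" if "n0 \<le> m" "m \<le> n" for m n
        using that by (simp flip: diff)
      then show "\<exists>n0. \<forall>m n. n0 \<le> m \<longrightarrow> m \<le> n \<longrightarrow> N (s n - s m) < \<epsilon>" by blast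
    qed
    then show "\<exists>y. qsums X a x y"
      using complete unfolding qsums_def s_def by blast
  qed
qed

text \<open>Completeness in the form needed for nested balls. A quasi-norm need not be continuous,
  so the bound for the limit is obtained by passing to one late \<open>Y n\<close>, at the price of
  another factor \<open>C\<close>.\<close>

lemma telescoping_limit:
  assumes Y: "\<And>n. Y n \<in> V" and step: "\<And>n. N (Y (Suc n) - Y n) \<le> s n" and pos: "\<And>n. 0 < s n"
    and s: "\<And>n. s (Suc n) \<le> s n / (2 * C)"
  shows "\<exists>y. qlim X Y y \<and> (\<forall>n. N (y - Y n) \<le> 4 * C\<^sup>2 * s n)"
proof -
  \<comment> \<open>The rescaled radii decrease, so from index \<open>m\<close> on the increments
    are dominated by a geometric sequence with the ratio of \<open>N_sum_geometric\<close>.\<close>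
  have sle: "s j * (2 * C) ^ j \<le> s m * (2 * C) ^ m" if "m \<le> j" for m j
    using that
  proof (induct rule: dec_induct)
    case (step j)
    have "s (Suc j) * (2 * C) ^ Suc j = (s (Suc j) * (2 * C)) * (2 * C) ^ j" by simp
    also have "\<dots> \<le> s j * (2 * C) ^ j"
      using s[of j] C_ge_1 by (intro mult_right_mono) (auto simp: field_simps)
    finally show ?case using step(3) by (rule order_trans)
  qed simp
  have bd: "N (Y n - Y m) \<le> 2 * C * s m" if "m \<le> n" for m n
  proof -
    have "N (\<Sum>j\<in>{m..<n}. Y (Suc j) - Y j) \<le> 2 * C * (s m * (2 * C) ^ m) * (1 / (2 * C)) ^ m"
    proof (rule N_sum_geometric)
      fix j assume "m \<le> j"
      then show "N (Y (Suc j) - Y j) \<le> s m * (2 * C) ^ m * (1 / (2 * C)) ^ j"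
        using order_trans[OF step, of j "s m * (2 * C) ^ m * (1 / (2 * C)) ^ j"] sle[of m j] C_ge_1
        by (simp add: power_one_over field_simps)
    qed (use Y C_ge_1 pos[of m] in \<open>auto intro!: V_simps\<close>)
    then show ?thesis using that C_ge_1 by (simp add: sum_Suc_diff' power_one_over)
  qed
  have s0: "s n \<le> s 0 * (1 / (2 * C)) ^ n" for n
    using sle[of 0 n] C_ge_1 by (simp add: power_one_over field_simps)
  have "s \<longlonglongrightarrow> 0"
    by (rule tendsto_sandwich[OF _ _ tendsto_const geometric_tendsto_0[of "s 0"]])
       (use s0 pos in \<open>auto intro!: always_eventually less_imp_le\<close>)
  have "qCauchy X Y"
  proof (rule qCauchyI[OF Y])
    fix \<epsilon> :: real assume "0 < \<epsilon>"
    then have "0 < \<epsilon> / (2 * C)" using C_ge_1 by simp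
    from order_tendstoD(2)[OF \<open>s \<longlonglongrightarrow> 0\<close> this]
    obtain n0 where n0: "\<And>n. n0 \<le> n \<Longrightarrow> s n < \<epsilon> / (2 * C)"
      unfolding eventually_sequentially by blast
    have "N (Y n - Y m) < \<epsilon>" if "n0 \<le> m" "m \<le> n" for m n
    proof -
      have "N (Y n - Y m) \<le> 2 * C * s m" by (rule bd[OF that(2)])
      also have "\<dots> < \<epsilon>" using n0[OF that(1)] C_ge_1 by (simp add: field_simps)
      finally show ?thesis .
    qed
    then show "\<exists>n0. \<forall>m n. n0 \<le> m \<longrightarrow> m \<le> n \<longrightarrow> N (Y n - Y m) < \<epsilon>" by blast
  qed
  then obtain y where y: "qlim X Y y" using complete by blast
  have "N (y - Y m) \<le> 4 * C\<^sup>2 * s m" for m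
  proof -
    have "eventually (\<lambda>n. N (Y n - y) < s m) sequentially"
      using y pos[of m] unfolding qlim_def by (intro order_tendstoD(2)[where y = 0]) auto
    then have "eventually (\<lambda>n. N (Y n - y) < s m \<and> m \<le> n) sequentially"
      by (rule eventually_conj) (rule eventually_ge_at_top)
    then obtain n where n: "N (Y n - y) < s m" "m \<le> n"
      using eventually_happens by fastforce
    have yV: "y \<in> V" using y by (simp add: qlim_def)
    have "N ((Y n - Y m) - (Y n - y)) \<le> C * (2 * C * s m + s m)"
      using n bd[OF n(2)] Y yV by (intro N_diff_le V_simps) auto
    also have "\<dots> = (2 * C * C + C * 1) * s m" by (simp add: algebra_simps)
    also have "\<dots> \<le> (2 * C * C + C * C) * s m"
      using C_ge_1 pos[of m] by (intro mult_right_mono add_left_mono mult_left_mono) auto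
    also have "\<dots> \<le> 4 * C\<^sup>2 * s m"
      using C_ge_1 pos[of m] by (simp add: power2_eq_square algebra_simps)
    finally show ?thesis by simp
  qed
  then show ?thesis using y by blast
qed

end

section \<open>Boundedness of the basis projections\<close>

context quasi_banach_space
begin

lemma closed_span_subset: "y \<in> closed_span X S \<Longrightarrow> y \<in> V"
  unfolding closed_span_def by blast

lemma span_subset_V: "S \<subseteq> V \<Longrightarrow> z \<in> span S \<Longrightarrow> z \<in> V"
  using span_minimal[OF _ V] by blast

lemma closed_span_sequence:
  assumes S: "S \<subseteq> V" and y: "y \<in> closed_span X S"
  shows "\<exists>s. qlim X s y \<and> (\<forall>n. s n \<in> span S)"
proof -
  have yV: "y \<in> V" using y by (rule closed_span_subset)
  have "\<exists>z. z \<in> span S \<and> N (y - z) < 1 / real (Suc n)" for n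
  proof -
    have "0 < 1 / real (Suc n)" by simp
    then show ?thesis using y unfolding closed_span_def by blast
  qed
  then obtain s where s: "\<And>n. s n \<in> span S" "\<And>n. N (y - s n) < 1 / real (Suc n)" by metis
  have sV: "s n \<in> V" for n using span_subset_V[OF S s(1)] .
  have "(\<lambda>n. N (s n - y)) \<longlonglongrightarrow> 0"
  proof (rule tendsto_sandwich[OF _ _ tendsto_const])
    show "(\<lambda>n. 1 / real (Suc n)) \<longlonglongrightarrow> 0" by (rule lim_1_over_n[THEN LIMSEQ_Suc])
    show "\<forall>\<^sub>F n in sequentially. N (s n - y) \<le> 1 / real (Suc n)"
      using s(2) N_minus_commute[OF yV sV] by (intro always_eventually allI) (simp add: less_imp_le)
  qed (intro always_eventually allI N_nonneg V_simps sV yV)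
  with s(1) sV yV show ?thesis unfolding qlim_def by blast
qed

lemma closed_span_limit_point:
  assumes "qlim X s y" "\<And>n. s n \<in> span S"
  shows "y \<in> closed_span X S"
  unfolding closed_span_def
proof (intro CollectI conjI allI impI)
  show yV: "y \<in> V" using qlim_V(2)[OF assms(1)] .
  fix \<epsilon> :: real assume e: "0 < \<epsilon>"
  have "(\<lambda>n. N (s n - y)) \<longlonglongrightarrow> 0" using assms(1) by (simp add: qlim_def)
  from order_tendstoD(2)[OF this e] obtain n where "N (s n - y) < \<epsilon>"
    unfolding eventually_sequentially by blast
  then show "\<exists>z\<in>span S. N (y - z) < \<epsilon>"
    using assms(2) N_minus_commute[OF yV qlim_V(1)[OF assms(1)], of n] by (intro bexI[of _ "s n"]) simp_all
qed

lemma closed_span_add: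
  assumes "S \<subseteq> V" "y \<in> closed_span X S" "y' \<in> closed_span X S"
  shows "y + y' \<in> closed_span X S"
  using closed_span_sequence[OF assms(1,2)] closed_span_sequence[OF assms(1,3)]
  by (auto intro!: closed_span_limit_point[OF qlim_add] span_add)

lemma closed_span_scale:
  assumes "S \<subseteq> V" "y \<in> closed_span X S"
  shows "sc c y \<in> closed_span X S"
  using closed_span_sequence[OF assms] by (auto intro!: closed_span_limit_point[OF qlim_scale] span_scale)

lemma closed_span_diff:
  assumes "S \<subseteq> V" "y \<in> closed_span X S" "y' \<in> closed_span X S"
  shows "y - y' \<in> closed_span X S"
  using closed_span_add[OF assms(1,2) closed_span_scale[OF assms(1,3), of "-1"]] by simp

lemma closed_span_closed:
  assumes "S \<subseteq> V" "qlim X s y" "\<And>n. s n \<in> closed_span X S"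
  shows "y \<in> closed_span X S"
  unfolding closed_span_def
proof (intro CollectI conjI allI impI)
  show yV: "y \<in> V" using assms(2) qlim_V by blast
  fix \<epsilon> :: real assume "0 < \<epsilon>"
  then have e: "0 < \<epsilon> / (2 * C)" using C_ge_1 by simp
  have "(\<lambda>n. N (s n - y)) \<longlonglongrightarrow> 0" using assms(2) by (simp add: qlim_def)
  from order_tendstoD(2)[OF this e] obtain n where n: "N (s n - y) < \<epsilon> / (2 * C)"
    unfolding eventually_sequentially by blast
  have sV: "s n \<in> V" using qlim_V assms(2) by blast
  obtain z where z: "z \<in> span S" "N (s n - z) < \<epsilon> / (2 * C)"
    using assms(3)[of n] e unfolding closed_span_def by blast
  have zV: "z \<in> V" using z span_subset_V assms(1) by blast
  have "N ((s n - z) - (s n - y)) \<le> C * (N (s n - z) + N (s n - y))"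
    by (intro N_diff V_simps yV zV sV)
  also have "\<dots> < C * (\<epsilon> / (2 * C) + \<epsilon> / (2 * C))"
    using z n C_ge_1 by (intro mult_strict_left_mono add_strict_mono) auto
  also have "\<dots> = \<epsilon>" using C_ge_1 by simp
  finally show "\<exists>z\<in>span S. N (y - z) < \<epsilon>" using z(1) by auto
qed

lemma span_subset_closed_span:
  assumes "S \<subseteq> V" "y \<in> span S"
  shows "y \<in> closed_span X S"
  unfolding closed_span_def
proof (intro CollectI conjI allI impI)
  show "y \<in> V" using assms span_subset_V by blast
  show "\<exists>z\<in>span S. N (y - z) < \<epsilon>" if "0 < \<epsilon>" for \<epsilon>
    using that by (intro bexI[OF _ assms(2)]) simp
qed

lemma closed_span_limit:
  assumes "range x \<subseteq> V" "y \<in> V" "\<And>\<epsilon>. 0 < \<epsilon> \<Longrightarrow> \<exists>F a. N (y - (\<Sum>j\<in>F. sc (a j) (x j))) < \<epsilon>"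
  shows "y \<in> closed_span X (range x)"
  unfolding closed_span_def
proof (intro CollectI conjI allI impI assms(2))
  fix \<epsilon> :: real assume "0 < \<epsilon>"
  from assms(3)[OF this] obtain F a where Fa: "N (y - (\<Sum>j\<in>F. sc (a j) (x j))) < \<epsilon>"
    by blast
  moreover have "(\<Sum>j\<in>F. sc (a j) (x j)) \<in> span (range x)"
    by (intro span_sum span_scale span_base rangeI)
  ultimately show "\<exists>z\<in>span (range x). N (y - z) < \<epsilon>" by blast
qed

lemma qsums_closed_span:
  assumes "range x \<subseteq> V" "qsums X a x y"
  shows "y \<in> closed_span X (range x)"
  using assms(2) unfolding qsums_def
  by (rule closed_span_limit_point) (intro span_sum span_scale span_base rangeI)

text \<open>The smallest such \<open>M\<close> is the norm given by the supremum over all partial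
  sums; the goal of this section is to bound it by a multiple of \<open>N y\<close>.\<close>

definition expands :: "(nat \<Rightarrow> 'v) \<Rightarrow> real \<Rightarrow> 'v \<Rightarrow> bool" where
  "expands z M y \<longleftrightarrow> (\<exists>a. qsums X a z y \<and> (\<forall>n. N (\<Sum>j<n. sc (a j) (z j)) \<le> M))"

lemma basic_seq_V: "basic_seq X z \<Longrightarrow> range z \<subseteq> V"
  unfolding basic_seq_def by blast

lemma basic_seq_expands:
  assumes "basic_seq X z" "y \<in> closed_span X (range z)"
  shows "\<exists>n::nat. expands z n y"
proof -
  obtain a where a: "qsums X a z y" using assms unfolding basic_seq_def by blast
  then obtain B where B: "\<forall>n. N (\<Sum>j<n. sc (a j) (z j)) \<le> B"
    using qlim_imp_bounded unfolding qsums_def by blast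
  obtain n :: nat where "B \<le> n" using real_arch_simple by blast
  with a B show ?thesis unfolding expands_def by (meson order_trans)
qed

lemma expands_0: "range z \<subseteq> V \<Longrightarrow> expands z 0 0"
  unfolding expands_def using qsums_finite[of z "{}" "\<lambda>_. 0"]
  by (intro exI[of _ "\<lambda>_. 0"]) simp

lemma expands_diff:
  assumes "range z \<subseteq> V" "expands z M y" "expands z M' y'"
  shows "expands z (C * (M + M')) (y - y')"
proof -
  obtain a where a: "qsums X a z y" "\<And>n. N (\<Sum>j<n. sc (a j) (z j)) \<le> M"
    using assms(2) unfolding expands_def by blast
  obtain b where b: "qsums X b z y'" "\<And>n. N (\<Sum>j<n. sc (b j) (z j)) \<le> M'"
    using assms(3) unfolding expands_def by blast
  have "N ((\<Sum>j<n. sc (a j) (z j)) - (\<Sum>j<n. sc (b j) (z j))) \<le> C * (M + M')" for n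
    by (intro N_diff_le partial_sum_in_V assms(1) a b)
  then show ?thesis
    unfolding expands_def using qsums_diff[OF a(1) b(1)]
    by (auto simp: scale_left_diff_distrib sum_subtractf intro!: exI[of _ "\<lambda>n. a n - b n"])
qed

lemma expands_scale:
  assumes "range z \<subseteq> V" "expands z M y"
  shows "expands z (norm c * M) (sc c y)"
proof -
  obtain a where a: "qsums X a z y" "\<And>n. N (\<Sum>j<n. sc (a j) (z j)) \<le> M"
    using assms(2) unfolding expands_def by blast
  have "N (\<Sum>j<n. sc (c * a j) (z j)) = norm c * N (\<Sum>j<n. sc (a j) (z j))" for n
    using N_scale[OF partial_sum_in_V[OF assms(1), of a "{..<n}"], of c]
    by (simp add: scale_sum_right)
  then show ?thesis
    unfolding expands_def using qsums_scale[OF a(1), of c] a(2)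
    by (auto intro!: exI[of _ "\<lambda>n. c * a n"] mult_left_mono)
qed

text \<open>A Baire category argument, carried out with shrinking balls because a quasi-norm need not
  come from a metric.\<close>

lemma expands_dense_in_ball:
  assumes z: "basic_seq X z"
  shows "\<exists>M r y0. 0 < r \<and> 0 \<le> M \<and> y0 \<in> closed_span X (range z) \<and>
    (\<forall>y\<in>closed_span X (range z). N (y - y0) < r \<longrightarrow> (\<forall>\<epsilon>>0. \<exists>y'. expands z M y' \<and> N (y - y') < \<epsilon>))"
proof (rule ccontr)
  let ?E = "closed_span X (range z)"
  assume contra: "\<not> ?thesis"
  have zV: "range z \<subseteq> V" by (rule basic_seq_V[OF z])
  have step: "\<exists>y s'. y \<in> ?E \<and> N (y - y0) < s \<and> 0 < s' \<and> s' \<le> s / (2 * C) \<and>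
      (\<forall>x. N (x - y) \<le> 4 * C\<^sup>2 * s' \<longrightarrow> x \<in> ?E \<longrightarrow> \<not> expands z (real n) x)"
    if y0: "y0 \<in> ?E" and s: "0 < s" for y0 s n
  proof -
    \<comment> \<open>The negated claim, with \<open>n\<close> as the bound and \<open>s\<close> as
      the radius, gives a vector of the ball near which nothing expands with bound
      \<open>n\<close>.\<close>
    obtain y \<epsilon> where y: "y \<in> ?E" "N (y - y0) < s" "0 < \<epsilon>" "\<And>y'. expands z (real n) y' \<Longrightarrow> \<not> N (y - y') < \<epsilon>"
      using contra y0 s of_nat_0_le_iff[of n] by blast
    \<comment> \<open>The first bound makes the radii decay as \<open>telescoping_limit\<close>
      requires; the second keeps the ball of radius \<open>4 * C\<^sup>2 * s'\<close>, where the
      limit will lie, away from all vectors that expand with bound \<open>n\<close>.\<close>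
    define s' where "s' = min (s / (2 * C)) (\<epsilon> / (8 * C\<^sup>2))"
    have C2: "0 < C\<^sup>2" using C_ge_1 by simp
    have s': "0 < s'" "s' \<le> s / (2 * C)" using s y(3) C_ge_1 C2 by (auto simp: s'_def)
    have "4 * C\<^sup>2 * s' \<le> 4 * C\<^sup>2 * (\<epsilon> / (8 * C\<^sup>2))"
      using C2 by (intro mult_left_mono) (auto simp: s'_def)
    also have "\<dots> < \<epsilon>" using C2 y(3) by (simp add: field_simps)
    finally have lt: "4 * C\<^sup>2 * s' < \<epsilon>" .
    have "\<not> expands z (real n) x" if "N (x - y) \<le> 4 * C\<^sup>2 * s'" "x \<in> ?E" for x
      using y(4)[of x] that lt N_minus_commute[of x y] closed_span_subset y(1) by fastforce
    with y s' show ?thesis by blast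
  qed
  have zero: "0 \<in> ?E" by (intro span_subset_closed_span zV span_zero)
  have "\<exists>f. \<forall>n. (fst (f n) \<in> ?E \<and> 0 < snd (f n)) \<and>
     (N (fst (f (Suc n)) - fst (f n)) < snd (f n) \<and> snd (f (Suc n)) \<le> snd (f n) / (2 * C) \<and>
      (\<forall>x. N (x - fst (f (Suc n))) \<le> 4 * C\<^sup>2 * snd (f (Suc n)) \<longrightarrow> x \<in> ?E \<longrightarrow> \<not> expands z (real n) x))"
  proof (rule dependent_nat_choice)
    show "\<exists>x. fst x \<in> ?E \<and> (0::real) < snd x"
      using zero by (intro exI[of _ "(0, 1)"]) simp
    fix f :: "'v \<times> real" and n
    assume "fst f \<in> ?E \<and> 0 < snd f"
    then show "\<exists>g. (fst g \<in> ?E \<and> 0 < snd g) \<and> (N (fst g - fst f) < snd f \<and> snd g \<le> snd f / (2 * C) \<and>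
      (\<forall>x. N (x - fst g) \<le> 4 * C\<^sup>2 * snd g \<longrightarrow> x \<in> ?E \<longrightarrow> \<not> expands z (real n) x))"
      using step[of "fst f" "snd f" n] by (metis fst_conv snd_conv)
  qed
  then obtain f where f: "\<And>n. fst (f n) \<in> ?E" "\<And>n. 0 < snd (f n)"
     "\<And>n. N (fst (f (Suc n)) - fst (f n)) < snd (f n)" "\<And>n. snd (f (Suc n)) \<le> snd (f n) / (2 * C)"
     "\<And>n x. N (x - fst (f (Suc n))) \<le> 4 * C\<^sup>2 * snd (f (Suc n)) \<Longrightarrow> x \<in> ?E \<Longrightarrow> \<not> expands z (real n) x"
    by blast
  obtain y where y: "qlim X (\<lambda>n. fst (f n)) y" "\<And>n. N (y - fst (f n)) \<le> 4 * C\<^sup>2 * snd (f n)"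
    using telescoping_limit[of "\<lambda>n. fst (f n)" "\<lambda>n. snd (f n)"] f closed_span_subset less_imp_le by blast
  have "y \<in> ?E" by (rule closed_span_closed[OF zV y(1) f(1)])
  \<comment> \<open>The limit lies in every forbidden ball, so no integer can bound its partial
    sums.\<close>
  then obtain n :: nat where "expands z n y" using basic_seq_expands[OF z] by blast
  then show False using f(5)[OF y(2)[of "Suc n"] \<open>y \<in> ?E\<close>] by blast
qed

text \<open>A multiple of \<open>y\<close> is added to the centre of the ball; approximants of the
  shifted point and of the centre are subtracted and scaled back. Hence the factor
  \<open>C * (M + M)\<close>.\<close>

lemma expands_approx:
  assumes z: "basic_seq X z"
  shows "\<exists>M\<ge>0. \<forall>y\<in>closed_span X (range z). \<forall>\<epsilon>>0. \<exists>y'. expands z (M * N y) y' \<and> N (y - y') < \<epsilon>"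
proof -
  let ?E = "closed_span X (range z)"
  have zV: "range z \<subseteq> V" by (rule basic_seq_V[OF z])
  obtain M r y0 where r: "0 < r" "0 \<le> M" "y0 \<in> ?E"
    and dense: "\<And>y \<epsilon>. y \<in> ?E \<Longrightarrow> N (y - y0) < r \<Longrightarrow> 0 < \<epsilon> \<Longrightarrow> \<exists>y'. expands z M y' \<and> N (y - y') < \<epsilon>"
    using expands_dense_in_ball[OF z] by blast
  define M' where "M' = 2 / r * (C * (M + M))"
  have M': "0 \<le> M'" using r C_ge_1 by (simp add: M'_def)
  have "\<exists>y'. expands z (M' * N y) y' \<and> N (y - y') < \<epsilon>" if y: "y \<in> ?E" and e: "0 < \<epsilon>" for y \<epsilon>
  proof (cases "N y = 0")
    case True
    then have "y = 0" using N_eq_0 y closed_span_subset by blast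
    then show ?thesis using e expands_0[OF zV] by (intro exI[of _ 0]) simp
  next
    case False
    have yV: "y \<in> V" and y0V: "y0 \<in> V" using y r closed_span_subset by blast+
    have Ny: "0 < N y" using False N_nonneg[OF yV] by simp
    \<comment> \<open>Makes the shift have quasi-norm \<open>r / 2\<close>, safely inside the
      ball.\<close>
    define l where "l = r / (2 * N y)"
    have l: "0 < l" using r Ny by (simp add: l_def)
    define c where "c = (of_real l :: 'k)"
    have c: "norm c = l" "c \<noteq> 0" using l by (auto simp: c_def)
    define y1 where "y1 = y0 + sc c y"
    have y1: "y1 \<in> ?E" unfolding y1_def by (intro closed_span_add closed_span_scale zV r y)
    have "N (y1 - y0) = l * N y" using N_scale[OF yV, of c] c by (simp add: y1_def)
    also have "\<dots> < r" using r Ny by (simp add: l_def)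
    finally have d1: "N (y1 - y0) < r" .
    have d0: "N (y0 - y0) < r" using r by simp
    define \<delta> where "\<delta> = l * \<epsilon> / (2 * C)"
    have d: "0 < \<delta>" using l e C_ge_1 by (simp add: \<delta>_def)
    obtain z1 where z1: "expands z M z1" "N (y1 - z1) < \<delta>" using dense[OF y1 d1 d] by blast
    obtain z0 where z0: "expands z M z0" "N (y0 - z0) < \<delta>" using dense[OF r(3) d0 d] by blast
    have zV': "z1 \<in> V" "z0 \<in> V" using z1 z0 unfolding expands_def qsums_def using qlim_V by blast+
    have y1V: "y1 \<in> V" using y1 closed_span_subset by blast
    have "sc c (y - sc (1 / c) (z1 - z0)) = (y1 - z1) - (y0 - z0)"
      using c by (simp add: y1_def scale_right_diff_distrib)
    then have "l * N (y - sc (1 / c) (z1 - z0)) = N ((y1 - z1) - (y0 - z0))"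
      using N_scale[of "y - sc (1 / c) (z1 - z0)" c] c yV zV' by (simp add: V_simps)
    also have "\<dots> \<le> C * (N (y1 - z1) + N (y0 - z0))"
      by (intro N_diff V_simps zV' y1V y0V)
    also have "\<dots> < C * (\<delta> + \<delta>)"
      using z1 z0 C_ge_1 by (intro mult_strict_left_mono add_strict_mono) auto
    also have "\<dots> = l * \<epsilon>" using C_ge_1 by (simp add: \<delta>_def)
    finally have "N (y - sc (1 / c) (z1 - z0)) < \<epsilon>" using l by simp
    moreover have "expands z (norm (1 / c) * (C * (M + M))) (sc (1 / c) (z1 - z0))"
      by (intro expands_scale expands_diff zV z1 z0)
    moreover have "norm (1 / c) * (C * (M + M)) = M' * N y"
      using c Ny r by (simp add: M'_def l_def norm_divide)
    ultimately show ?thesis by metis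
  qed
  with M' show ?thesis by blast
qed

lemma finite_combination_tendsto_0:
  fixes z :: "nat \<Rightarrow> 'v"
  assumes "range z \<subseteq> V" "\<And>j. (\<lambda>i. c i j) \<longlonglongrightarrow> 0"
  shows "(\<lambda>i. N (\<Sum>j<n. sc (c i j) (z j))) \<longlonglongrightarrow> 0"
proof (induct n)
  case (Suc n)
  have zn: "z n \<in> V" using assms(1) by auto
  have "(\<lambda>i. C * (N (\<Sum>j<n. sc (c i j) (z j)) + norm (c i n) * N (z n))) \<longlonglongrightarrow> C * (0 + norm (0::'k) * N (z n))"
    by (intro tendsto_intros Suc assms(2))
  then have lim: "(\<lambda>i. C * (N (\<Sum>j<n. sc (c i j) (z j)) + norm (c i n) * N (z n))) \<longlonglongrightarrow> 0" by simp
  have le: "N (\<Sum>j<Suc n. sc (c i j) (z j)) \<le> C * (N (\<Sum>j<n. sc (c i j) (z j)) + norm (c i n) * N (z n))" for i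
    using N_add[OF partial_sum_in_V[OF assms(1), of "c i" "{..<n}"] V_simps(4)[OF zn, of "c i n"]]
    by (simp add: N_scale[OF zn])
  show ?case
    by (rule tendsto_sandwich[OF _ _ tendsto_const lim])
       (intro always_eventually allI le N_nonneg partial_sum_in_V assms(1))+
qed simp

text \<open>Without continuity of the quasi-norm a bound passes to the limit only up to the factor
  \<open>C\<close>.\<close>

lemma qlim_norm_le:
  assumes "x \<in> V" "(\<lambda>n. N (x - s n)) \<longlonglongrightarrow> 0" "\<And>n. s n \<in> V" "\<And>n. k \<le> n \<Longrightarrow> N (s n) \<le> B"
  shows "N x \<le> C * B"
proof -
  have "(\<lambda>n. C * (N (x - s n) + B)) \<longlonglongrightarrow> C * (0 + B)"
    by (intro tendsto_intros assms)
  moreover have "N x \<le> C * (N (x - s n) + B)" if "k \<le> n" for n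
    using N_add_le[of "x - s n" "s n" "N (x - s n)" B] assms that by (simp add: V_simps)
  ultimately show ?thesis by (intro LIMSEQ_le_const) auto
qed

text \<open>A zero term could carry the coefficient 0 or 1, which would give two expansions of
  0.\<close>

lemma basic_seq_nonzero:
  assumes "basic_seq X z"
  shows "z j \<noteq> 0"
proof
  assume 0: "z j = 0"
  have zV: "range z \<subseteq> V" by (rule basic_seq_V[OF assms])
  have "qsums X (\<lambda>_. 0) z 0" using qsums_finite[OF zV, of "{}" "\<lambda>_. 0"] by simp
  moreover have "qsums X (\<lambda>i. if i = j then 1 else 0) z 0"
    using qsums_finite[OF zV, of "{j}" "\<lambda>i. if i = j then 1 else 0"] 0 by simp
  moreover have "0 \<in> closed_span X (range z)" by (intro span_subset_closed_span zV span_zero)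
  ultimately have "(\<lambda>_. 0) = (\<lambda>i. if i = j then 1 else (0::'k))"
    using assms unfolding basic_seq_def by blast
  then show False by (metis one_neq_zero)
qed

text \<open>Successive approximation as in the open mapping theorem: the remainder of each stage is
  expanded approximately with geometrically decreasing bounds, and the coefficients of all stages
  are added.\<close>

lemma basic_seq_expands_norm:
  assumes z: "basic_seq X z"
  shows "\<exists>M\<ge>0. \<forall>y\<in>closed_span X (range z). expands z (M * N y) y"
proof -
  let ?E = "closed_span X (range z)"
  define q where "q = 1 / (2 * C)"
  have q: "0 < q" "q < 1" using C_ge_1 by (auto simp: q_def)
  have zV: "range z \<subseteq> V" by (rule basic_seq_V[OF z])
  then have zjV: "z j \<in> V" for j by auto
  have zpos: "0 < N (z j)" for j
    using N_nonneg[OF zjV, of j] N_eq_0[OF zjV, of j] basic_seq_nonzero[OF z, of j] by simp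
  obtain M where M: "0 \<le> M" and approx: "\<And>y \<epsilon>. y \<in> ?E \<Longrightarrow> 0 < \<epsilon> \<Longrightarrow> \<exists>y'. expands z (M * N y) y' \<and> N (y - y') < \<epsilon>"
    using expands_approx[OF z] by blast
  have "expands z (2 * C\<^sup>2 * M * N y) y" if y: "y \<in> ?E" for y
  proof (cases "y = 0")
    case True
    then show ?thesis using expands_0[OF zV] by simp
  next
    case False
    have yV: "y \<in> V" using y closed_span_subset by blast
    have Ny: "0 < N y" using False N_nonneg[OF yV] N_eq_0[OF yV] by simp
    define B where "B = M * N y"
    have B: "0 \<le> B" using M Ny by (simp add: B_def)
    \<comment> \<open>\<open>R i\<close> is the remainder before stage \<open>i\<close>, and
      \<open>R i - R (Suc i)\<close> is what stage \<open>i\<close> expands. The clause for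
      \<open>i = 0\<close> carries the starting value through the choice principle.\<close>
    have "\<exists>R. \<forall>i. (R i \<in> ?E \<and> N (R i) \<le> N y * q ^ i \<and> (i = 0 \<longrightarrow> R i = y)) \<and>
       (\<exists>a. qsums X a z (R i - R (Suc i)) \<and> (\<forall>n. N (\<Sum>j<n. sc (a j) (z j)) \<le> B * q ^ i))"
    proof (rule dependent_nat_choice)
      show "\<exists>x. x \<in> ?E \<and> N x \<le> N y * q ^ 0 \<and> ((0::nat) = 0 \<longrightarrow> x = y)" using y by auto
      fix R and i :: nat
      assume R: "R \<in> ?E \<and> N R \<le> N y * q ^ i \<and> (i = 0 \<longrightarrow> R = y)"
      have "0 < N y * q ^ Suc i" using Ny q by simp
      then obtain y' where y': "expands z (M * N R) y'" "N (R - y') < N y * q ^ Suc i"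
        using approx[of R "N y * q ^ Suc i"] R by blast
      obtain a where a: "qsums X a z y'" "\<And>n. N (\<Sum>j<n. sc (a j) (z j)) \<le> M * N R"
        using y'(1) unfolding expands_def by blast
      have "M * N R \<le> B * q ^ i" using R M by (simp add: B_def mult.assoc mult_left_mono)
      then have a': "\<And>n. N (\<Sum>j<n. sc (a j) (z j)) \<le> B * q ^ i" using a(2) order_trans by blast
      have "R - y' \<in> ?E" using R qsums_closed_span[OF zV a(1)] closed_span_diff[OF zV] by blast
      moreover have "qsums X a z (R - (R - y'))" using a(1) by simp
      ultimately show "\<exists>R'. (R' \<in> ?E \<and> N R' \<le> N y * q ^ Suc i \<and> (Suc i = 0 \<longrightarrow> R' = y)) \<and>
         (\<exists>a. qsums X a z (R - R') \<and> (\<forall>n. N (\<Sum>j<n. sc (a j) (z j)) \<le> B * q ^ i))"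
        using y'(2) a' by (intro exI[of _ "R - y'"] conjI exI[of _ a]) auto
    qed
    then obtain R where R: "\<And>i. R i \<in> ?E" "\<And>i. N (R i) \<le> N y * q ^ i" "R 0 = y"
      and ex: "\<And>i. \<exists>a. qsums X a z (R i - R (Suc i)) \<and> (\<forall>n. N (\<Sum>j<n. sc (a j) (z j)) \<le> B * q ^ i)"
      by blast
    from choice[of "\<lambda>i a. qsums X a z (R i - R (Suc i)) \<and> (\<forall>n. N (\<Sum>j<n. sc (a j) (z j)) \<le> B * q ^ i)"] ex
    obtain a where a: "\<And>i. qsums X (a i) z (R i - R (Suc i))" "\<And>i n. N (\<Sum>j<n. sc (a i j) (z j)) \<le> B * q ^ i"
      by blast
    have RV: "R i \<in> V" for i using R closed_span_subset by blast
    define T where "T = (\<lambda>I n. \<Sum>j<n. sc (\<Sum>i<I. a i j) (z j))"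
    have T: "T I n = (\<Sum>i<I. \<Sum>j<n. sc (a i j) (z j))" for I n
      unfolding T_def scale_sum_left by (rule sum.swap)
    have TV: "T I n \<in> V" for I n unfolding T_def by (rule partial_sum_in_V[OF zV])
    \<comment> \<open>A coefficient is recovered from two consecutive partial sums, so it inherits
      their geometric decay in \<open>i\<close>.\<close>
    have coef: "norm (a i j) \<le> (2 * C * B / N (z j)) * q ^ i" for i j
    proof -
      have "norm (a i j) * N (z j) = N ((\<Sum>k<Suc j. sc (a i k) (z k)) - (\<Sum>k<j. sc (a i k) (z k)))"
        using N_scale[OF zjV] by simp
      also have "\<dots> \<le> C * (B * q ^ i + B * q ^ i)"
        by (intro N_diff_le a partial_sum_in_V zV)
      finally show ?thesis using zpos[of j] by (simp add: field_simps)
    qed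
    have summ: "summable (\<lambda>i. a i j)" for j
      by (rule summable_comparison_test'[of "\<lambda>i. (2 * C * B / N (z j)) * q ^ i" 0])
         (use coef q in \<open>auto intro!: summable_mult summable_geometric\<close>)
    define b where "b = (\<lambda>j. \<Sum>i. a i j)"
    define S where "S = (\<lambda>n. \<Sum>j<n. sc (b j) (z j))"
    have SV: "S n \<in> V" for n unfolding S_def by (rule partial_sum_in_V[OF zV])
    \<comment> \<open>The bound is uniform in \<open>n\<close>, which permits interchanging the
      limits in \<open>n\<close> and \<open>I\<close>.\<close>
    have tail: "N (S n - T I n) \<le> C * (2 * C * B * q ^ I)" for n I
    proof (rule qlim_norm_le[where s = "\<lambda>J. T J n - T I n" and k = I])
      have "(\<lambda>J. b j - (\<Sum>i<J. a i j)) \<longlonglongrightarrow> b j - b j" for j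
        unfolding b_def by (intro tendsto_intros summable_LIMSEQ summ)
      then have "(\<lambda>J. N (\<Sum>j<n. sc (b j - (\<Sum>i<J. a i j)) (z j))) \<longlonglongrightarrow> 0"
        by (intro finite_combination_tendsto_0 zV) simp
      then show "(\<lambda>J. N (S n - T I n - (T J n - T I n))) \<longlonglongrightarrow> 0"
        by (simp add: S_def T_def scale_left_diff_distrib sum_subtractf)
      fix J assume J: "I \<le> J"
      have "T J n - T I n = (\<Sum>i\<in>{I..<J}. \<Sum>j<n. sc (a i j) (z j))"
        unfolding T lessThan_atLeast0 by (rule sum_diff_nat_ivl) (use J in auto)
      also have "N \<dots> \<le> 2 * C * B * (1 / (2 * C)) ^ I"
        by (rule N_sum_geometric) (use a B in \<open>auto simp: q_def intro!: partial_sum_in_V zV\<close>)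
      finally show "N (T J n - T I n) \<le> 2 * C * B * q ^ I" by (simp add: q_def)
    qed (intro V_simps SV TV)+
    have limT: "(\<lambda>n. N (T I n - (y - R I))) \<longlonglongrightarrow> 0" for I
    proof -
      have "qlim X (\<lambda>n. \<Sum>i<I. \<Sum>j<n. sc (a i j) (z j)) (\<Sum>i<I. R i - R (Suc i))"
        using a(1) unfolding qsums_def by (intro qlim_sum)
      then show ?thesis unfolding qlim_def T sum_lessThan_telescope' R(3) by blast
    qed
    have "(\<lambda>n. N (S n - y)) \<longlonglongrightarrow> 0"
    proof (rule LIMSEQ_I)
      fix \<epsilon> :: real assume e: "0 < \<epsilon>"
      define D where "D = 2 * C ^ 3 * B + C\<^sup>2 * N y"
      have "(\<lambda>I. D * q ^ I) \<longlonglongrightarrow> 0" unfolding q_def by (rule geometric_tendsto_0)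
      then obtain I where I: "D * q ^ I < \<epsilon> / 2"
        using order_tendstoD(2)[of _ 0 _ "\<epsilon> / 2"] e unfolding eventually_sequentially by fastforce
      have C2: "0 < C\<^sup>2" using C_ge_1 by simp
      then have "0 < \<epsilon> / (2 * C\<^sup>2)" using e by simp
      from order_tendstoD(2)[OF limT this] obtain n0
        where n0: "\<And>n. n0 \<le> n \<Longrightarrow> N (T I n - (y - R I)) < \<epsilon> / (2 * C\<^sup>2)"
        unfolding eventually_sequentially by blast
      have "norm (N (S n - y) - 0) < \<epsilon>" if "n0 \<le> n" for n
      proof -
        \<comment> \<open>Three pieces: the first and the last are small once \<open>I\<close> is
          large, for all \<open>n\<close>; the middle one is small for large \<open>n\<close> with
          \<open>I\<close> fixed.\<close>
        have "N ((S n - T I n) + ((T I n - (y - R I)) - R I))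
          \<le> C * (C * (2 * C * B * q ^ I) + C * (N (T I n - (y - R I)) + N y * q ^ I))"
          by (intro N_add_le N_diff_le V_simps SV TV yV RV tail order_refl R)
        also have "\<dots> = D * q ^ I + C\<^sup>2 * N (T I n - (y - R I))"
          by (simp add: D_def algebra_simps power2_eq_square power3_eq_cube)
        also have "\<dots> < \<epsilon> / 2 + C\<^sup>2 * (\<epsilon> / (2 * C\<^sup>2))"
          using I n0[OF that] C2 by (intro add_strict_mono mult_strict_left_mono)
        also have "\<dots> = \<epsilon>" using C2 by simp
        finally show ?thesis using N_nonneg[of "S n - y"] SV yV by (simp add: V_simps)
      qed
      then show "\<exists>no. \<forall>n\<ge>no. norm (N (S n - y) - 0) < \<epsilon>" by blast
    qed
    then have "qsums X b z y" unfolding qsums_def qlim_def using SV yV by (auto simp: S_def)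
    moreover have "N (S n) \<le> 2 * C\<^sup>2 * M * N y" for n
      using tail[of n 0] by (simp add: T_def B_def power2_eq_square mult.assoc mult.left_commute)
    ultimately show ?thesis unfolding expands_def S_def by blast
  qed
  moreover have "0 \<le> 2 * C\<^sup>2 * M" using M by simp
  ultimately show ?thesis by blast
qed

text \<open>By uniqueness a finite combination is its own expansion, so the bound on its partial
  sums from \<open>basic_seq_expands_norm\<close> applies to it.\<close>

lemma basis_constant:
  assumes z: "basic_seq X z"
  shows "\<exists>M\<ge>0. \<forall>a m n. m \<le> n \<longrightarrow> N (\<Sum>j<m. sc (a j) (z j)) \<le> M * N (\<Sum>j<n. sc (a j) (z j))"
proof -
  have zV: "range z \<subseteq> V" by (rule basic_seq_V[OF z])
  obtain M where M: "0 \<le> M" and ex: "\<And>y. y \<in> closed_span X (range z) \<Longrightarrow> expands z (M * N y) y"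
    using basic_seq_expands_norm[OF z] by blast
  have "N (\<Sum>j<m. sc (a j) (z j)) \<le> M * N (\<Sum>j<n. sc (a j) (z j))" if "m \<le> n" for a m n
  proof -
    define b where "b = (\<lambda>j. if j < n then a j else 0)"
    have b: "(\<Sum>j<m. sc (b j) (z j)) = (\<Sum>j<m. sc (a j) (z j))" if "m \<le> n" for m
      using that by (intro sum.cong) (auto simp: b_def)
    define y where "y = (\<Sum>j<n. sc (a j) (z j))"
    have yE: "y \<in> closed_span X (range z)"
      unfolding y_def by (intro span_subset_closed_span zV span_sum span_scale span_base rangeI)
    have qb: "qsums X b z y"
      using qsums_finite[OF zV, of "{..<n}" b] b[of n] by (simp add: y_def b_def)
    obtain c where c: "qsums X c z y" "\<And>n. N (\<Sum>j<n. sc (c j) (z j)) \<le> M * N y"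
      using ex[OF yE] unfolding expands_def by blast
    have "c = b" using z yE qb c(1) unfolding basic_seq_def by blast
    then show ?thesis using c(2)[of m] b[OF that] by (simp add: y_def)
  qed
  with M show ?thesis by blast
qed

end

section \<open>Perturbations and spreading sequences\<close>

context quasi_banach_space
begin

text \<open>Otherwise \<open>v\<close> lies in the closed span and has an expansion. The projection
  onto the first \<open>m\<close> terms kills combinations of later terms, which come arbitrarily
  close to \<open>v\<close>; bounded projections then make all partial sums of \<open>v\<close>
  vanish.\<close>

lemma far_from_tails:
  assumes z: "basic_seq X z" and v: "v \<in> V" "v \<noteq> 0"
  shows "\<exists>n0 \<delta>. 0 < \<delta> \<and> (\<forall>F a. finite F \<longrightarrow> F \<subseteq> {n0..} \<longrightarrow> \<delta> \<le> N (v - (\<Sum>j\<in>F. sc (a j) (z j))))"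
proof (rule ccontr)
  assume "\<not> ?thesis"
  then have near: "\<And>n0 \<delta>. 0 < \<delta> \<Longrightarrow> \<exists>F a. finite F \<and> F \<subseteq> {n0..} \<and> N (v - (\<Sum>j\<in>F. sc (a j) (z j))) < \<delta>"
    by (meson not_le)
  have zV: "range z \<subseteq> V" by (rule basic_seq_V[OF z])
  have "v \<in> closed_span X (range z)"
    using near by (intro closed_span_limit zV v) blast
  then obtain d where d: "qsums X d z v" using z unfolding basic_seq_def by blast
  obtain M where M: "0 \<le> M" "\<And>a m n. m \<le> n \<Longrightarrow> N (\<Sum>j<m. sc (a j) (z j)) \<le> M * N (\<Sum>j<n. sc (a j) (z j))"
    using basis_constant[OF z] by blast
  define S where "S = (\<lambda>n. \<Sum>j<n. sc (d j) (z j))"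
  have SV: "S n \<in> V" for n unfolding S_def by (rule partial_sum_in_V[OF zV])
  have lim: "(\<lambda>n. N (S n - v)) \<longlonglongrightarrow> 0" using d by (simp add: qsums_def qlim_def S_def)
  have small: "N (S m) \<le> M * (C * (\<delta> + \<delta>))" if \<delta>: "0 < \<delta>" for m \<delta>
  proof -
    obtain F a where F: "finite F" "F \<subseteq> {m..}" "N (v - (\<Sum>j\<in>F. sc (a j) (z j))) < \<delta>"
      using near[OF \<delta>] by blast
    obtain n1 where n1: "\<And>n. n1 \<le> n \<Longrightarrow> N (S n - v) < \<delta>"
      using order_tendstoD(2)[OF lim \<delta>] unfolding eventually_sequentially by blast
    obtain n2 where n2: "\<And>j. j \<in> F \<Longrightarrow> j < n2" using F(1) finite_nat_bounded by blast
    define n where "n = max m (max n1 n2)"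
    \<comment> \<open>Coefficients of an almost vanishing combination; below \<open>m\<close> they
      agree with \<open>d\<close>, because \<open>F\<close> lies beyond \<open>m\<close>.\<close>
    define e where "e = (\<lambda>j. d j - (if j \<in> F then a j else 0))"
    have FV: "(\<Sum>j\<in>F. sc (a j) (z j)) \<in> V" by (rule partial_sum_in_V[OF zV])
    have "(\<Sum>j<n. sc (if j \<in> F then a j else 0) (z j)) = (\<Sum>j\<in>F. sc (a j) (z j))"
      using n2 by (intro sum.mono_neutral_cong_right) (fastforce simp: n_def)+
    then have 1: "(\<Sum>j<n. sc (e j) (z j)) = (S n - v) + (v - (\<Sum>j\<in>F. sc (a j) (z j)))"
      by (simp add: e_def S_def scale_left_diff_distrib sum_subtractf)
    have "S m = (\<Sum>j<m. sc (e j) (z j))"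
      unfolding S_def e_def using F(2) by (intro sum.cong) auto
    also have "N \<dots> \<le> M * N (\<Sum>j<n. sc (e j) (z j))"
      by (rule M(2)) (simp add: n_def)
    also have "\<dots> \<le> M * (C * (\<delta> + \<delta>))"
      unfolding 1 using less_imp_le[OF n1[of n]] less_imp_le[OF F(3)]
      by (intro mult_left_mono M N_add_le subspace_diff[OF V] SV v FV) (simp_all add: n_def)
    finally show ?thesis .
  qed
  have "S m = 0" for m
  proof -
    have "N (S m) \<le> \<epsilon>" if "0 < \<epsilon>" for \<epsilon>
    proof -
      have "0 < M * C + 1" using M C_ge_1 by (simp add: add_nonneg_pos)
      then have "0 < \<epsilon> / (M * C + 1) / 2" using that by simp
      from small[OF this, of m]
      have "N (S m) \<le> (M * C) * (\<epsilon> / (M * C + 1))"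
        unfolding field_sum_of_halves by (simp only: mult.assoc)
      also have "\<dots> \<le> (M * C + 1) * (\<epsilon> / (M * C + 1))"
        using \<open>0 < M * C + 1\<close> that by (intro mult_right_mono) auto
      also have "\<dots> = \<epsilon>" using \<open>0 < M * C + 1\<close> by simp
      finally show ?thesis .
    qed
    then have "N (S m) \<le> 0" by (rule field_le_epsilon) simp
    then show ?thesis using N_nonneg[OF SV, of m] N_eq_0[OF SV, of m] by simp
  qed
  then have "N (- v) = 0" using lim by (simp add: LIMSEQ_const_iff)
  then show False using v N_minus N_eq_0 by simp
qed

lemma qsums_add_vectors:
  "qsums X a x u \<Longrightarrow> qsums X a y v \<Longrightarrow> qsums X a (\<lambda>j. x j + y j) (u + v)"
  unfolding qsums_def using qlim_add by (simp add: scale_right_distrib sum.distrib)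

lemma convergent_geometric:
  assumes "range x \<subseteq> V" "\<And>j. n0 \<le> j \<Longrightarrow> N (sc (a j) (x j)) \<le> (1 / (2 * C)) ^ j"
  shows "\<exists>u. qsums X a x u"
  unfolding convergent_series_iff[OF assms(1)]
proof (intro allI impI)
  fix \<epsilon> :: real assume "0 < \<epsilon>"
  from order_tendstoD(2)[OF geometric_tendsto_0 this, of "2 * C"] obtain n1
    where n1: "\<And>n. n1 \<le> n \<Longrightarrow> 2 * C * (1 / (2 * C)) ^ n < \<epsilon>"
    unfolding eventually_sequentially by blast
  have "N (\<Sum>j = m..<n. sc (a j) (x j)) < \<epsilon>" if "max n0 n1 \<le> m" "m \<le> n" for m n
  proof -
    have "N (\<Sum>j = m..<n. sc (a j) (x j)) \<le> 2 * C * 1 * (1 / (2 * C)) ^ m"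
      by (rule N_sum_geometric) (use assms that in \<open>auto intro!: V_simps\<close>)
    also have "\<dots> < \<epsilon>" using n1[of m] that by simp
    finally show ?thesis .
  qed
  then show "\<exists>n0. \<forall>m n. n0 \<le> m \<longrightarrow> m \<le> n \<longrightarrow> N (\<Sum>j = m..<n. sc (a j) (x j)) < \<epsilon>" by blast
qed

lemma convergent_terms:
  assumes "range x \<subseteq> V" "qsums X a x u" "0 < \<epsilon>"
  shows "\<exists>n0. \<forall>j\<ge>n0. N (sc (a j) (x j)) < \<epsilon>"
proof -
  obtain n0 where "\<forall>m n. n0 \<le> m \<longrightarrow> m \<le> n \<longrightarrow> N (\<Sum>j\<in>{m..<n}. sc (a j) (x j)) < \<epsilon>"
    using assms convergent_series_iff[OF assms(1)] by blast
  then have "\<forall>m\<ge>n0. N (\<Sum>j\<in>{m..<Suc m}. sc (a j) (x j)) < \<epsilon>" by (meson le_SucI order_refl)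
  then show ?thesis by auto
qed

text \<open>Ensures that the coefficients of a convergent series are eventually bounded.\<close>

definition bounded_away :: "(nat \<Rightarrow> 'v) \<Rightarrow> bool" where
  "bounded_away x \<longleftrightarrow> (\<exists>c>0. \<forall>\<^sub>F j in sequentially. c \<le> N (x j))"

text \<open>Convergence forces the coefficients to be at most 1 in modulus eventually, so the series
  of the differences is dominated by a geometric one.\<close>

lemma perturbation_convergent:
  assumes "range x \<subseteq> V" "range y \<subseteq> V" "bounded_away x"
    and close: "\<And>j. N (x j - y j) \<le> (1 / (2 * C)) ^ j" and "qsums X a x u"
  shows "\<exists>v. qsums X a y v"
proof -
  have xy: "x j \<in> V" "y j \<in> V" for j using assms by auto
  obtain c n0 where c: "0 < c" "\<And>j. n0 \<le> j \<Longrightarrow> c \<le> N (x j)"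
    using assms(3) unfolding bounded_away_def eventually_sequentially by blast
  obtain n1 where n1: "\<And>j. n1 \<le> j \<Longrightarrow> N (sc (a j) (x j)) < c"
    using convergent_terms[OF assms(1,5) c(1)] by blast
  have "\<exists>v. qsums X a (\<lambda>j. y j - x j) v"
  proof (rule convergent_geometric[of _ "max n0 n1"])
    show "range (\<lambda>j. y j - x j) \<subseteq> V" using xy by (auto intro!: V_simps)
    fix j assume j: "max n0 n1 \<le> j"
    have "norm (a j) * c \<le> norm (a j) * N (x j)" using c(2)[of j] j by (intro mult_left_mono) auto
    also have "\<dots> < c" using n1[of j] j N_scale[OF xy(1)] by simp
    finally have "norm (a j) \<le> 1" using c(1) by simp
    then have "norm (a j) * N (y j - x j) \<le> 1 * (1 / (2 * C)) ^ j"
      using close[of j] xy by (intro mult_mono) (auto simp: N_minus_commute V_simps N_nonneg)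
    then show "N (sc (a j) (y j - x j)) \<le> (1 / (2 * C)) ^ j"
      using N_scale[of "y j - x j" "a j"] xy by (simp add: V_simps)
  qed
  then obtain v where "qsums X a (\<lambda>j. y j - x j) v" by blast
  from qsums_add_vectors[OF assms(5) this] show ?thesis by auto
qed

lemma bounded_away_perturbation:
  assumes "range x \<subseteq> V" "range y \<subseteq> V" "bounded_away x"
    and close: "\<And>j. N (x j - y j) \<le> (1 / (2 * C)) ^ j"
  shows "bounded_away y"
proof -
  have xy: "x j \<in> V" "y j \<in> V" for j using assms by auto
  obtain c where c: "0 < c" "\<forall>\<^sub>F j in sequentially. c \<le> N (x j)"
    using assms(3) unfolding bounded_away_def by blast
  have "0 < c / (2 * C)" using c C_ge_1 by simp
  from order_tendstoD(2)[OF geometric_tendsto_0 this, of 1]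
  have "\<forall>\<^sub>F j in sequentially. (1 / (2 * C)) ^ j < c / (2 * C)" by simp
  with c(2) have "\<forall>\<^sub>F j in sequentially. c / (2 * C) \<le> N (y j)"
  proof eventually_elim
    case (elim j)
    have "N (y j + (x j - y j)) \<le> C * (N (y j) + c / (2 * C))"
      using close[of j] elim xy by (intro N_add_le V_simps) auto
    with elim(1) have "c \<le> C * (N (y j) + c / (2 * C))" by simp
    also have "\<dots> = C * N (y j) + c / 2" using C_ge_1 by (simp add: distrib_left)
    finally show ?case using C_ge_1 by (simp add: field_simps)
  qed
  then show ?thesis using \<open>0 < c / (2 * C)\<close> unfolding bounded_away_def by blast
qed

lemma perturbation:
  assumes "range x \<subseteq> V" "range y \<subseteq> V" "bounded_away x"
    and close: "\<And>j. N (x j - y j) \<le> (1 / (2 * C)) ^ j"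
  shows "equivalent_seqs X x X y"
proof -
  have "N (y j - x j) \<le> (1 / (2 * C)) ^ j" for j
    using close[of j] N_minus_commute[of "x j" "y j"] subsetD[OF assms(1) rangeI] subsetD[OF assms(2) rangeI]
    by simp
  then show ?thesis
    unfolding equivalent_seqs_def
    using perturbation_convergent assms bounded_away_perturbation[OF assms] by metis
qed

text \<open>Otherwise a subsequence satisfies
  \<open>N (z (\<phi> k)) < N (z k) * (1 / (2 * C)) ^ k\<close>. With the coefficients
  \<open>1 / N (z k)\<close> the series along the subsequence converges, while along
  \<open>z\<close> all terms have quasi-norm 1.\<close>

lemma spreading_bounded_below:
  assumes "range z \<subseteq> V" and nz: "\<And>j. z j \<noteq> 0"
    and spread: "\<And>\<phi>. strict_mono \<phi> \<Longrightarrow> equivalent_seqs X (z \<circ> \<phi>) X z"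
  shows "\<exists>c>0. \<forall>j. c \<le> N (z j)"
proof (rule ccontr)
  assume "\<not> ?thesis"
  then have small: "\<And>c. 0 < c \<Longrightarrow> \<exists>j. N (z j) < c" by (meson not_le)
  have zV: "z j \<in> V" for j using assms(1) by auto
  have pos: "0 < N (z j)" for j using N_nonneg[OF zV, of j] N_eq_0[OF zV, of j] nz[of j] by simp
  have "\<exists>j>m. N (z j) < c" if "0 < c" for c m
  proof -
    \<comment> \<open>The minimum over the indices up to \<open>m\<close> forces the index found
      below to exceed \<open>m\<close>.\<close>
    define c' where "c' = min c (Min ((\<lambda>j. N (z j)) ` {..m}))"
    have "0 < c'" using that pos by (simp add: c'_def)
    then obtain j where j: "N (z j) < c'" using small by blast
    have "\<not> j \<le> m"
    proof
      assume "j \<le> m"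
      with j show False by (auto simp: c'_def)
    qed
    with j show ?thesis by (auto simp: c'_def)
  qed
  then have "\<exists>\<phi>. strict_mono \<phi> \<and> (\<forall>k. N (z (\<phi> k)) < N (z k) * (1 / (2 * C)) ^ k)"
    using pos C_ge_1 by (intro ex_strict_mono_frequently) simp
  then obtain \<phi> where \<phi>: "strict_mono \<phi>" "\<And>k. N (z (\<phi> k)) < N (z k) * (1 / (2 * C)) ^ k" by blast
  define a where "a = (\<lambda>j. of_real (1 / N (z j)) :: 'k)"
  have a: "norm (a j) = 1 / N (z j)" for j using pos[of j] by (simp add: a_def norm_divide)
  have "\<exists>u. qsums X a (z \<circ> \<phi>) u"
  proof (rule convergent_geometric[of _ 0])
    show "range (z \<circ> \<phi>) \<subseteq> V" using zV by auto
    fix j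
    have "N (sc (a j) ((z \<circ> \<phi>) j)) = N (z (\<phi> j)) / N (z j)" using N_scale[OF zV] a by simp
    also have "\<dots> \<le> (1 / (2 * C)) ^ j"
      using \<phi>(2)[of j] pos[of j] by (simp add: pos_divide_le_eq mult.commute)
    finally show "N (sc (a j) ((z \<circ> \<phi>) j)) \<le> (1 / (2 * C)) ^ j" .
  qed
  then obtain u where "qsums X a z u" using spread[OF \<phi>(1)] unfolding equivalent_seqs_def by blast
  from convergent_terms[OF assms(1) this zero_less_one]
  obtain n0 where "N (sc (a n0) (z n0)) < 1" by blast
  then show False using N_scale[OF zV, of "a n0" n0] a[of n0] pos[of n0] by simp
qed

text \<open>The dual argument: coefficients that make the series along \<open>z\<close> geometric
  leave terms of quasi-norm above 1 along a fast growing subsequence.\<close>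

lemma spreading_bounded_above:
  assumes "range z \<subseteq> V" and nz: "\<And>j. z j \<noteq> 0"
    and spread: "\<And>\<phi>. strict_mono \<phi> \<Longrightarrow> equivalent_seqs X (z \<circ> \<phi>) X z"
  shows "\<exists>B. \<forall>j. N (z j) \<le> B"
proof (rule ccontr)
  assume "\<not> ?thesis"
  then have large: "\<And>B. \<exists>j. B < N (z j)" by (meson not_le)
  have zV: "z j \<in> V" for j using assms(1) by auto
  have pos: "0 < N (z j)" for j using N_nonneg[OF zV, of j] N_eq_0[OF zV, of j] nz[of j] by simp
  have "\<exists>j>m. B < N (z j)" for B m
  proof -
    obtain j where j: "max B (Max ((\<lambda>j. N (z j)) ` {..m})) < N (z j)" using large by blast
    have "\<not> j \<le> m"
    proof
      assume "j \<le> m"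
      with j show False by auto
    qed
    with j show ?thesis by auto
  qed
  then have "\<exists>\<phi>. strict_mono \<phi> \<and> (\<forall>k. N (z k) / (1 / (2 * C)) ^ k < N (z (\<phi> k)))"
    by (intro ex_strict_mono_frequently)
  then obtain \<phi> where \<phi>: "strict_mono \<phi>" "\<And>k. N (z k) / (1 / (2 * C)) ^ k < N (z (\<phi> k))" by blast
  have q: "0 < (1 / (2 * C)) ^ j" for j using C_ge_1 by simp
  define a where "a = (\<lambda>j. of_real ((1 / (2 * C)) ^ j / N (z j)) :: 'k)"
  have a: "norm (a j) = (1 / (2 * C)) ^ j / N (z j)" for j
    unfolding a_def norm_of_real using pos[of j] q[of j] by (intro abs_of_nonneg) simp
  have "\<exists>u. qsums X a z u"
    by (rule convergent_geometric[of _ 0]) (use assms(1) N_scale[OF zV] a pos in \<open>auto simp: less_imp_neq[symmetric]\<close>)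
  then obtain u where u: "qsums X a (z \<circ> \<phi>) u" using spread[OF \<phi>(1)] unfolding equivalent_seqs_def by blast
  have "range (z \<circ> \<phi>) \<subseteq> V" using zV by auto
  from convergent_terms[OF this u zero_less_one]
  obtain n0 where "N (sc (a n0) ((z \<circ> \<phi>) n0)) < 1" by blast
  then have "((1 / (2 * C)) ^ n0 / N (z n0)) * N (z (\<phi> n0)) < 1"
    using N_scale[OF zV, of "a n0" "\<phi> n0"] a[of n0] by simp
  moreover have "1 < ((1 / (2 * C)) ^ n0 / N (z n0)) * N (z (\<phi> n0))"
    using \<phi>(2)[of n0] pos[of n0] q[of n0] by (simp add: field_simps)
  ultimately show False by simp
qed

end

section \<open>Garling spaces as quasi-Banach spaces\<close>

lemma ex_strict_mono_enumeration:
  assumes "finite (A::'i::linorder set)"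
  shows "\<exists>q. strict_mono_on {..<card A} q \<and> q ` {..<card A} = A"
proof (intro exI conjI)
  let ?q = "inv_into A (idx A)"
  have bij: "bij_betw (idx A) A {..<card A}" by (rule bij_betw_idx[OF assms])
  have bij': "bij_betw ?q {..<card A} A" by (rule bij_betw_inv_into[OF bij])
  then show im: "?q ` {..<card A} = A" by (simp add: bij_betw_def)
  show "strict_mono_on {..<card A} ?q"
  proof (rule strict_mono_onI)
    fix i j assume ij: "i \<in> {..<card A}" "j \<in> {..<card A}" "i < j"
    then have "?q i \<in> A" "?q j \<in> A" using im by blast+
    moreover have "idx A (?q i) < idx A (?q j)"
      using ij bij by (simp add: bij_betw_inv_into_right)
    ultimately show "?q i < ?q j" using idx_less_iff[OF assms] by blast
  qed
qed

lemma ennroot_le_iff: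
  assumes "0 < p" "0 \<le> c"
  shows "ennroot p s \<le> ennreal c \<longleftrightarrow> s \<le> ennreal (c powr p)"
proof (cases s)
  case (real r)
  have "r powr (1 / p) \<le> c \<longleftrightarrow> r \<le> c powr p"
  proof
    assume "r powr (1 / p) \<le> c"
    then have "(r powr (1 / p)) powr p \<le> c powr p" using assms by (intro powr_mono2) auto
    then show "r \<le> c powr p" using assms real by (simp add: powr_powr)
  next
    assume "r \<le> c powr p"
    then have "r powr (1 / p) \<le> (c powr p) powr (1 / p)" using assms real by (intro powr_mono2) auto
    then show "r powr (1 / p) \<le> c" using assms by (simp add: powr_powr)
  qed
  then show ?thesis using real assms by (simp add: ennroot_def)
next
  case top
  then show ?thesis by (simp add: ennroot_def top_unique)
qed

lemma ennreal_eq_by_bounds: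
  assumes "\<And>c. 0 \<le> c \<Longrightarrow> s \<le> ennreal c \<longleftrightarrow> t \<le> ennreal c"
  shows "s = t"
proof (rule antisym)
  show "s \<le> t" using assms by (cases t) auto
  show "t \<le> s" using assms by (cases s) auto
qed

context garling
begin

lemma gsum_enumeration:
  assumes "strict_mono_on {..<n} q"
  shows "(\<Sum>i<n. ennreal (norm (x (q i)) powr p * w i)) = ennreal (gsum x (q ` {..<n}))"
proof -
  have inj: "inj_on q {..<n}" using assms by (rule strict_mono_on_imp_inj_on)
  have "idx (q ` {..<n}) (q i) = i" if "i < n" for i
  proof -
    have "idx (q ` {..<n}) (q i) = idx {..<n} i"
    proof (rule idx_image[OF _ inj])
      fix b assume "b \<in> {..<n}"
      then show "q b < q i \<longleftrightarrow> b < i"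
        using strict_mono_on_less[OF assms, of b i] that by simp
    qed
    also have "\<dots> = card {..<i}" unfolding idx_def using that by (intro arg_cong[where f = card]) auto
    finally show ?thesis by simp
  qed
  then have "gsum x (q ` {..<n}) = (\<Sum>i<n. norm (x (q i)) powr p * w i)"
    unfolding gsum_def sum.reindex[OF inj] by simp
  then show ?thesis by (simp add: sum_ennreal w_nonneg)
qed

lemma gQnorm_eq: "gQnorm w p y = ennroot p (gpow y)"
proof -
  have "Sup {\<Sum>i<N. ennreal (norm (y (q i)) powr p * w i) |N q. 1 \<le> N \<and> strict_mono_on {..<N} q} = gpow y"
    (is "Sup ?S = _")
  proof (rule antisym)
    show "Sup ?S \<le> gpow y"
      by (rule Sup_least) (auto simp: gsum_enumeration intro!: gsum_le_gpow)
    show "gpow y \<le> Sup ?S"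
    proof (rule gpow_leI)
      fix A :: "rat set" assume A: "finite A"
      show "ennreal (gsum y A) \<le> Sup ?S"
      proof (cases "A = {}")
        case False
        obtain q where q: "strict_mono_on {..<card A} q" "q ` {..<card A} = A"
          using ex_strict_mono_enumeration[OF A] by blast
        have "1 \<le> card A" using A False by (simp add: Suc_le_eq card_gt_0_iff)
        then have "ennreal (gsum y A) \<in> ?S"
          using gsum_enumeration[OF q(1), of y] q by (intro CollectI exI[of _ "card A"] exI[of _ q]) simp
        then show ?thesis by (rule Sup_upper)
      qed (simp add: gsum_def)
    qed
  qed
  then show ?thesis unfolding gQnorm_def by (simp only:)
qed

lemma suminf_le_gpow:
  assumes "strict_mono \<phi>"
  shows "(\<Sum>j. ennreal (norm (x (\<phi> j)) powr p * w j)) \<le> gpow x"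
proof -
  have "(\<Sum>j<n. ennreal (norm (x (\<phi> j)) powr p * w j)) \<le> gpow x" for n
  proof -
    have "strict_mono_on {..<n} \<phi>" using assms by (auto simp: strict_mono_on_def strict_mono_def)
    then show ?thesis by (subst gsum_enumeration) (auto intro: gsum_le_gpow)
  qed
  then show ?thesis by (simp add: suminf_eq_SUP SUP_le_iff)
qed

text \<open>The definition ranges over infinite increasing maps, \<open>gpow\<close> over finite
  sets. Comparing upper bounds avoids moving the root through the supremum.\<close>

lemma gnorm_eq: "gnorm w p x = ennroot p (gpow x)"
proof (rule ennreal_eq_by_bounds)
  fix c :: real assume c: "0 \<le> c"
  let ?s = "\<lambda>\<phi>. \<Sum>j. ennreal (norm (x (\<phi> j)) powr p * w j)"
  have "gnorm w p x \<le> ennreal c \<longleftrightarrow> (\<forall>\<phi>. strict_mono \<phi> \<longrightarrow> ?s \<phi> \<le> ennreal (c powr p))"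
    unfolding gnorm_def using ennroot_le_iff[OF p_pos c] by (simp add: SUP_le_iff)
  also have "\<dots> \<longleftrightarrow> gpow x \<le> ennreal (c powr p)"
  proof safe
    assume *: "\<forall>\<phi>. strict_mono \<phi> \<longrightarrow> ?s \<phi> \<le> ennreal (c powr p)"
    show "gpow x \<le> ennreal (c powr p)"
    proof (rule gpow_leI)
      fix A :: "nat set" assume A: "finite A"
      obtain q where q: "strict_mono_on {..<card A} q" "q ` {..<card A} = A"
        using ex_strict_mono_enumeration[OF A] by blast
      obtain b where b: "\<And>a. a \<in> A \<Longrightarrow> a < b" using A finite_nat_bounded by blast
      \<comment> \<open>A finite enumeration is prolonged beyond the maximum of \<open>A\<close>;
        the additional terms are nonnegative and do no harm.\<close>
      define \<phi> where "\<phi> = (\<lambda>i. if i < card A then q i else b + i)"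
      have "q i < b" if "i < card A" for i using b q(2) that by blast
      then have \<phi>: "strict_mono \<phi>"
        using strict_mono_onD[OF q(1)]
        by (auto simp: \<phi>_def strict_mono_def intro: less_le_trans trans_less_add1)
      have "ennreal (gsum x A) = (\<Sum>i<card A. ennreal (norm (x (\<phi> i)) powr p * w i))"
        using gsum_enumeration[OF q(1), of x] q(2) by (simp add: \<phi>_def)
      also have "\<dots> \<le> ?s \<phi>" by (intro sum_le_suminf) auto
      also have "\<dots> \<le> ennreal (c powr p)" using * \<phi> by blast
      finally show "ennreal (gsum x A) \<le> ennreal (c powr p)" .
    qed
  next
    fix \<phi> :: "nat \<Rightarrow> nat" assume "gpow x \<le> ennreal (c powr p)" "strict_mono \<phi>"
    then show "?s \<phi> \<le> ennreal (c powr p)" using suminf_le_gpow order_trans by blast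
  qed
  finally show "gnorm w p x \<le> ennreal c \<longleftrightarrow> ennroot p (gpow x) \<le> ennreal c"
    using ennroot_le_iff[OF p_pos c] by simp
qed

text \<open>One structure for every linearly ordered index type; both spaces of the theorem are
  instances by \<open>garling_space_eq\<close> and \<open>garlingQ_space_eq\<close>.\<close>

definition gspace :: "('k::real_normed_field, 'i::linorder \<Rightarrow> 'k) qspace" where
  "gspace = \<lparr>scl = fscl, vecs = {x. gpow x < \<infinity>}, qnorm = (\<lambda>x. enn2real (gpow x) powr (1 / p))\<rparr>"

lemma gspace_simps [simp]:
  "scl gspace = fscl" "x \<in> vecs gspace \<longleftrightarrow> gpow x < \<infinity>"
  "qnorm gspace x = enn2real (gpow x) powr (1 / p)"
  by (simp_all add: gspace_def)

lemma ennroot_less_top: "ennroot p s < \<infinity> \<longleftrightarrow> s < \<infinity>"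
  and enn2real_ennroot: "enn2real (ennroot p s) = enn2real s powr (1 / p)"
  by (auto simp: ennroot_def less_top)

lemma garling_space_eq: "garling_space w p = gspace" and garlingQ_space_eq: "garlingQ_space w p = gspace"
  by (simp_all add: garling_space_def garlingQ_space_def gspace_def gnorm_eq gQnorm_eq
      ennroot_less_top[simplified] enn2real_ennroot)

lemma vector_space_fscl: "vector_space (fscl :: 'k::real_normed_field \<Rightarrow> ('i \<Rightarrow> 'k) \<Rightarrow> 'i \<Rightarrow> 'k)"
  by unfold_locales (auto simp: fscl_def fun_eq_iff algebra_simps)

lemma qnorm_le_iff:
  assumes "gpow x < top" "0 \<le> c"
  shows "enn2real (gpow x) powr (1 / p) \<le> c \<longleftrightarrow> gpow x \<le> ennreal (c powr p)"
  using ennroot_le_iff[OF p_pos assms(2), of "gpow x"] assms by (simp add: ennroot_def less_top[symmetric])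

lemma qnorm_ge_iff:
  assumes "gpow x < top" "0 \<le> c"
  shows "c \<le> enn2real (gpow x) powr (1 / p) \<longleftrightarrow> ennreal (c powr p) \<le> gpow x"
proof -
  obtain r where r: "gpow x = ennreal r" "0 \<le> r" using assms(1) by (cases "gpow x") auto
  have "c \<le> r powr (1 / p) \<longleftrightarrow> c powr p \<le> r"
  proof
    assume "c \<le> r powr (1 / p)"
    then have "c powr p \<le> (r powr (1 / p)) powr p" using assms p_pos by (intro powr_mono2) auto
    then show "c powr p \<le> r" using p_pos r by (simp add: powr_powr)
  next
    assume "c powr p \<le> r"
    then have "(c powr p) powr (1 / p) \<le> r powr (1 / p)" using assms p_pos by (intro powr_mono2) auto
    then show "c \<le> r powr (1 / p)" using assms p_pos by (simp add: powr_powr)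
  qed
  with r show ?thesis by simp
qed

lemma quasi_banach_gspace:
  "quasi_banach (gspace :: ('k::{real_normed_field, banach}, 'i::linorder \<Rightarrow> 'k) qspace)"
  unfolding quasi_banach_def gspace_simps
proof (intro conjI ballI allI impI)
  let ?X = "gspace :: ('k, 'i \<Rightarrow> 'k) qspace"
  interpret vector_space "fscl :: 'k \<Rightarrow> ('i \<Rightarrow> 'k) \<Rightarrow> 'i \<Rightarrow> 'k" by (rule vector_space_fscl)
  show "vector_space (fscl :: 'k \<Rightarrow> ('i \<Rightarrow> 'k) \<Rightarrow> 'i \<Rightarrow> 'k)" by (rule vector_space_fscl)
  show "module.subspace fscl (vecs ?X)"
    unfolding subspace_def by (auto simp: gpow_add_less_top gpow_fscl ennreal_mult_less_top)
  fix x y :: "'i \<Rightarrow> 'k" and c :: 'k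
  assume x: "x \<in> vecs ?X"
  show "0 \<le> enn2real (gpow x) powr (1 / p)" by simp
  show "enn2real (gpow x) powr (1 / p) = 0 \<longleftrightarrow> x = 0"
    using x by (auto simp: enn2real_eq_0_iff gpow_eq_0_iff)
  show "enn2real (gpow (fscl c x)) powr (1 / p) = norm c * enn2real (gpow x) powr (1 / p)"
    using p_pos by (simp add: gpow_fscl enn2real_mult powr_mult powr_powr)
next
  show "\<exists>L. \<forall>x\<in>vecs (gspace :: ('k, 'i \<Rightarrow> 'k) qspace). \<forall>y\<in>vecs gspace. enn2real (gpow (x + y)) powr (1 / p)
    \<le> L * (enn2real (gpow x) powr (1 / p) + enn2real (gpow y) powr (1 / p))"
  proof (intro exI ballI)
    fix x y :: "'i \<Rightarrow> 'k" assume xy: "x \<in> vecs gspace" "y \<in> vecs gspace"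
    obtain r s where r: "gpow x = ennreal r" "0 \<le> r" and s: "gpow y = ennreal s" "0 \<le> s"
      using xy by (cases "gpow x"; cases "gpow y") auto
    have "gpow (x + y) \<le> ennreal (K * (r + s))"
      using gpow_add_le[of x y] K_gt_1 r s by (simp add: ennreal_mult)
    then have "enn2real (gpow (x + y)) \<le> K * (r + s)"
      using K_gt_1 r s by (intro enn2real_leI) auto
    also have "\<dots> \<le> 2 * K * max r s" using K_gt_1 by (simp add: max_def)
    finally have "enn2real (gpow (x + y)) powr (1 / p) \<le> (2 * K * max r s) powr (1 / p)"
      using p_pos by (intro powr_mono2) auto
    also have "\<dots> = (2 * K) powr (1 / p) * (max r s powr (1 / p))"
      using K_gt_1 r s by (simp add: powr_mult)
    also have "\<dots> \<le> (2 * K) powr (1 / p) * (r powr (1 / p) + s powr (1 / p))"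
      by (intro mult_left_mono) (auto simp: max_def)
    finally show "enn2real (gpow (x + y)) powr (1 / p) \<le>
      (2 * K) powr (1 / p) * (enn2real (gpow x) powr (1 / p) + enn2real (gpow y) powr (1 / p))"
      using r s by simp
  qed
next
  fix s :: "nat \<Rightarrow> 'i \<Rightarrow> 'k"
  assume Cauchy: "qCauchy gspace s"
  have "s n \<in> vecs gspace" for n using Cauchy unfolding qCauchy_def by blast
  then have sV: "gpow (s n) < top" for n by simp
  have small: "\<exists>n0. \<forall>m\<ge>n0. \<forall>n\<ge>n0. gpow (s m - s n) \<le> ennreal (\<epsilon> powr p)" if "0 < \<epsilon>" for \<epsilon>
  proof -
    have "\<forall>\<epsilon>>0. \<exists>n0. \<forall>m\<ge>n0. \<forall>n\<ge>n0. enn2real (gpow (s m - s n)) powr (1 / p) < \<epsilon>"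
      using Cauchy unfolding qCauchy_def gspace_simps(3) by (rule conjunct2)
    from this[rule_format, OF \<open>0 < \<epsilon>\<close>] obtain n0
      where n0: "\<And>m n. n0 \<le> m \<Longrightarrow> n0 \<le> n \<Longrightarrow> enn2real (gpow (s m - s n)) powr (1 / p) < \<epsilon>" by blast
    have V: "gpow (s m - s n) < top" for m n
      by (intro gpow_diff_less_top sV)
    have "gpow (s m - s n) \<le> ennreal (\<epsilon> powr p)" if "n0 \<le> m" "n0 \<le> n" for m n
      using qnorm_le_iff[OF V, of \<epsilon> m n] n0[OF that] \<open>0 < \<epsilon>\<close> by linarith
    then show ?thesis by blast
  qed
  have "Cauchy (\<lambda>n. s n i)" for i
  proof (rule metric_CauchyI)
    fix \<epsilon> :: real assume e: "0 < \<epsilon>"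
    obtain n0 where n0: "\<And>m n. n0 \<le> m \<Longrightarrow> n0 \<le> n \<Longrightarrow> gpow (s m - s n) \<le> ennreal ((\<epsilon> / 2) powr p)"
      using small[of "\<epsilon> / 2"] e by auto
    have "dist (s m i) (s n i) < \<epsilon>" if "n0 \<le> m" "n0 \<le> n" for m n
    proof -
      have "ennreal (norm ((s m - s n) i) powr p) \<le> ennreal ((\<epsilon> / 2) powr p)"
        using coord_le_gpow n0[OF that] order_trans by blast
      then have "norm (s m i - s n i) powr p \<le> (\<epsilon> / 2) powr p" by simp
      then have "norm (s m i - s n i) \<le> \<epsilon> / 2"
        using e p_pos powr_less_mono2[of p "\<epsilon> / 2" "norm (s m i - s n i)"] by (cases "norm (s m i - s n i) \<le> \<epsilon> / 2") auto
      then show ?thesis using e by (simp add: dist_norm)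
    qed
    then show "\<exists>M. \<forall>m\<ge>M. \<forall>n\<ge>M. dist (s m i) (s n i) < \<epsilon>" by blast
  qed
  then have "\<forall>i. \<exists>l. (\<lambda>n. s n i) \<longlonglongrightarrow> l" by (simp add: Cauchy_convergent_iff convergent_def)
  then obtain y where y: "\<And>i. (\<lambda>n. s n i) \<longlonglongrightarrow> y i" by metis
  \<comment> \<open>\<open>gpow_fatou\<close> turns the Cauchy estimate into an estimate for the
    distance to the coordinatewise limit.\<close>
  have lim: "\<exists>n0. \<forall>m\<ge>n0. gpow (s m - y) \<le> ennreal (\<epsilon> powr p)" if "0 < \<epsilon>" for \<epsilon>
  proof -
    obtain n0 where n0: "\<And>m n. n0 \<le> m \<Longrightarrow> n0 \<le> n \<Longrightarrow> gpow (s m - s n) \<le> ennreal (\<epsilon> powr p)"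
      using small[OF \<open>0 < \<epsilon>\<close>] by blast
    have "gpow (s m - y) \<le> ennreal (\<epsilon> powr p)" if "n0 \<le> m" for m
    proof (rule gpow_fatou[where x = "\<lambda>n. s m - s n"])
      show "(\<lambda>n. (s m - s n) i) \<longlonglongrightarrow> (s m - y) i" for i
        by (auto intro!: tendsto_intros y)
      show "\<forall>\<^sub>F n in sequentially. gpow (s m - s n) \<le> ennreal (\<epsilon> powr p)"
        using n0[OF that] by (rule eventually_sequentiallyI)
    qed
    then show ?thesis by blast
  qed
  have yV: "gpow y < top"
  proof -
    obtain n0 where "gpow (s n0 - y) \<le> ennreal (1 powr p)" using lim[of 1] by auto
    then have "gpow (s n0 - y) < top" using ennreal_less_top le_less_trans by blast
    then have "gpow (s n0 - (s n0 - y)) < top"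
      by (rule gpow_diff_less_top[OF sV])
    then show ?thesis by simp
  qed
  have dV: "gpow (s n - y) < top" for n
    by (intro gpow_diff_less_top sV yV)
  have "(\<lambda>n. enn2real (gpow (s n - y)) powr (1 / p)) \<longlonglongrightarrow> 0"
  proof (rule LIMSEQ_I)
    fix \<epsilon> :: real assume e: "0 < \<epsilon>"
    then obtain n0 where "\<And>m. n0 \<le> m \<Longrightarrow> gpow (s m - y) \<le> ennreal ((\<epsilon> / 2) powr p)"
      using lim[of "\<epsilon> / 2"] by auto
    then have "\<And>m. n0 \<le> m \<Longrightarrow> enn2real (gpow (s m - y)) powr (1 / p) \<le> \<epsilon> / 2"
      using qnorm_le_iff[OF dV, of "\<epsilon> / 2"] e by simp
    then show "\<exists>no. \<forall>n\<ge>no. norm (enn2real (gpow (s n - y)) powr (1 / p) - 0) < \<epsilon>"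
      using e by (intro exI[of _ n0]) force
  qed
  then show "\<exists>y. qlim gspace s y"
    unfolding qlim_def using sV yV by (intro exI[of _ y] conjI image_subsetI) simp_all
qed

end

section \<open>Successive flat vectors\<close>

definition disjoint_supp :: "(nat \<Rightarrow> 'i \<Rightarrow> 'k::zero) \<Rightarrow> bool" where
  "disjoint_supp y \<longleftrightarrow> (\<forall>k l i. k \<noteq> l \<longrightarrow> y k i = 0 \<or> y l i = 0)"

text \<open>Required for all pairs and not only for neighbours, as in \<open>generated_on_Q\<close>:
  a zero vector in between would break transitivity.\<close>

definition successive :: "(nat \<Rightarrow> 'i::linorder \<Rightarrow> 'k::zero) \<Rightarrow> bool" where
  "successive y \<longleftrightarrow> (\<forall>k l i j. k < l \<longrightarrow> y k i \<noteq> 0 \<longrightarrow> y l j \<noteq> 0 \<longrightarrow> i < j)"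

lemma successiveD: "successive y \<Longrightarrow> k < l \<Longrightarrow> y k i \<noteq> 0 \<Longrightarrow> y l j \<noteq> 0 \<Longrightarrow> i < j"
  unfolding successive_def by blast

lemma successive_subseq: "successive y \<Longrightarrow> strict_mono \<phi> \<Longrightarrow> successive (y \<circ> \<phi>)"
  unfolding successive_def strict_mono_def by auto

lemma successive_imp_disjoint: "successive y \<Longrightarrow> disjoint_supp y"
  unfolding successive_def disjoint_supp_def by (metis less_irrefl linorder_neqE_nat)

lemma disjoint_supp_inj: "disjoint_supp y \<Longrightarrow> inj \<sigma> \<Longrightarrow> disjoint_supp (y \<circ> \<sigma>)"
  unfolding disjoint_supp_def by (simp add: inj_eq)

lemma disjoint_sum_apply:
  fixes y :: "nat \<Rightarrow> 'i \<Rightarrow> 'k::real_normed_field"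
  assumes "disjoint_supp y" "finite F" "y k i \<noteq> 0"
  shows "(\<Sum>l\<in>F. fscl (a l) (y l)) i = (if k \<in> F then a k * y k i else 0)"
proof -
  have "(\<Sum>l\<in>F. a l * y l i) = (\<Sum>l\<in>F. if l = k then a k * y k i else 0)"
    using assms(1,3) unfolding disjoint_supp_def by (intro sum.cong refl) (metis mult_zero_right)
  then show ?thesis using assms(2) by (simp add: sum_fscl_apply)
qed

context garling
begin

lemma quasi_banach_space_gspace: "quasi_banach_space (gspace :: ('k::{real_normed_field, banach}, 'i::linorder \<Rightarrow> 'k) qspace)"
  by (rule quasi_banach_space.intro[OF quasi_banach_gspace])

lemma range_gspace: "(\<And>j. gpow (y j) < top) \<Longrightarrow> range y \<subseteq> vecs gspace"
  by auto

lemma gpow_finite_combination: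
  fixes y :: "nat \<Rightarrow> 'i::linorder \<Rightarrow> 'k::{real_normed_field, banach}"
  shows "(\<And>j. gpow (y j) < top) \<Longrightarrow> gpow (\<Sum>j\<in>F. fscl (a j) (y j)) < top"
  using quasi_banach_space.partial_sum_in_V[OF quasi_banach_space_gspace range_gspace, of y a F] by simp

lemma convergent_iff:
  fixes y :: "nat \<Rightarrow> 'i::linorder \<Rightarrow> 'k::{real_normed_field, banach}"
  assumes y: "\<And>j. gpow (y j) < top"
  shows "(\<exists>v. qsums gspace a y v) \<longleftrightarrow>
    (\<forall>\<epsilon>>0. \<exists>n0. \<forall>m n. n0 \<le> m \<longrightarrow> m \<le> n \<longrightarrow> gpow (\<Sum>j\<in>{m..<n}. fscl (a j) (y j)) \<le> ennreal \<epsilon>)"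
    (is "_ \<longleftrightarrow> ?R")
proof -
  let ?S = "\<lambda>m n. \<Sum>j\<in>{m..<n}. fscl (a j) (y j)"
  have fin: "gpow (?S m n) < top" for m n by (rule gpow_finite_combination[OF y])
  have "(\<exists>v. qsums gspace a y v) \<longleftrightarrow>
    (\<forall>\<epsilon>>0. \<exists>n0. \<forall>m n. n0 \<le> m \<longrightarrow> m \<le> n \<longrightarrow> enn2real (gpow (?S m n)) powr (1 / p) < \<epsilon>)" (is "_ \<longleftrightarrow> ?Q")
    using quasi_banach_space.convergent_series_iff[OF quasi_banach_space_gspace range_gspace[OF y], of a] by simp
  also have "\<dots> \<longleftrightarrow> ?R"
  proof safe
    fix \<epsilon> :: real assume Q: ?Q and e: "0 < \<epsilon>"
    then have "0 < \<epsilon> powr (1 / p)" by simp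
    from Q[rule_format, OF this] obtain n0
      where n0: "\<And>m n. n0 \<le> m \<Longrightarrow> m \<le> n \<Longrightarrow> enn2real (gpow (?S m n)) powr (1 / p) < \<epsilon> powr (1 / p)" by blast
    have "gpow (?S m n) \<le> ennreal \<epsilon>" if "n0 \<le> m" "m \<le> n" for m n
      using n0[OF that] qnorm_le_iff[OF fin, of "\<epsilon> powr (1 / p)" m n] e p_pos by (simp add: powr_powr)
    then show "\<exists>n0. \<forall>m n. n0 \<le> m \<longrightarrow> m \<le> n \<longrightarrow> gpow (?S m n) \<le> ennreal \<epsilon>" by blast
  next
    fix \<epsilon> :: real assume R: ?R and e: "0 < \<epsilon>"
    then have "0 < (\<epsilon> / 2) powr p" by simp
    from R[rule_format, OF this] obtain n0
      where n0: "\<And>m n. n0 \<le> m \<Longrightarrow> m \<le> n \<Longrightarrow> gpow (?S m n) \<le> ennreal ((\<epsilon> / 2) powr p)" by blast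
    have "enn2real (gpow (?S m n)) powr (1 / p) < \<epsilon>" if "n0 \<le> m" "m \<le> n" for m n
      using n0[OF that] qnorm_le_iff[OF fin, of "\<epsilon> / 2" m n] e by simp
    then show "\<exists>n0. \<forall>m n. n0 \<le> m \<longrightarrow> m \<le> n \<longrightarrow> enn2real (gpow (?S m n)) powr (1 / p) < \<epsilon>" by blast
  qed
  finally show ?thesis .
qed

lemma equivalent_gpow_eq:
  fixes y :: "nat \<Rightarrow> 'i::linorder \<Rightarrow> 'k::{real_normed_field, banach}"
    and z :: "nat \<Rightarrow> 'j::linorder \<Rightarrow> 'k"
  assumes "\<And>j. gpow (y j) < top" "\<And>j. gpow (z j) < top"
    and "\<And>a F. gpow (\<Sum>j\<in>F. fscl (a j) (y j)) = gpow (\<Sum>j\<in>F. fscl (a j) (z j))"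
  shows "equivalent_seqs gspace y gspace z"
  unfolding equivalent_seqs_def convergent_iff[OF assms(1)] convergent_iff[OF assms(2)] assms(3) by simp

text \<open>The index set is the disjoint union of all \<open>T k\<close>. Positions belonging to
  different \<open>k\<close> may coincide; comparing the orders across all pairs makes them coincide
  on both sides alike.\<close>

lemma gpow_combination_order_iso:
  fixes y :: "nat \<Rightarrow> 'i::linorder \<Rightarrow> 'k::real_normed_field" and z :: "nat \<Rightarrow> 'j::linorder \<Rightarrow> 'k"
    and \<alpha> :: "nat \<Rightarrow> 't \<Rightarrow> 'i" and \<beta> :: "nat \<Rightarrow> 't \<Rightarrow> 'j"
  assumes val: "\<And>k t. t \<in> T k \<Longrightarrow> y k (\<alpha> k t) = z k (\<beta> k t)"
    and order: "\<And>k l s t. s \<in> T k \<Longrightarrow> t \<in> T l \<Longrightarrow> \<alpha> k s < \<alpha> l t \<longleftrightarrow> \<beta> k s < \<beta> l t"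
    and supp: "\<And>k i. i \<notin> \<alpha> k ` T k \<Longrightarrow> y k i = 0" "\<And>k i. i \<notin> \<beta> k ` T k \<Longrightarrow> z k i = 0"
  shows "gpow (\<Sum>j\<in>F. fscl (a j) (y j)) = gpow (\<Sum>j\<in>F. fscl (a j) (z j))"
proof (rule gpow_order_iso[where U = "Sigma UNIV T" and \<alpha> = "\<lambda>(k, t). \<alpha> k t" and \<beta> = "\<lambda>(k, t). \<beta> k t"])
  have eq: "\<alpha> k s = \<alpha> l t \<longleftrightarrow> \<beta> k s = \<beta> l t" if "s \<in> T k" "t \<in> T l" for k l s t
    using order[OF that] order[OF that(2,1)] by (metis less_irrefl linorder_neqE)
  have val': "y k (\<alpha> l t) = z k (\<beta> l t)" if t: "t \<in> T l" for k l t
  proof (cases "\<alpha> l t \<in> \<alpha> k ` T k")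
    case True
    then obtain s where s: "s \<in> T k" "\<alpha> l t = \<alpha> k s" by blast
    then show ?thesis using val[OF s(1)] eq[OF t s(1)] by simp
  next
    case False
    then have "\<beta> l t \<notin> \<beta> k ` T k" using eq[OF t] by blast
    then show ?thesis using supp False by simp
  qed
  fix u assume u: "u \<in> Sigma UNIV T"
  obtain l t where lt: "u = (l, t)" "t \<in> T l" using u by auto
  then show "norm ((\<Sum>j\<in>F. fscl (a j) (y j)) (case u of (k, t) \<Rightarrow> \<alpha> k t)) =
      norm ((\<Sum>j\<in>F. fscl (a j) (z j)) (case u of (k, t) \<Rightarrow> \<beta> k t))"
    using val' by (simp add: sum_fscl_apply)
  fix v assume "v \<in> Sigma UNIV T"
  then show "(case u of (k, t) \<Rightarrow> \<alpha> k t) < (case v of (k, t) \<Rightarrow> \<alpha> k t) \<longleftrightarrow>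
      (case u of (k, t) \<Rightarrow> \<beta> k t) < (case v of (k, t) \<Rightarrow> \<beta> k t)"
    using order lt by (cases v) auto
next
  fix i assume "i \<notin> (\<lambda>(k, t). \<alpha> k t) ` Sigma UNIV T"
  then have "i \<notin> \<alpha> k ` T k" for k by force
  then show "(\<Sum>j\<in>F. fscl (a j) (y j)) i = 0" by (simp add: sum_fscl_apply supp)
next
  fix i assume "i \<notin> (\<lambda>(k, t). \<beta> k t) ` Sigma UNIV T"
  then have "i \<notin> \<beta> k ` T k" for k by force
  then show "(\<Sum>j\<in>F. fscl (a j) (z j)) i = 0" by (simp add: sum_fscl_apply supp)
qed

lemma equivalent_order_iso:
  fixes y :: "nat \<Rightarrow> 'i::linorder \<Rightarrow> 'k::{real_normed_field, banach}"
    and z :: "nat \<Rightarrow> 'j::linorder \<Rightarrow> 'k"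
    and \<alpha> :: "nat \<Rightarrow> 't \<Rightarrow> 'i" and \<beta> :: "nat \<Rightarrow> 't \<Rightarrow> 'j"
  assumes "\<And>k t. t \<in> T k \<Longrightarrow> y k (\<alpha> k t) = z k (\<beta> k t)"
    and "\<And>k l s t. s \<in> T k \<Longrightarrow> t \<in> T l \<Longrightarrow> \<alpha> k s < \<alpha> l t \<longleftrightarrow> \<beta> k s < \<beta> l t"
    and "\<And>k i. i \<notin> \<alpha> k ` T k \<Longrightarrow> y k i = 0" "\<And>k i. i \<notin> \<beta> k ` T k \<Longrightarrow> z k i = 0"
    and fin: "\<And>k. gpow (y k) < top"
  shows "equivalent_seqs gspace y gspace z" "gpow (z k) = gpow (y k)"
proof -
  have eq: "gpow (\<Sum>j\<in>F. fscl (a j) (y j)) = gpow (\<Sum>j\<in>F. fscl (a j) (z j))" for F a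
    by (rule gpow_combination_order_iso[where \<alpha> = \<alpha> and \<beta> = \<beta> and T = T]) (use assms in auto)
  show eq1: "gpow (z k) = gpow (y k)" for k
    using eq[of "\<lambda>_. 1" "{k}"] by (simp add: fscl_def)
  show "equivalent_seqs gspace y gspace z"
    by (rule equivalent_gpow_eq[OF fin _ eq]) (simp add: eq1 fin)
qed

text \<open>Before \<open>b\<close> come at most \<open>m\<close> elements from earlier sets, and
  elements of \<open>B k\<close> whose ranks in \<open>A k\<close> lie between \<open>m\<close> and
  the rank of \<open>b\<close>. The dropped initial part makes exactly the room that the earlier
  sets take.\<close>

lemma idx_concat_le:
  fixes A :: "nat \<Rightarrow> 'i::linorder set"
  assumes k: "k \<in> F" and b: "b \<in> B k" and "finite F" and fin: "\<And>j. finite (A j)"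
    and sub: "\<And>j. B j = {a \<in> A j. (\<Sum>i<j. card (A i)) \<le> idx (A j) a}"
    and succ: "\<And>i j a a'. i < j \<Longrightarrow> a \<in> A i \<Longrightarrow> a' \<in> A j \<Longrightarrow> a < a'"
  shows "idx (\<Union>j\<in>F. B j) b \<le> idx (A k) b"
proof -
  define m where "m = (\<Sum>i<k. card (A i))"
  have bA: "b \<in> A k" "m \<le> idx (A k) b" using b unfolding sub m_def by auto
  have "{b' \<in> (\<Union>j\<in>F. B j). b' < b} \<subseteq> (\<Union>j<k. A j) \<union> {b' \<in> B k. b' < b}"
  proof
    fix b' assume "b' \<in> {b' \<in> (\<Union>j\<in>F. B j). b' < b}"
    then obtain j where j: "j \<in> F" "b' \<in> B j" "b' < b" by blast
    then have "\<not> k < j" using succ[of k j b b'] bA sub by auto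
    then show "b' \<in> (\<Union>j<k. A j) \<union> {b' \<in> B k. b' < b}"
    proof (cases "j = k")
      case False
      with \<open>\<not> k < j\<close> have "j \<in> {..<k}" by simp
      then show ?thesis using j(2) sub by blast
    qed (use j in auto)
  qed
  then have "idx (\<Union>j\<in>F. B j) b \<le> card ((\<Union>j<k. A j) \<union> {b' \<in> B k. b' < b})"
    unfolding idx_def by (rule card_mono[rotated]) (use fin sub in auto)
  also have "\<dots> \<le> card (\<Union>j<k. A j) + card {b' \<in> B k. b' < b}" by (rule card_Un_le)
  also have "card (\<Union>j<k. A j) \<le> m" unfolding m_def by (rule card_UN_le) simp
  also have "card {b' \<in> B k. b' < b} \<le> card {m..<idx (A k) b}"
  proof (rule card_inj_on_le)
    show "inj_on (idx (A k)) {b' \<in> B k. b' < b}"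
      by (rule inj_on_subset[OF inj_on_idx[OF fin]]) (auto simp: sub)
    show "idx (A k) ` {b' \<in> B k. b' < b} \<subseteq> {m..<idx (A k) b}"
      using idx_less_iff[OF fin, of _ k b] bA by (auto simp: sub m_def)
  qed simp
  finally show ?thesis using bA by simp
qed

text \<open>The elements dropped from the \<open>k\<close>-th optimal set are as many as all earlier ones together, so in the
  concatenation the remaining ones keep at least their own weights.\<close>

lemma lp_lower_estimate:
  fixes v :: "nat \<Rightarrow> 'i::linorder \<Rightarrow> 'k::real_normed_field"
  assumes succ: "successive v" and \<delta>: "0 < \<delta>" and big: "\<And>k. ennreal \<delta> < gpow (v k)"
    and flat: "\<And>\<epsilon>. 0 < \<epsilon> \<Longrightarrow> \<forall>\<^sub>F k in sequentially. \<forall>i. norm (v k i) powr p \<le> \<epsilon>"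
  shows "\<exists>\<phi>::nat \<Rightarrow> nat. strict_mono \<phi> \<and> (\<forall>F a. finite F \<longrightarrow>
    ennreal (\<delta> / 2 * (\<Sum>k\<in>F. norm (a k) powr p)) \<le> gpow (\<Sum>k\<in>F. fscl (a k) (v (\<phi> k))))"
proof -
  have "\<exists>A. finite A \<and> (\<forall>a\<in>A. v k a \<noteq> 0) \<and> \<delta> < gsum (v k) A" for k
  proof -
    obtain A where A: "finite A" "ennreal \<delta> < ennreal (gsum (v k) A)" using big by (rule less_gpowE)
    \<comment> \<open>Zeros are removed because \<open>successive\<close> orders only the
      supports.\<close>
    have "gsum (v k) A \<le> gsum (v k) {a \<in> A. v k a \<noteq> 0}"
      by (rule gsum_le_subset) (use A in auto)
    then show ?thesis using A \<delta> by (intro exI[of _ "{a \<in> A. v k a \<noteq> 0}"]) (auto simp: ennreal_less_iff)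
  qed
  then obtain A where A: "\<And>k. finite (A k)" "\<And>k a. a \<in> A k \<Longrightarrow> v k a \<noteq> 0" "\<And>k. \<delta> < gsum (v k) (A k)"
    by metis
  have "\<forall>\<^sub>F k' in sequentially. \<forall>i. real (\<Sum>j\<le>k. card (A j)) * norm (v k' i) powr p \<le> \<delta> / 2" for k
  proof -
    define M where "M = real (\<Sum>j\<le>k. card (A j))"
    have M: "0 \<le> M" unfolding M_def by (rule of_nat_0_le_iff)
    then have "0 < \<delta> / 2 / (M + 1)" using \<delta> by simp
    from flat[OF this] show ?thesis
      unfolding M_def[symmetric]
    proof eventually_elim
      case (elim k')
      have "M * norm (v k' i) powr p \<le> \<delta> / 2" for i
      proof -
        have "M * norm (v k' i) powr p \<le> (M + 1) * (\<delta> / 2 / (M + 1))"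
          using elim M by (intro mult_mono) auto
        also have "\<dots> = \<delta> / 2"
          unfolding times_divide_eq_right[of "M + 1" "\<delta> / 2" "M + 1"]
          using M by (intro nonzero_mult_div_cancel_left) simp
        finally show ?thesis .
      qed
      then show ?case by blast
    qed
  qed
  \<comment> \<open>Flatness allows a subsequence so sparse that the p-th power of any coordinate,
    times the number of elements of all earlier sets, is at most \<open>\<delta> / 2\<close>;
    dropping that many elements then costs at most half of the norm.\<close>
  from ex_strict_mono_chain[of "\<lambda>k k'. \<forall>i. real (\<Sum>j\<le>k. card (A j)) * norm (v k' i) powr p \<le> \<delta> / 2", OF this]
  obtain \<phi> where \<phi>: "strict_mono \<phi>"
    and small: "\<And>k i. real (\<Sum>j\<le>\<phi> k. card (A j)) * norm (v (\<phi> (Suc k)) i) powr p \<le> \<delta> / 2" by blast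
  define A' where "A' = (\<lambda>k. A (\<phi> k))"
  define u where "u = (\<lambda>k. v (\<phi> k))"
  have A': "\<And>k. finite (A' k)" "\<And>k a. a \<in> A' k \<Longrightarrow> u k a \<noteq> 0" "\<And>k. \<delta> < gsum (u k) (A' k)"
    using A by (auto simp: A'_def u_def)
  have usucc: "successive u" using successive_subseq[OF succ \<phi>] by (simp add: u_def o_def)
  define m where "m = (\<lambda>k. \<Sum>j<k. card (A' j))"
  have m: "real (m k) * norm (u k i) powr p \<le> \<delta> / 2" for k i
  proof (cases k)
    case (Suc l)
    have "m k = (\<Sum>j\<in>\<phi> ` {..l}. card (A j))"
      unfolding m_def A'_def Suc lessThan_Suc_atMost
      by (subst sum.reindex) (auto intro: inj_on_subset[OF strict_mono_imp_inj_on[OF \<phi>]])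
    also have "\<dots> \<le> (\<Sum>j\<le>\<phi> l. card (A j))"
      using \<phi> by (intro sum_mono2) (auto simp: strict_mono_less_eq)
    finally have "real (m k) * norm (u k i) powr p \<le> real (\<Sum>j\<le>\<phi> l. card (A j)) * norm (u k i) powr p"
      by (intro mult_right_mono of_nat_mono powr_ge_zero)
    with small[of l i] show ?thesis by (simp add: u_def Suc)
  qed (use \<delta> in \<open>simp add: m_def\<close>)
  define B where "B = (\<lambda>k. {a \<in> A' k. m k \<le> idx (A' k) a})"
  have lower: "\<delta> / 2 \<le> (\<Sum>b\<in>B k. norm (u k b) powr p * w (idx (A' k) b))" for k
  proof -
    let ?g = "\<lambda>b. norm (u k b) powr p * w (idx (A' k) b)"
    have "A' k = B k \<union> (A' k - B k)" by (auto simp: B_def)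
    then have "gsum (u k) (A' k) = sum ?g (B k \<union> (A' k - B k))" unfolding gsum_def by simp
    also have "\<dots> = sum ?g (B k) + sum ?g (A' k - B k)"
      by (rule sum.union_disjoint) (use A' in \<open>auto simp: B_def\<close>)
    also have "sum ?g (A' k - B k) \<le> \<delta> / 2"
    proof (cases "m k = 0")
      case True
      then show ?thesis using \<delta> by (simp add: B_def)
    next
      case False
      have "card (A' k - B k) \<le> card {..<m k}"
        by (rule card_inj_on_le[of "idx (A' k)"])
           (auto simp: B_def intro: inj_on_subset[OF inj_on_idx[OF A'(1)]])
      then have c: "card (A' k - B k) \<le> m k" by simp
      have "sum ?g (A' k - B k) \<le> real (card (A' k - B k)) * (\<delta> / 2 / real (m k))"
      proof (rule sum_bounded_above)
        fix b assume "b \<in> A' k - B k"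
        have "?g b \<le> norm (u k b) powr p" by (rule mult_left_le) (auto simp: w_le_1 w_nonneg)
        also have "\<dots> \<le> \<delta> / 2 / real (m k)" using m[of k b] False by (simp add: field_simps)
        finally show "?g b \<le> \<delta> / 2 / real (m k)" .
      qed
      also have "\<dots> \<le> real (m k) * (\<delta> / 2 / real (m k))"
        using c \<delta> by (intro mult_right_mono) auto
      finally show ?thesis using False by simp
    qed
    finally show ?thesis using A'(3)[of k] by simp
  qed
  have main: "ennreal (\<delta> / 2 * (\<Sum>k\<in>F. norm (a k) powr p)) \<le> gpow (\<Sum>k\<in>F. fscl (a k) (u k))"
    if F: "finite F" for F a
  proof -
    define x where "x = (\<Sum>k\<in>F. fscl (a k) (u k))"
    have finB: "finite (B k)" for k using A' by (simp add: B_def)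
    have xb: "x b = a k * u k b" if "k \<in> F" "b \<in> B k" for k b
      unfolding x_def using disjoint_sum_apply[OF successive_imp_disjoint[OF usucc] F, of k b a] that A'(2)
      by (auto simp: B_def)
    have idx: "idx (\<Union>j\<in>F. B j) b \<le> idx (A' k) b" if "k \<in> F" "b \<in> B k" for k b
    proof (rule idx_concat_le[where A = A' and B = B, OF that F A'(1)])
      show "B j = {a \<in> A' j. (\<Sum>i<j. card (A' i)) \<le> idx (A' j) a}" for j by (simp add: B_def m_def)
      show "a < a'" if "i < j" "a \<in> A' i" "a' \<in> A' j" for i j a a'
        using successiveD[OF usucc that(1)] A'(2) that by blast
    qed
    have "\<delta> / 2 * (\<Sum>k\<in>F. norm (a k) powr p) = (\<Sum>k\<in>F. norm (a k) powr p * (\<delta> / 2))"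
      by (simp add: sum_distrib_left mult.commute)
    also have "\<dots> \<le> (\<Sum>k\<in>F. norm (a k) powr p * (\<Sum>b\<in>B k. norm (u k b) powr p * w (idx (A' k) b)))"
      by (intro sum_mono mult_left_mono lower) auto
    also have "\<dots> \<le> (\<Sum>k\<in>F. \<Sum>b\<in>B k. norm (x b) powr p * w (idx (\<Union>j\<in>F. B j) b))"
      unfolding sum_distrib_left
    proof (intro sum_mono)
      fix k b assume kb: "k \<in> F" "b \<in> B k"
      have "norm (a k) powr p * (norm (u k b) powr p * w (idx (A' k) b)) = norm (x b) powr p * w (idx (A' k) b)"
        using xb[OF kb] by (simp add: norm_mult powr_mult)
      also have "\<dots> \<le> norm (x b) powr p * w (idx (\<Union>j\<in>F. B j) b)"
        using idx[OF kb] by (intro mult_left_mono w_le) auto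
      finally show "norm (a k) powr p * (norm (u k b) powr p * w (idx (A' k) b)) \<le>
        norm (x b) powr p * w (idx (\<Union>j\<in>F. B j) b)" .
    qed
    also have "\<dots> = gsum x (\<Union>j\<in>F. B j)"
      unfolding gsum_def
    proof (rule sum.UNION_disjoint[symmetric])
      show "\<forall>i\<in>F. \<forall>j\<in>F. i \<noteq> j \<longrightarrow> B i \<inter> B j = {}"
        using successive_imp_disjoint[OF usucc] A'(2) unfolding disjoint_supp_def B_def by blast
    qed (use F finB in auto)
    finally have "ennreal (\<delta> / 2 * (\<Sum>k\<in>F. norm (a k) powr p)) \<le> ennreal (gsum x (\<Union>j\<in>F. B j))"
      by (rule ennreal_leI)
    also have "\<dots> \<le> gpow x" using F finB by (intro gsum_le_gpow) auto
    finally show ?thesis by (simp add: x_def)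
  qed
  show ?thesis
    by (intro exI[of _ \<phi>] conjI allI impI \<phi>) (erule main[unfolded u_def])
qed

end

section \<open>Disjointly supported sequences\<close>

text \<open>The norm dominates every coordinate, and coordinate \<open>i\<close> of the partial sums
  is eventually \<open>a i\<close>; so the only possible limit is \<open>a\<close> itself.\<close>

lemma lp_convergent_iff:
  fixes a :: "nat \<Rightarrow> 'k::real_normed_field"
  assumes p: "0 < p"
  shows "(\<exists>v. qsums (lp_space p) a unit_vec v) \<longleftrightarrow> summable (\<lambda>j. norm (a j) powr p)"
proof -
  define S where "S = (\<lambda>n i. if i < n then a i else 0)"
  have S: "(\<Sum>j<n. fscl (a j) (unit_vec j)) = S n" for n
    by (auto simp: sum_fscl_apply unit_vec_def S_def fun_eq_iff if_distrib[of "\<lambda>x. a _ * x"] cong: if_cong)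
  have fin: "summable (\<lambda>j. norm (S n j) powr p)" for n
    by (rule summable_finite[of "{..<n}"]) (auto simp: S_def)
  have iff: "qsums (lp_space p) a unit_vec v \<longleftrightarrow> summable (\<lambda>j. norm (v j) powr p) \<and>
     (\<lambda>n. (\<Sum>j. norm ((S n - v) j) powr p) powr (1 / p)) \<longlonglongrightarrow> 0" for v
    unfolding qsums_def qlim_def using fin by (auto simp: lp_space_def S)
  show ?thesis
  proof
    assume summ: "summable (\<lambda>j. norm (a j) powr p)"
    have "(\<Sum>j. norm ((S n - a) j) powr p) = (\<Sum>j. norm (a (j + n)) powr p)" for n
    proof -
      have eq: "norm ((S n - a) j) powr p = (if j < n then 0 else norm (a j) powr p)" for j
        by (simp add: S_def)
      have s: "summable (\<lambda>j. norm ((S n - a) j) powr p)"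
        unfolding eq by (rule summable_comparison_test'[OF summ, of 0]) auto
      have "(\<Sum>j. norm ((S n - a) j) powr p) = (\<Sum>j. norm ((S n - a) (j + n)) powr p) + (\<Sum>j<n. norm ((S n - a) j) powr p)"
        by (rule suminf_split_initial_segment[OF s])
      then show ?thesis unfolding eq by simp
    qed
    moreover have "(\<lambda>n. (\<Sum>j. norm (a (j + n)) powr p) powr (1 / p)) \<longlonglongrightarrow> 0 powr (1 / p)"
      using p summ by (intro tendsto_powr' tendsto_const suminf_exist_split2)
        (auto intro!: always_eventually suminf_nonneg summable_ignore_initial_segment[of "\<lambda>j. norm (a j) powr p"])
    ultimately show "\<exists>v. qsums (lp_space p) a unit_vec v"
      unfolding iff using summ by (intro exI[of _ a]) simp
  next
    assume "\<exists>v. qsums (lp_space p) a unit_vec v"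
    then obtain v where v: "summable (\<lambda>j. norm (v j) powr p)"
      "(\<lambda>n. (\<Sum>j. norm ((S n - v) j) powr p) powr (1 / p)) \<longlonglongrightarrow> 0" unfolding iff by blast
    have dsumm: "summable (\<lambda>j. norm ((S n - v) j) powr p)" for n
    proof (rule summable_comparison_test'[of _ n])
      show "summable (\<lambda>j. norm (v j) powr p)" by (rule v)
    qed (simp add: S_def)
    have "norm (a i - v i) \<le> 0" for i
    proof (rule LIMSEQ_le_const[OF v(2)], intro exI[of _ "Suc i"] allI impI)
      fix n assume n: "Suc i \<le> n"
      have "(norm ((S n - v) i) powr p) powr (1 / p) \<le> (\<Sum>j. norm ((S n - v) j) powr p) powr (1 / p)"
        using p sum_le_suminf[OF dsumm, of "{i}" n] by (intro powr_mono2) auto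
      then show "norm (a i - v i) \<le> (\<Sum>j. norm ((S n - v) j) powr p) powr (1 / p)"
        using n p by (simp add: S_def powr_powr)
    qed
    then have "a = v" by (auto simp: fun_eq_iff)
    with v(1) show "summable (\<lambda>j. norm (a j) powr p)" by simp
  qed
qed

section \<open>Tails of vectors in the Garling space\<close>

context garling
begin

lemma gpow_disjoint_mono:
  fixes x y :: "nat \<Rightarrow> 'i::linorder \<Rightarrow> 'k::real_normed_field"
  assumes "disjoint_supp y" "finite F" "\<And>k i. x k i = 0 \<or> x k i = y k i"
  shows "gpow (\<Sum>k\<in>F. fscl (a k) (x k)) \<le> gpow (\<Sum>k\<in>F. fscl (a k) (y k))"
proof (rule gpow_mono)
  fix i
  have dx: "disjoint_supp x"
    unfolding disjoint_supp_def using assms(1,3) unfolding disjoint_supp_def by metis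
  show "norm ((\<Sum>k\<in>F. fscl (a k) (x k)) i) \<le> norm ((\<Sum>k\<in>F. fscl (a k) (y k)) i)"
  proof (cases "\<exists>k. x k i \<noteq> 0")
    case True
    then obtain k where k: "x k i \<noteq> 0" by blast
    then have k': "x k i = y k i" "y k i \<noteq> 0" using assms(3)[of k i] by auto
    have "(\<Sum>k\<in>F. fscl (a k) (x k)) i = (\<Sum>k\<in>F. fscl (a k) (y k)) i"
      unfolding disjoint_sum_apply[OF assms(1,2) k'(2)] disjoint_sum_apply[OF dx assms(2) k] k'(1) ..
    then show ?thesis by simp
  next
    case False
    then have "(\<Sum>k\<in>F. fscl (a k) (x k)) i = 0" by (simp add: sum_fscl_apply)
    then show ?thesis by simp
  qed
qed

text \<open>If the tails did not vanish, successive finite pieces of \<open>x\<close> would have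
  norms bounded below. They are flat, as \<open>x\<close> has few large coordinates, so by
  \<open>lp_lower_estimate\<close> arbitrarily many of them would add up beyond
  \<open>gpow x\<close>.\<close>

lemma gpow_tail:
  fixes x :: "nat \<Rightarrow> 'k::real_normed_field"
  assumes x: "gpow x < top" and \<epsilon>: "0 < \<epsilon>"
  shows "\<forall>\<^sub>F L in sequentially. gpow (\<lambda>i. if L \<le> i then x i else 0) \<le> ennreal \<epsilon>"
proof (rule ccontr)
  define t where "t = (\<lambda>L i. if L \<le> i then x i else 0)"
  assume "\<not> ?thesis"
  then have neg: "\<exists>L'\<ge>L. ennreal \<epsilon> < gpow (t L')" for L
    unfolding eventually_sequentially t_def by (meson not_le)
  have "ennreal \<epsilon> < gpow (t L)" for L
  proof -
    obtain L' where "L \<le> L'" "ennreal \<epsilon> < gpow (t L')" using neg by blast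
    moreover from this have "gpow (t L') \<le> gpow (t L)" by (intro gpow_mono) (auto simp: t_def)
    ultimately show ?thesis by (meson less_le_trans)
  qed
  then have "\<exists>A. finite A \<and> ennreal \<epsilon> < ennreal (gsum (t L) A)" for L by (meson less_gpowE)
  then obtain A where A: "\<And>L. finite (A L)" "\<And>L. ennreal \<epsilon> < ennreal (gsum (t L) (A L))" by metis
  have "\<forall>\<^sub>F L' in sequentially. \<forall>a\<in>A L. a < L'" for L
  proof -
    obtain b where "\<forall>a\<in>A L. a < b" using finite_nat_bounded[OF A(1)[of L]] by blast
    then show ?thesis by (intro eventually_sequentiallyI[of b]) auto
  qed
  from ex_strict_mono_chain[of "\<lambda>L L'. \<forall>a\<in>A L. a < L'", OF this]
  obtain \<phi> where \<phi>: "strict_mono \<phi>" "\<And>k a. a \<in> A (\<phi> k) \<Longrightarrow> a < \<phi> (Suc k)" by blast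
  define v where "v = (\<lambda>k i. if i \<in> A (\<phi> k) then t (\<phi> k) i else 0)"
  have vx: "v k i = 0 \<or> v k i = x i" for k i by (auto simp: v_def t_def)
  have succ: "successive v"
    unfolding successive_def
  proof (intro allI impI)
    fix k l i j assume kl: "k < l" and i: "v k i \<noteq> 0" and j: "v l j \<noteq> 0"
    have "i < \<phi> (Suc k)" using i \<phi>(2) by (auto simp: v_def split: if_splits)
    also have "\<phi> (Suc k) \<le> \<phi> l" using kl \<phi>(1) by (simp add: strict_mono_less_eq)
    also have "\<phi> l \<le> j" using j by (auto simp: v_def t_def split: if_splits)
    finally show "i < j" .
  qed
  have big: "ennreal \<epsilon> < gpow (v k)" for k
  proof -
    have "gsum (t (\<phi> k)) (A (\<phi> k)) = gsum (v k) (A (\<phi> k))" by (rule gsum_cong) (simp add: v_def)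
    then show ?thesis using A(2)[of "\<phi> k"] gsum_le_gpow[OF A(1), of "v k" "\<phi> k"] by simp
  qed
  have flat: "\<forall>\<^sub>F k in sequentially. \<forall>i. norm (v k i) powr p \<le> \<eta>" if "0 < \<eta>" for \<eta>
  proof -
    obtain b where b: "\<And>i. \<eta> \<le> norm (x i) powr p \<Longrightarrow> i < b"
      using finite_nat_bounded[OF finite_large_coords[OF _ \<open>0 < \<eta>\<close>, of x]] x by auto
    have "norm (v k i) powr p \<le> \<eta>" if k: "b \<le> k" for k i
    proof (cases "v k i = 0")
      case False
      then have "\<phi> k \<le> i" "v k i = x i" by (auto simp: v_def t_def split: if_splits)
      moreover have "k \<le> \<phi> k" by (rule strict_mono_imp_increasing[OF \<phi>(1)])
      ultimately show ?thesis using b[of i] k by force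
    qed (use \<open>0 < \<eta>\<close> in simp)
    then show ?thesis by (auto intro: eventually_sequentiallyI)
  qed
  obtain \<psi> :: "nat \<Rightarrow> nat" where \<psi>: "strict_mono \<psi>"
    and low: "\<And>F a. finite F \<Longrightarrow> ennreal (\<epsilon> / 2 * (\<Sum>k\<in>F. norm (a k) powr p)) \<le> gpow (\<Sum>k\<in>F. fscl (a k) (v (\<psi> k)))"
    using lp_lower_estimate[OF succ \<epsilon> big flat] by blast
  have "ennreal (\<epsilon> / 2 * real n) \<le> gpow x" for n
  proof -
    have "ennreal (\<epsilon> / 2 * real n) \<le> gpow (\<Sum>k<n. fscl 1 (v (\<psi> k)))"
      using low[of "{..<n}" "\<lambda>_. 1"] by simp
    also have "\<dots> \<le> gpow x"
    proof (rule gpow_mono)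
      fix i
      have d: "disjoint_supp (v \<circ> \<psi>)"
        by (intro successive_imp_disjoint successive_subseq succ \<psi>)
      show "norm ((\<Sum>k<n. fscl 1 (v (\<psi> k))) i) \<le> norm (x i)"
      proof (cases "\<exists>k. v (\<psi> k) i \<noteq> 0")
        case True
        then obtain k where k: "v (\<psi> k) i \<noteq> 0" by blast
        then show ?thesis
          using disjoint_sum_apply[OF d, of "{..<n}" k i "\<lambda>_. 1"] vx[of "\<psi> k" i] by auto
      qed (simp add: sum_fscl_apply)
    qed
    finally show ?thesis .
  qed
  moreover obtain n :: nat where "enn2real (gpow x) / (\<epsilon> / 2) < n" using reals_Archimedean2 by blast
  then have "enn2real (gpow x) < \<epsilon> / 2 * n" using \<epsilon> by (simp add: field_simps)
  then have "gpow x < ennreal (\<epsilon> / 2 * n)" using x by (metis ennreal_enn2real ennreal_lessI enn2real_nonneg le_less_trans)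
  ultimately show False by (meson not_le)
qed

section \<open>Disjointly supported sequences as basic sequences\<close>

lemma norm_le_qnorm:
  assumes "gpow x < top"
  shows "norm (x i) \<le> enn2real (gpow x) powr (1 / p)"
  using qnorm_ge_iff[OF assms, of "norm (x i)"] coord_le_gpow[of x i] by simp

lemma qsums_coord:
  assumes "qsums gspace a y v"
  shows "(\<lambda>n. \<Sum>j<n. a j * y j i) \<longlonglongrightarrow> v i"
proof -
  let ?S = "\<lambda>n. \<Sum>j<n. fscl (a j) (y j)"
  have "?S n \<in> vecs gspace" for n using assms unfolding qsums_def qlim_def gspace_simps(1) by blast
  then have S: "gpow (?S n) < top" for n by simp
  have v: "gpow v < top" using assms unfolding qsums_def qlim_def by simp
  have d: "gpow (?S n - v) < top" for n
    by (intro gpow_diff_less_top S v)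
  have lim: "(\<lambda>n. enn2real (gpow (?S n - v)) powr (1 / p)) \<longlonglongrightarrow> 0"
    using assms unfolding qsums_def qlim_def by simp
  have "(\<lambda>n. norm ((?S n - v) i)) \<longlonglongrightarrow> 0"
    by (rule tendsto_sandwich[OF _ _ tendsto_const lim])
       (intro always_eventually allI norm_ge_zero norm_le_qnorm d)+
  then have "(\<lambda>n. ?S n i - v i) \<longlonglongrightarrow> 0" by (simp add: tendsto_norm_zero_iff)
  then have "(\<lambda>n. ?S n i) \<longlonglongrightarrow> v i" by (rule LIM_zero_cancel)
  then show ?thesis by (simp only: sum_fscl_apply)
qed

lemma qsums_disjoint_coord:
  assumes "qsums gspace a y v" "disjoint_supp y" "y k i \<noteq> 0"
  shows "v i = a k * y k i"
proof -
  have "(\<Sum>j<n. a j * y j i) = a k * y k i" if "Suc k \<le> n" for n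
    using disjoint_sum_apply[OF assms(2), of "{..<n}" k i a] assms(3) that by (simp add: sum_fscl_apply)
  then have "(\<lambda>n. \<Sum>j<n. a j * y j i) \<longlonglongrightarrow> a k * y k i"
    by (intro tendsto_eventually eventually_sequentiallyI)
  with qsums_coord[OF assms(1)] show ?thesis by (rule LIMSEQ_unique)
qed

text \<open>Proportionality to \<open>y j\<close> on its support is cross-multiplied, so that it is
  preserved by sums and coordinatewise limits, and likewise vanishing off the supports. The last
  clause fails in the limit and serves only for finite approximants.\<close>

lemma span_disjoint:
  fixes y :: "nat \<Rightarrow> 'i::linorder \<Rightarrow> 'k::real_normed_field"
  assumes d: "disjoint_supp y" and z: "z \<in> module.span fscl (range y)"
  shows "\<exists>n0. (\<forall>j i i'. y j i \<noteq> 0 \<longrightarrow> y j i' \<noteq> 0 \<longrightarrow> z i * y j i' = z i' * y j i) \<and>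
     (\<forall>i. (\<forall>j. y j i = 0) \<longrightarrow> z i = 0) \<and> (\<forall>j\<ge>n0. \<forall>i. y j i \<noteq> 0 \<longrightarrow> z i = 0)"
proof -
  interpret vector_space "fscl :: 'k \<Rightarrow> ('i \<Rightarrow> 'k) \<Rightarrow> 'i \<Rightarrow> 'k" by (rule vector_space_fscl)
  show ?thesis
    using z
  proof (induct rule: span_induct_alt)
    case base
    show ?case by (intro exI[of _ 0]) simp
  next
    case (step c x z)
    then obtain k where k: "x = y k" by blast
    obtain n0 where z: "\<And>j i i'. y j i \<noteq> 0 \<Longrightarrow> y j i' \<noteq> 0 \<Longrightarrow> z i * y j i' = z i' * y j i"
      "\<And>i. (\<And>j. y j i = 0) \<Longrightarrow> z i = 0" "\<And>j i. n0 \<le> j \<Longrightarrow> y j i \<noteq> 0 \<Longrightarrow> z i = 0"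
      using step(2) by blast
    have yk: "y k i = 0" if "y j i \<noteq> 0" "j \<noteq> k" for j i using d that unfolding disjoint_supp_def by blast
    show ?case
    proof (intro exI[of _ "max n0 (Suc k)"] conjI allI impI)
      fix j i i' assume ji: "y j i \<noteq> 0" "y j i' \<noteq> 0"
      then show "(fscl c x + z) i * y j i' = (fscl c x + z) i' * y j i"
        using z(1)[OF ji] yk[OF ji(1)] yk[OF ji(2)] k
        by (cases "j = k") (auto simp: fscl_apply algebra_simps)
    next
      fix i assume "\<forall>j. y j i = 0"
      then show "(fscl c x + z) i = 0" using z(2) k by (simp add: fscl_apply)
    next
      fix j i assume j: "max n0 (Suc k) \<le> j" and ji: "y j i \<noteq> 0"
      then show "(fscl c x + z) i = 0" using z(3)[of j i] yk[OF ji] k by (simp add: fscl_apply)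
    qed
  qed
qed

text \<open>The coefficients of \<open>v\<close> are read off the supports one by one. Truncating
  \<open>v\<close> after \<open>n\<close> supports approximates it at least as well as any finite
  combination that uses no later term.\<close>

lemma basic_seq_disjoint:
  fixes y :: "nat \<Rightarrow> 'i::linorder \<Rightarrow> 'k::{real_normed_field, banach}"
  assumes d: "disjoint_supp y" and nz: "\<And>j. y j \<noteq> 0" and fin: "\<And>j. gpow (y j) < top"
  shows "basic_seq gspace y"
  unfolding basic_seq_def
proof (intro conjI ballI ex_ex1I)
  show "range y \<subseteq> vecs gspace" by (rule range_gspace[OF fin])
next
  fix v a b assume ab: "qsums gspace a y v" "qsums gspace b y v"
  show "a = b"
  proof
    fix k
    obtain i where i: "y k i \<noteq> 0" using nz[of k] by (auto simp: fun_eq_iff)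
    from qsums_disjoint_coord[OF ab(1) d i] qsums_disjoint_coord[OF ab(2) d i] i
    show "a k = b k" by simp
  qed
next
  fix v assume "v \<in> closed_span gspace (range y)"
  then have v: "gpow v < top"
    and near: "\<And>\<epsilon>. 0 < \<epsilon> \<Longrightarrow> \<exists>z\<in>module.span fscl (range y). enn2real (gpow (v - z)) powr (1 / p) < \<epsilon>"
    unfolding closed_span_def by auto
  have spanV: "gpow z < top" if "z \<in> module.span fscl (range y)" for z
  proof -
    have "z \<in> vecs gspace"
      by (rule quasi_banach_space.span_subset_V[OF quasi_banach_space_gspace range_gspace[OF fin]]) (use that in simp)
    then show ?thesis by simp
  qed
  have "\<exists>u. u \<in> module.span fscl (range y) \<and> enn2real (gpow (v - u)) powr (1 / p) < 1 / real (Suc n)" for n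
  proof -
    have "0 < 1 / real (Suc n)" by simp
    from near[OF this] show ?thesis by blast
  qed
  then have "\<exists>z. \<forall>n. z n \<in> module.span fscl (range y) \<and> enn2real (gpow (v - z n)) powr (1 / p) < 1 / real (Suc n)"
    by (intro choice allI)
  then obtain z where z: "\<And>n. z n \<in> module.span fscl (range y)" "\<And>n. enn2real (gpow (v - z n)) powr (1 / p) < 1 / real (Suc n)"
    by blast
  have dV: "gpow (v - z n) < top" for n
    by (intro gpow_diff_less_top v spanV[OF z(1)])
  have lim: "(\<lambda>n. z n i) \<longlonglongrightarrow> v i" for i
  proof -
    have "(\<lambda>n. norm ((v - z n) i)) \<longlonglongrightarrow> 0"
    proof (rule tendsto_sandwich[OF _ _ tendsto_const])
      show "(\<lambda>n. 1 / real (Suc n)) \<longlonglongrightarrow> 0" by (rule lim_1_over_n[THEN LIMSEQ_Suc])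
      show "\<forall>\<^sub>F n in sequentially. norm ((v - z n) i) \<le> 1 / real (Suc n)"
        using norm_le_qnorm[OF dV] z(2) by (intro always_eventually allI) (meson le_less_trans less_imp_le)
    qed simp
    then have "(\<lambda>n. (v - z n) i) \<longlonglongrightarrow> 0" by (simp only: tendsto_norm_zero_iff)
    then have "(\<lambda>n. v i - (v - z n) i) \<longlonglongrightarrow> v i - 0" by (intro tendsto_intros)
    then show ?thesis by simp
  qed
  have ratio: "v i * y j i' = v i' * y j i" if "y j i \<noteq> 0" "y j i' \<noteq> 0" for j i i'
  proof (rule LIMSEQ_unique)
    show "(\<lambda>n. z n i * y j i') \<longlonglongrightarrow> v i * y j i'" by (intro tendsto_intros lim)
    have "z n i * y j i' = z n i' * y j i" for n using span_disjoint[OF d z(1)[of n]] that by blast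
    then show "(\<lambda>n. z n i * y j i') \<longlonglongrightarrow> v i' * y j i" by (simp only:) (intro tendsto_intros lim)
  qed
  have off: "v i = 0" if "\<And>j. y j i = 0" for i
  proof (rule LIMSEQ_unique[OF lim])
    have "z n i = 0" for n using span_disjoint[OF d z(1)[of n]] that by blast
    then show "(\<lambda>n. z n i) \<longlonglongrightarrow> 0" by simp
  qed
  have "\<exists>a. \<forall>i. y j i \<noteq> 0 \<longrightarrow> v i = a * y j i" for j
  proof -
    obtain i' where i': "y j i' \<noteq> 0" using nz[of j] by (auto simp: fun_eq_iff)
    have "v i = (v i' / y j i') * y j i" if "y j i \<noteq> 0" for i
      using ratio[OF that i'] i' by (simp add: field_simps)
    then show ?thesis by blast
  qed
  then obtain a where a: "\<And>j i. y j i \<noteq> 0 \<Longrightarrow> v i = a j * y j i" by metis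
  define S where "S = (\<lambda>n. \<Sum>j<n. fscl (a j) (y j))"
  have SV: "gpow (S n) < top" for n unfolding S_def by (rule gpow_finite_combination[OF fin])
  have S: "S n i = (if k < n then v i else 0)" if "y k i \<noteq> 0" for n k i
    using disjoint_sum_apply[OF d, of "{..<n}" k i a] that a by (simp add: S_def)
  have S0: "S n i = 0" if "\<And>j. y j i = 0" for n i by (simp add: S_def sum_fscl_apply that)
  have dS: "gpow (S n - v) < top" for n
    by (intro gpow_diff_less_top v SV)
  have "(\<lambda>n. enn2real (gpow (S n - v)) powr (1 / p)) \<longlonglongrightarrow> 0"
  proof (rule LIMSEQ_I)
    fix \<epsilon> :: real assume "0 < \<epsilon>"
    from near[OF this] obtain u where u: "u \<in> module.span fscl (range y)" "enn2real (gpow (v - u)) powr (1 / p) < \<epsilon>"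
      by blast
    obtain n0 where n0: "\<And>j i. n0 \<le> j \<Longrightarrow> y j i \<noteq> 0 \<Longrightarrow> u i = 0" using span_disjoint[OF d u(1)] by blast
    have "enn2real (gpow (S n - v)) powr (1 / p) < \<epsilon>" if n: "n0 \<le> n" for n
    proof -
      \<comment> \<open>Coordinatewise: on the first \<open>n\<close> supports \<open>S n\<close>
        equals \<open>v\<close>, and on the later ones both \<open>S n\<close> and \<open>u\<close>
        vanish.\<close>
      have "gpow (S n - v) \<le> gpow (v - u)"
      proof (rule gpow_mono)
        fix i
        show "norm ((S n - v) i) \<le> norm ((v - u) i)"
        proof (cases "\<exists>k. y k i \<noteq> 0")
          case True
          then obtain k where k: "y k i \<noteq> 0" by blast
          then show ?thesis using S[OF k, of n] n0[of k i] n by auto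
        qed (use off S0 in auto)
      qed
      moreover have "gpow (v - u) < top"
        by (intro gpow_diff_less_top v spanV[OF u(1)])
      ultimately have "enn2real (gpow (S n - v)) powr (1 / p) \<le> enn2real (gpow (v - u)) powr (1 / p)"
        using p_pos by (intro powr_mono2 enn2real_mono) auto
      with u(2) show ?thesis by simp
    qed
    then show "\<exists>no. \<forall>n\<ge>no. norm (enn2real (gpow (S n - v)) powr (1 / p) - 0) < \<epsilon>" by auto
  qed
  then show "\<exists>a. qsums gspace a y v"
    unfolding qsums_def qlim_def gspace_simps S_def
    using SV[unfolded S_def] v by (intro exI[of _ a] conjI image_subsetI) simp_all
qed

text \<open>Disjointness survives permutations, so the unconditional part of subsymmetry comes for
  free.\<close>

lemma subsymmetric_disjoint:
  fixes y :: "nat \<Rightarrow> 'i::linorder \<Rightarrow> 'k::{real_normed_field, banach}"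
  assumes "disjoint_supp y" "\<And>j. y j \<noteq> 0" "\<And>j. gpow (y j) < top"
    and "\<And>\<phi>. strict_mono \<phi> \<Longrightarrow> equivalent_seqs gspace (y \<circ> \<phi>) gspace y"
  shows "subsymmetric gspace y"
  unfolding subsymmetric_def using assms
  by (auto intro!: basic_seq_disjoint disjoint_supp_inj bij_is_inj)

lemma equivalent_lp:
  fixes y :: "nat \<Rightarrow> 'i::linorder \<Rightarrow> 'k::{real_normed_field, banach}"
  assumes fin: "\<And>j. gpow (y j) < top" and c: "0 < c"
    and lower: "\<And>F a. finite F \<Longrightarrow> ennreal (c * (\<Sum>k\<in>F. norm (a k) powr p)) \<le> gpow (\<Sum>k\<in>F. fscl (a k) (y k))"
    and upper: "\<And>F a. finite F \<Longrightarrow> gpow (\<Sum>k\<in>F. fscl (a k) (y k)) \<le> ennreal (B * (\<Sum>k\<in>F. norm (a k) powr p))"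
  shows "equivalent_seqs gspace y (lp_space p :: ('k, nat \<Rightarrow> 'k) qspace) unit_vec"
  unfolding equivalent_seqs_def convergent_iff[OF fin] lp_convergent_iff[OF p_pos]
proof
  fix a :: "nat \<Rightarrow> 'k"
  let ?s = "\<lambda>m n. \<Sum>j\<in>{m..<n}. norm (a j) powr p"
  have s: "0 \<le> ?s m n" for m n by (intro sum_nonneg) auto
  have "summable (\<lambda>j. norm (a j) powr p) \<longleftrightarrow> (\<forall>\<epsilon>>0. \<exists>n0. \<forall>m\<ge>n0. \<forall>n. ?s m n < \<epsilon>)"
    unfolding summable_Cauchy using s by simp
  also have "\<dots> \<longleftrightarrow> (\<forall>\<epsilon>>0. \<exists>n0. \<forall>m n. n0 \<le> m \<longrightarrow> m \<le> n \<longrightarrow> gpow (\<Sum>j\<in>{m..<n}. fscl (a j) (y j)) \<le> ennreal \<epsilon>)"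
  proof safe
    fix \<epsilon> :: real assume e: "0 < \<epsilon>" and sm: "\<forall>\<epsilon>>0. \<exists>n0. \<forall>m\<ge>n0. \<forall>n. ?s m n < \<epsilon>"
    have "0 < \<epsilon> / (\<bar>B\<bar> + 1)" using e by simp
    from sm[rule_format, OF this] obtain n0 where n0: "\<And>m n. n0 \<le> m \<Longrightarrow> ?s m n < \<epsilon> / (\<bar>B\<bar> + 1)" by blast
    have "gpow (\<Sum>j\<in>{m..<n}. fscl (a j) (y j)) \<le> ennreal \<epsilon>" if "n0 \<le> m" for m n
    proof -
      have "B * ?s m n \<le> (\<bar>B\<bar> + 1) * (\<epsilon> / (\<bar>B\<bar> + 1))"
        using n0[OF that, of n] s[of m n] by (intro mult_mono) auto
      also have "\<dots> = \<epsilon>" by (simp add: add_nonneg_eq_0_iff)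
      finally show ?thesis using upper[of "{m..<n}" a] ennreal_leI order_trans by blast
    qed
    then show "\<exists>n0. \<forall>m n. n0 \<le> m \<longrightarrow> m \<le> n \<longrightarrow> gpow (\<Sum>j\<in>{m..<n}. fscl (a j) (y j)) \<le> ennreal \<epsilon>" by blast
  next
    fix \<epsilon> :: real assume e: "0 < \<epsilon>"
      and g: "\<forall>\<epsilon>>0. \<exists>n0. \<forall>m n. n0 \<le> m \<longrightarrow> m \<le> n \<longrightarrow> gpow (\<Sum>j\<in>{m..<n}. fscl (a j) (y j)) \<le> ennreal \<epsilon>"
    have "0 < c * \<epsilon> / 2" using e c by simp
    from g[rule_format, OF this] obtain n0
      where n0: "\<And>m n. n0 \<le> m \<Longrightarrow> m \<le> n \<Longrightarrow> gpow (\<Sum>j\<in>{m..<n}. fscl (a j) (y j)) \<le> ennreal (c * \<epsilon> / 2)" by blast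
    have "?s m n < \<epsilon>" if m: "n0 \<le> m" for m n
    proof (cases "m \<le> n")
      case True
      have "ennreal (c * ?s m n) \<le> ennreal (c * \<epsilon> / 2)"
        using lower[of "{m..<n}" a] n0[OF m True] by (simp add: order_trans)
      then have "c * ?s m n \<le> c * \<epsilon> / 2" using e c by (subst (asm) ennreal_le_iff) auto
      then have "c * ?s m n < c * \<epsilon>" using e c by (simp add: le_less_trans)
      then show ?thesis using c by simp
    qed (use e in simp)
    then show "\<exists>n0. \<forall>m\<ge>n0. \<forall>n. ?s m n < \<epsilon>" by blast
  qed
  finally show "(\<forall>\<epsilon>>0. \<exists>n0. \<forall>m n. n0 \<le> m \<longrightarrow> m \<le> n \<longrightarrow> gpow (\<Sum>j\<in>{m..<n}. fscl (a j) (y j)) \<le> ennreal \<epsilon>)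
    \<longleftrightarrow> summable (\<lambda>j. norm (a j) powr p)" by simp
qed

lemma gpow_disjoint_upper:
  fixes y :: "nat \<Rightarrow> 'i::linorder \<Rightarrow> 'k::real_normed_field"
  assumes "disjoint_supp y" "\<And>j. gpow (y j) \<le> ennreal B" "0 \<le> B"
  shows "gpow (\<Sum>k\<in>F. fscl (a k) (y k)) \<le> ennreal (B * (\<Sum>k\<in>F. norm (a k) powr p))"
proof -
  have "gpow (\<Sum>k\<in>F. fscl (a k) (y k)) \<le> (\<Sum>k\<in>F. ennreal (norm (a k) powr p) * gpow (y k))"
    by (rule gpow_sum_disjoint_le) (use assms(1) in \<open>simp add: disjoint_supp_def\<close>)
  also have "\<dots> \<le> (\<Sum>k\<in>F. ennreal (norm (a k) powr p) * ennreal B)"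
    by (intro sum_mono mult_left_mono assms) auto
  also have "\<dots> = ennreal (B * (\<Sum>k\<in>F. norm (a k) powr p))"
    using assms(3) by (simp add: ennreal_mult sum_distrib_left mult.commute flip: sum_ennreal)
  finally show ?thesis .
qed

definition away_from_zero :: "(nat \<Rightarrow> 'i::linorder \<Rightarrow> 'k::real_normed_field) \<Rightarrow> bool" where
  "away_from_zero x \<longleftrightarrow> (\<exists>c>0. \<forall>\<^sub>F j in sequentially. ennreal c \<le> gpow (x j))"

lemma bounded_away_iff:
  fixes x :: "nat \<Rightarrow> 'i::linorder \<Rightarrow> 'k::{real_normed_field, banach}"
  assumes "\<And>j. gpow (x j) < top"
  shows "quasi_banach_space.bounded_away gspace x \<longleftrightarrow> away_from_zero x"
  unfolding quasi_banach_space.bounded_away_def[OF quasi_banach_space_gspace] away_from_zero_def gspace_simps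
proof safe
  fix c :: real assume c: "0 < c" "\<forall>\<^sub>F j in sequentially. c \<le> enn2real (gpow (x j)) powr (1 / p)"
  then show "\<exists>c>0. \<forall>\<^sub>F j in sequentially. ennreal c \<le> gpow (x j)"
    by (intro exI[of _ "c powr p"]) (simp add: qnorm_ge_iff[OF assms])
next
  fix c :: real assume c: "0 < c" "\<forall>\<^sub>F j in sequentially. ennreal c \<le> gpow (x j)"
  then show "\<exists>c>0. \<forall>\<^sub>F j in sequentially. c \<le> enn2real (gpow (x j)) powr (1 / p)"
    using p_pos by (intro exI[of _ "c powr (1 / p)"]) (simp add: qnorm_ge_iff[OF assms] powr_powr)
qed

text \<open>The tolerances depend on the space alone, so they can be fixed before the sequences to
  be compared are built. They are the p-th powers of the bounds in
  \<open>perturbation\<close>.\<close>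

lemma ex_perturbation_tolerance:
  "\<exists>\<tau>::nat \<Rightarrow> real. (\<forall>j. 0 < \<tau> j) \<and> (\<forall>x y :: nat \<Rightarrow> 'i::linorder \<Rightarrow> 'k::{real_normed_field, banach}.
     (\<forall>j. gpow (x j) < top) \<longrightarrow> (\<forall>j. gpow (y j) < top) \<longrightarrow> away_from_zero x \<longrightarrow>
     (\<forall>j. gpow (x j - y j) \<le> ennreal (\<tau> j)) \<longrightarrow> equivalent_seqs gspace x gspace y \<and> away_from_zero y)"
proof -
  let ?X = "gspace :: ('k, 'i \<Rightarrow> 'k) qspace"
  interpret g: quasi_banach_space ?X by (rule quasi_banach_space_gspace)
  define \<tau> where "\<tau> = (\<lambda>j. ((1 / (2 * g.C)) ^ j) powr p)"
  show ?thesis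
  proof (intro exI[of _ \<tau>] conjI allI impI)
    show "0 < \<tau> j" for j using g.C_ge_1 by (simp add: \<tau>_def)
    fix x y :: "nat \<Rightarrow> 'i \<Rightarrow> 'k"
    assume fin: "\<forall>j. gpow (x j) < top" "\<forall>j. gpow (y j) < top" and away: "away_from_zero x"
      and close: "\<forall>j. gpow (x j - y j) \<le> ennreal (\<tau> j)"
    have "gpow (x j - y j) < top" for j
      using fin by (intro gpow_diff_less_top) auto
    then have N: "qnorm ?X (x j - y j) \<le> (1 / (2 * g.C)) ^ j" for j
      using close g.C_ge_1 by (simp add: qnorm_le_iff \<tau>_def)
    have ranges: "range x \<subseteq> vecs ?X" "range y \<subseteq> vecs ?X" using fin by auto
    have "g.bounded_away x" using away bounded_away_iff fin by blast
    then show "equivalent_seqs ?X x ?X y" "away_from_zero y"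
      using g.perturbation[OF ranges _ N] g.bounded_away_perturbation[OF ranges _ N] bounded_away_iff fin
      by blast+
  qed
qed

end

section \<open>Seeds and sequences generated on the rationals\<close>

definition place :: "('t \<Rightarrow> 'i) \<Rightarrow> 't set \<Rightarrow> ('t \<Rightarrow> 'k::zero) \<Rightarrow> 'i \<Rightarrow> 'k" where
  "place \<alpha> T c = (\<lambda>i. if i \<in> \<alpha> ` T then c (inv_into T \<alpha> i) else 0)"

lemma place_at: "inj_on \<alpha> T \<Longrightarrow> t \<in> T \<Longrightarrow> place \<alpha> T c (\<alpha> t) = c t"
  and place_off: "i \<notin> \<alpha> ` T \<Longrightarrow> place \<alpha> T c i = 0"
  by (simp_all add: place_def)

text \<open>Inserting at \<open>d n\<close> shifts everything from there on by one and never
  reorders old positions; the relative order of two indices is thus decided once and for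
  all.\<close>

lemma pos_perm_order:
  "i < n \<Longrightarrow> j < n \<Longrightarrow> pos_perm d (Suc n) i < pos_perm d (Suc n) j \<longleftrightarrow> pos_perm d n i < pos_perm d n j"
  by auto

lemma pos_perm_order_mono:
  assumes "m \<le> n" "i < m" "j < m"
  shows "pos_perm d n i < pos_perm d n j \<longleftrightarrow> pos_perm d m i < pos_perm d m j"
  using assms(1)
proof (induct rule: dec_induct)
  case (step n)
  then show ?case using pos_perm_order[of i n j d] assms by simp
qed simp

lemma pos_perm_less:
  assumes "positioning d"
  shows "j < n \<Longrightarrow> pos_perm d n j < n"
proof (induct n)
  case (Suc n)
  have "d n \<le> n" using assms by (simp add: positioning_def)
  then show ?case using Suc by (cases "j = n") (auto simp: less_Suc_eq_le)
qed simp

lemma inj_on_pos_perm: "inj_on (pos_perm d n) {..<n}"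
proof (induct n)
  case (Suc n)
  have ne: "pos_perm d (Suc n) j \<noteq> d n" if "j < n" for j using that by auto
  show ?case
  proof (rule inj_onI)
    fix i j assume ij: "i \<in> {..<Suc n}" "j \<in> {..<Suc n}" "pos_perm d (Suc n) i = pos_perm d (Suc n) j"
    show "i = j"
    proof (cases "i = n \<or> j = n")
      case True
      then show ?thesis using ij ne[of i] ne[of j] by (auto simp: less_Suc_eq simp del: pos_perm.simps(2)) simp_all
    next
      case False
      then have "pos_perm d n i = pos_perm d n j" using ij by (auto split: if_splits)
      then show ?thesis using False ij inj_onD[OF Suc, of i j] by simp
    qed
  qed
qed simp

lemma pos_perm_image:
  assumes "positioning d"
  shows "pos_perm d n ` {..<n} = {..<n}"
  by (rule endo_inj_surj) (use pos_perm_less[OF assms] inj_on_pos_perm in auto)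

text \<open>Eliminates the inverse permutations, leaving a comparison of two orders on indices as
  used by \<open>gpow_order_iso\<close>.\<close>

lemma compatible_seq_iff:
  assumes "positioning d"
  shows "compatible_seq d q \<longleftrightarrow> (\<forall>n i j. i < n \<longrightarrow> j < n \<longrightarrow> (q i < q j \<longleftrightarrow> pos_perm d n i < pos_perm d n j))"
proof
  assume *: "compatible_seq d q"
  show "\<forall>n i j. i < n \<longrightarrow> j < n \<longrightarrow> (q i < q j \<longleftrightarrow> pos_perm d n i < pos_perm d n j)"
  proof (intro allI impI)
    fix n i j :: nat assume ij: "i < n" "j < n"
    have "strict_mono_on {..<n} (\<lambda>i. q (inv_into {..<n} (pos_perm d n) i))"
      using * by (simp add: compatible_seq_def)
    from strict_mono_on_less[OF this, of "pos_perm d n i" "pos_perm d n j"]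
    show "q i < q j \<longleftrightarrow> pos_perm d n i < pos_perm d n j"
      using ij pos_perm_less[OF assms] inv_into_f_f[OF inj_on_pos_perm] by simp
  qed
next
  assume *: "\<forall>n i j. i < n \<longrightarrow> j < n \<longrightarrow> (q i < q j \<longleftrightarrow> pos_perm d n i < pos_perm d n j)"
  show "compatible_seq d q"
    unfolding compatible_seq_def
  proof (intro allI strict_mono_onI)
    fix n s t :: nat assume st: "s \<in> {..<n}" "t \<in> {..<n}" "s < t"
    then have im: "s \<in> pos_perm d n ` {..<n}" "t \<in> pos_perm d n ` {..<n}"
      by (simp_all add: pos_perm_image[OF assms])
    from inv_into_into[OF im(1)] inv_into_into[OF im(2)]
    show "q (inv_into {..<n} (pos_perm d n) s) < q (inv_into {..<n} (pos_perm d n) t)"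
      using * st f_inv_into_f[OF im(1)] f_inv_into_f[OF im(2)] by simp
  qed
qed

lemma compatible_seq_inj:
  assumes "positioning d" "compatible_seq d q"
  shows "inj q"
proof (rule injI)
  fix i j assume "q i = q j"
  then have "\<not> pos_perm d (Suc (max i j)) i < pos_perm d (Suc (max i j)) j"
    "\<not> pos_perm d (Suc (max i j)) j < pos_perm d (Suc (max i j)) i"
    using assms(2) unfolding compatible_seq_iff[OF assms(1)] by (metis less_Suc_eq_le less_irrefl max.cobounded1 max.cobounded2)+
  then have "pos_perm d (Suc (max i j)) i = pos_perm d (Suc (max i j)) j" by linarith
  then show "i = j" using inj_onD[OF inj_on_pos_perm, of d "Suc (max i j)" i j] by (simp add: less_Suc_eq_le)
qed

lemma seed_vec_diff:
  assumes "m \<le> n"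
  shows "seed_vec f d n n - seed_vec f d m n = (\<Sum>j\<in>{m..<n}. fscl (f j) (unit_vec (pos_perm d n j)))"
  unfolding seed_vec_def lessThan_atLeast0 using assms by (intro sum_diff_nat_ivl) auto

lemma seed_vec_diff_at:
  assumes "m \<le> j" "j < n"
  shows "(seed_vec f d n n - seed_vec f d m n) (pos_perm d n j) = f j"
proof -
  have "(\<Sum>k\<in>{m..<n}. f k * unit_vec (pos_perm d n k) (pos_perm d n j)) = (\<Sum>k\<in>{m..<n}. if k = j then f j else 0)"
    by (rule sum.cong) (use assms inj_onD[OF inj_on_pos_perm[of d n]] in \<open>auto simp: unit_vec_def\<close>)
  also have "\<dots> = f j" using assms by simp
  finally show ?thesis
    unfolding seed_vec_diff[OF order_trans[OF assms(1) less_imp_le[OF assms(2)]]] sum_fscl_apply .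
qed

lemma seed_vec_diff_off:
  assumes "m \<le> n" "i \<notin> pos_perm d n ` {m..<n}"
  shows "(seed_vec f d n n - seed_vec f d m n) i = 0"
  unfolding seed_vec_diff[OF assms(1)] sum_fscl_apply using assms(2)
  by (intro sum.neutral) (auto simp: unit_vec_def)

section \<open>Norms of seed tails\<close>

context garling
begin

lemma gpow_seed_vec_diff:
  fixes x :: "'i::linorder \<Rightarrow> 'k::real_normed_field" and q :: "nat \<Rightarrow> 'i"
  assumes "m \<le> n" and order: "\<And>i j. i < n \<Longrightarrow> j < n \<Longrightarrow> q i < q j \<longleftrightarrow> pos_perm d n i < pos_perm d n j"
    and "\<And>j. m \<le> j \<Longrightarrow> j < n \<Longrightarrow> x (q j) = f j" "\<And>i. i \<notin> q ` {m..<n} \<Longrightarrow> x i = 0"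
  shows "gpow x = gpow (seed_vec f d n n - seed_vec f d m n)"
proof (rule gpow_order_iso[where U = "{m..<n}" and \<alpha> = q and \<beta> = "pos_perm d n"])
  show "norm (x (q u)) = norm ((seed_vec f d n n - seed_vec f d m n) (pos_perm d n u))" if "u \<in> {m..<n}" for u
    using that assms(3)[of u] seed_vec_diff_at[of m u n f d] by simp
  show "(seed_vec f d n n - seed_vec f d m n) i = 0" if "i \<notin> pos_perm d n ` {m..<n}" for i
    by (rule seed_vec_diff_off[OF assms(1) that])
qed (use assms in auto)

lemma seed_tail_inf_eq_0_iff:
  fixes f :: "nat \<Rightarrow> 'k::real_normed_field"
  shows "seed_tail_inf w p f d = 0 \<longleftrightarrow>
    (\<forall>\<epsilon>>0. \<exists>m. \<forall>n\<ge>m. gpow (seed_vec f d n n - seed_vec f d m n) \<le> ennreal \<epsilon>)"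
proof -
  have le: "seed_tail w p f d m \<le> ennreal c \<longleftrightarrow>
    (\<forall>n\<ge>m. gpow (seed_vec f d n n - seed_vec f d m n) \<le> ennreal (c powr p))" if c: "0 \<le> c" for m c
  proof -
    have "seed_tail w p f d m \<le> ennreal c \<longleftrightarrow>
      (\<forall>n. m \<le> n \<and> 1 \<le> n \<longrightarrow> gpow (seed_vec f d n n - seed_vec f d m n) \<le> ennreal (c powr p))"
      unfolding seed_tail_def gnorm_eq SUP_le_iff using ennroot_le_iff[OF p_pos c] by simp
    also have "\<dots> \<longleftrightarrow> (\<forall>n\<ge>m. gpow (seed_vec f d n n - seed_vec f d m n) \<le> ennreal (c powr p))"
    proof safe
      fix n assume *: "\<forall>n. m \<le> n \<and> 1 \<le> n \<longrightarrow> gpow (seed_vec f d n n - seed_vec f d m n) \<le> ennreal (c powr p)" "m \<le> n"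
      show "gpow (seed_vec f d n n - seed_vec f d m n) \<le> ennreal (c powr p)"
      \<comment> \<open>The supremum in \<open>seed_tail\<close> omits \<open>n = 0\<close>; then
        \<open>m = 0\<close> as well and the difference is zero.\<close>
      proof (cases "n = 0")
        case True
        then have "seed_vec f d n n - seed_vec f d m n = 0" using *(2) by simp
        then show ?thesis by (simp only: gpow_0) simp
      qed (use * in auto)
    qed auto
    finally show ?thesis .
  qed
  show ?thesis
  proof
    assume 0: "seed_tail_inf w p f d = 0"
    show "\<forall>\<epsilon>>0. \<exists>m. \<forall>n\<ge>m. gpow (seed_vec f d n n - seed_vec f d m n) \<le> ennreal \<epsilon>"
    proof (intro allI impI)
      fix \<epsilon> :: real assume e: "0 < \<epsilon>"
      then have "seed_tail_inf w p f d < ennreal (\<epsilon> powr (1 / p))" using 0 by simp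
      then obtain m where "seed_tail w p f d m < ennreal (\<epsilon> powr (1 / p))"
        unfolding seed_tail_inf_def INF_less_iff by blast
      then have "seed_tail w p f d m \<le> ennreal (\<epsilon> powr (1 / p))" by (rule less_imp_le)
      then show "\<exists>m. \<forall>n\<ge>m. gpow (seed_vec f d n n - seed_vec f d m n) \<le> ennreal \<epsilon>"
        using le[of "\<epsilon> powr (1 / p)" m] e p_pos by (intro exI[of _ m]) (simp add: powr_powr)
    qed
  next
    assume *: "\<forall>\<epsilon>>0. \<exists>m. \<forall>n\<ge>m. gpow (seed_vec f d n n - seed_vec f d m n) \<le> ennreal \<epsilon>"
    have eps: "seed_tail_inf w p f d \<le> 0 + ennreal c" if c: "0 < c" for c
    proof -
      have "0 < c powr p" using c by simp
      from *[rule_format, OF this] obtain m where "seed_tail w p f d m \<le> ennreal c"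
        using le[of c] c by auto
      then show ?thesis unfolding seed_tail_inf_def by (simp add: INF_lower2)
    qed
    have "seed_tail_inf w p f d \<le> 0" by (rule ennreal_le_epsilon) (rule eps)
    then show "seed_tail_inf w p f d = 0" by simp
  qed
qed

lemma gpow_seed_vec_diff_antimono:
  fixes f :: "nat \<Rightarrow> 'k::real_normed_field"
  assumes "m \<le> m'" "m' \<le> n"
  shows "gpow (seed_vec f d n n - seed_vec f d m' n) \<le> gpow (seed_vec f d n n - seed_vec f d m n)"
proof (rule gpow_mono)
  fix i
  show "norm ((seed_vec f d n n - seed_vec f d m' n) i) \<le> norm ((seed_vec f d n n - seed_vec f d m n) i)"
  proof (cases "i \<in> pos_perm d n ` {m'..<n}")
    case True
    then obtain j where "i = pos_perm d n j" "m' \<le> j" "j < n" by auto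
    then show ?thesis using seed_vec_diff_at[of m' j n f d] seed_vec_diff_at[of m j n f d] assms by simp
  next
    case False
    then show ?thesis using seed_vec_diff_off[OF assms(2) False, of f] by simp
  qed
qed

text \<open>The vector without its first \<open>m\<close> coordinates is the coordinatewise limit of
  its pieces from \<open>m\<close> to \<open>n - 1\<close>, which have the norms of the seed
  tails.\<close>

lemma gpow_seed_remainder:
  fixes y :: "rat \<Rightarrow> 'k::real_normed_field"
  assumes "positioning d" "compatible_seq d q" "\<And>n. y (q n) = f n" "\<And>r. r \<notin> range q \<Longrightarrow> y r = 0"
    and bd: "\<And>n. m \<le> n \<Longrightarrow> gpow (seed_vec f d n n - seed_vec f d m n) \<le> c"
  shows "gpow (\<lambda>r. if r \<in> q ` {..<m} then 0 else y r) \<le> c"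
proof (rule gpow_fatou[where x = "\<lambda>n r. if r \<in> q ` {m..<n} then y r else 0"])
  have inj: "inj q" by (rule compatible_seq_inj[OF assms(1,2)])
  fix r
  show "(\<lambda>n. if r \<in> q ` {m..<n} then y r else 0) \<longlonglongrightarrow> (if r \<in> q ` {..<m} then 0 else y r)"
  proof (cases "r \<in> range q")
    case True
    then obtain j where j: "r = q j" by blast
    have "r \<in> q ` {m..<n} \<longleftrightarrow> r \<notin> q ` {..<m}" if "Suc j \<le> n" for n
      using that unfolding j inj_image_mem_iff[OF inj] by auto
    then show ?thesis by (intro tendsto_eventually eventually_sequentiallyI[of "Suc j"]) auto
  next
    case False
    then show ?thesis using assms(4)[OF False] by (simp add: image_iff)
  qed
next
  show "\<forall>\<^sub>F n in sequentially. gpow (\<lambda>r. if r \<in> q ` {m..<n} then y r else 0) \<le> c"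
  proof (rule eventually_sequentiallyI[of m])
    fix n assume n: "m \<le> n"
    have "gpow (\<lambda>r. if r \<in> q ` {m..<n} then y r else 0) = gpow (seed_vec f d n n - seed_vec f d m n)"
      by (rule gpow_seed_vec_diff[OF n, where q = q])
         (use assms(2,3) in \<open>auto simp: compatible_seq_iff[OF assms(1)]\<close>)
    with bd[OF n] show "gpow (\<lambda>r. if r \<in> q ` {m..<n} then y r else 0) \<le> c" by simp
  qed
qed

lemma lower_estimate_subseq:
  fixes y :: "nat \<Rightarrow> 'i::linorder \<Rightarrow> 'k::real_normed_field"
  assumes lower: "\<And>F a. finite F \<Longrightarrow> ennreal (c * (\<Sum>k\<in>F. norm (a k) powr p)) \<le> gpow (\<Sum>k\<in>F. fscl (a k) (y k))"
    and \<psi>: "strict_mono (\<psi>::nat \<Rightarrow> nat)" and F: "finite F"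
  shows "ennreal (c * (\<Sum>k\<in>F. norm (a k) powr p)) \<le> gpow (\<Sum>k\<in>F. fscl (a k) ((y \<circ> \<psi>) k))"
proof -
  have inj: "inj \<psi>" by (rule strict_mono_imp_inj_on[OF \<psi>])
  have 1: "(\<Sum>k\<in>\<psi> ` F. norm (a (inv \<psi> k)) powr p) = (\<Sum>k\<in>F. norm (a k) powr p)"
    using inj by (subst sum.reindex) (auto intro: inj_on_subset)
  have 2: "(\<Sum>k\<in>\<psi> ` F. fscl (a (inv \<psi> k)) (y k)) = (\<Sum>k\<in>F. fscl (a k) ((y \<circ> \<psi>) k))"
    using inj by (subst sum.reindex) (auto intro: inj_on_subset)
  show ?thesis using lower[of "\<psi> ` F" "\<lambda>k. a (inv \<psi> k)"] F unfolding 1 2 by simp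
qed

text \<open>Normalized constant blocks are flat, because their height tends to 0 with growing
  length. Every subsequence of the selected blocks is equivalent to the \<open>l_p\<close> basis,
  and spreading follows.\<close>

lemma lp_subsymmetric_in_garling:
  "\<exists>z::nat \<Rightarrow> nat \<Rightarrow> 'k::{real_normed_field, banach}. subsymmetric gspace z \<and>
     equivalent_seqs gspace z (lp_space p :: ('k, nat \<Rightarrow> 'k) qspace) unit_vec"
proof -
  define W where "W = (\<lambda>k. \<Sum>i<Suc k. w i)"
  have W: "0 < W k" for k unfolding W_def by (rule W_pos)
  \<comment> \<open>Block \<open>k\<close> has \<open>k + 1\<close> elements and starts at
    \<open>k * k\<close>; it ends before \<open>(k + 1) * (k + 1)\<close>.\<close>
  define I where "I = (\<lambda>k::nat. {k * k..<k * k + Suc k})"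
  \<comment> \<open>The height makes the weighted sum over the whole block equal to 1.\<close>
  define v where "v = (\<lambda>k i. if i \<in> I k then of_real (W k powr (- (1 / p))) else 0 :: 'k)"
  have vp: "norm (v k i) powr p = (if i \<in> I k then 1 / W k else 0)" for k i
  proof -
    have "(W k powr (- (1 / p))) powr p = 1 / W k"
      unfolding powr_powr using W[of k] p_pos by (simp add: powr_minus_divide)
    then show ?thesis by (simp add: v_def)
  qed
  have succ: "successive v"
    unfolding successive_def
  proof (intro allI impI)
    fix k l i j assume kl: "k < l" and "v k i \<noteq> 0" "v l j \<noteq> 0"
    then have i: "i < k * k + Suc k" and j: "l * l \<le> j" by (auto simp: v_def I_def split: if_splits)
    have "k * k + Suc k \<le> Suc k * Suc k" by simp
    also have "\<dots> \<le> l * l" using kl by (intro mult_le_mono) auto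
    finally show "i < j" using i j by linarith
  qed
  have big: "ennreal (1 / 2) < gpow (v k)" for k
  proof -
    have "1 / W k * (\<Sum>i<card (I k). w i) \<le> gsum (v k) (I k)"
      by (rule gsum_ge_const) (auto simp: vp I_def)
    then have "1 \<le> gsum (v k) (I k)" using W[of k] by (simp add: I_def W_def)
    then have "ennreal (1 / 2) < ennreal (gsum (v k) (I k))" by (intro ennreal_lessI) auto
    also have "\<dots> \<le> gpow (v k)" by (rule gsum_le_gpow) (simp add: I_def)
    finally show ?thesis .
  qed
  have small: "gpow (v k) \<le> ennreal 1" for k
  proof (intro gpow_leI ennreal_leI)
    fix A :: "nat set" assume A: "finite A"
    have "gsum (v k) A \<le> gsum (v k) (A \<inter> I k)"
      using A by (intro gsum_le_subset) (auto simp: v_def)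
    also have "\<dots> \<le> 1 / W k * (\<Sum>i<card (A \<inter> I k). w i)"
      using A by (intro gsum_le_const) (auto simp: vp)
    also have "\<dots> \<le> 1 / W k * W k"
    proof -
      have "card (A \<inter> I k) \<le> card (I k)" by (rule card_mono) (auto simp: I_def)
      then have "(\<Sum>i<card (A \<inter> I k). w i) \<le> W k"
        unfolding W_def by (intro sum_mono2) (auto simp: w_nonneg I_def)
      then show ?thesis using W[of k] by (intro mult_left_mono) auto
    qed
    also have "\<dots> = 1" using W[of k] by simp
    finally show "gsum (v k) A \<le> 1" .
  qed
  have flat: "\<forall>\<^sub>F k in sequentially. \<forall>i. norm (v k i) powr p \<le> \<epsilon>" if e: "0 < \<epsilon>" for \<epsilon>
  proof -
    obtain n0 where n0: "\<And>n. n0 \<le> n \<Longrightarrow> 1 / \<epsilon> < (\<Sum>i<n. w i)" using W_unbounded by blast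
    have "norm (v k i) powr p \<le> \<epsilon>" if "n0 \<le> k" for k i
    proof -
      have "1 / \<epsilon> < W k" unfolding W_def by (rule n0) (use that in simp)
      then have "1 / W k \<le> \<epsilon>" using e W[of k] by (simp add: field_simps)
      then show ?thesis using e by (simp add: vp)
    qed
    then show ?thesis by (auto intro: eventually_sequentiallyI)
  qed
  obtain \<phi> :: "nat \<Rightarrow> nat" where \<phi>: "strict_mono \<phi>" and lower: "\<And>F a. finite F \<Longrightarrow>
      ennreal (1 / 2 / 2 * (\<Sum>k\<in>F. norm (a k) powr p)) \<le> gpow (\<Sum>k\<in>F. fscl (a k) ((v \<circ> \<phi>) k))"
    using lp_lower_estimate[OF succ _ big flat] unfolding o_def by auto
  define z where "z = v \<circ> \<phi>"
  have succz: "successive z" unfolding z_def by (rule successive_subseq[OF succ \<phi>])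
  have finz: "gpow (z k) < top" for k
    using small[of "\<phi> k"] unfolding z_def o_def by (rule le_less_trans) simp
  have lp: "equivalent_seqs gspace (z \<circ> \<psi>) (lp_space p :: ('k, nat \<Rightarrow> 'k) qspace) unit_vec"
    if \<psi>: "strict_mono \<psi>" for \<psi>
  proof (rule equivalent_lp[where c = "1 / 2 / 2" and B = 1])
    show "gpow ((z \<circ> \<psi>) j) < top" for j using finz by simp
    show "ennreal (1 / 2 / 2 * (\<Sum>k\<in>F. norm (a k) powr p)) \<le> gpow (\<Sum>k\<in>F. fscl (a k) ((z \<circ> \<psi>) k))"
      if "finite F" for F a
      unfolding z_def by (rule lower_estimate_subseq[OF lower \<psi> that])
    show "gpow (\<Sum>k\<in>F. fscl (a k) ((z \<circ> \<psi>) k)) \<le> ennreal (1 * (\<Sum>k\<in>F. norm (a k) powr p))"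
      if "finite F" for F a
      by (rule gpow_disjoint_upper[OF successive_imp_disjoint[OF successive_subseq[OF succz \<psi>]]])
         (use small in \<open>auto simp: z_def\<close>)
  qed simp
  have id: "z \<circ> id = z" by simp
  have lpz: "equivalent_seqs gspace z (lp_space p :: ('k, nat \<Rightarrow> 'k) qspace) unit_vec"
    using lp[of id] unfolding id by (simp add: strict_mono_def)
  have nz: "z j \<noteq> 0" for j
  proof
    assume "z j = 0"
    then have "gpow (z j) = 0" by (simp only: gpow_0)
    then show False using big[of "\<phi> j"] by (simp add: z_def)
  qed
  have "subsymmetric gspace z"
    by (rule subsymmetric_disjoint[OF successive_imp_disjoint[OF succz] nz finz])
       (rule equivalent_seqs_trans[OF lp equivalent_seqs_sym[OF lpz]])
  with lpz show ?thesis by blast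
qed

text \<open>A subsequence of a generated sequence has the same order pattern as the sequence itself,
  so spreading holds there with equal norms; the finite blocks inherit it through
  equivalence.\<close>

lemma generated_imp_subsymmetric:
  fixes y :: "nat \<Rightarrow> rat \<Rightarrow> 'k::{real_normed_field, banach}"
  assumes d: "positioning d" and tail: "seed_tail_inf w p f d = 0" and gen: "generated_on_Q f d y"
    and basic: "basic_seq gspace y"
  shows "\<exists>z::nat \<Rightarrow> nat \<Rightarrow> 'k. subsymmetric gspace z \<and> equivalent_seqs gspace y gspace z"
proof -
  have "range y \<subseteq> vecs gspace" using basic by (simp add: basic_seq_def)
  then have "y k \<in> vecs gspace" for k by blast
  then have fin: "gpow (y k) < top" for k by simp
  have nz: "y k \<noteq> 0" for k by (rule quasi_banach_space.basic_seq_nonzero[OF quasi_banach_space_gspace basic])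
  have "\<exists>q. compatible_seq d q \<and> (\<forall>n. y k (q n) = f n) \<and> (\<forall>r. r \<notin> range q \<longrightarrow> y k r = 0)" for k
    using gen unfolding generated_on_Q_def compatible_vec_def by blast
  then obtain Q where Q: "\<And>k. compatible_seq d (Q k)" "\<And>k n. y k (Q k n) = f n" "\<And>k r. r \<notin> range (Q k) \<Longrightarrow> y k r = 0"
    by metis
  have Qord: "Q k i < Q k j \<longleftrightarrow> pos_perm d n i < pos_perm d n j" if "i < n" "j < n" for k i j n
    using Q(1)[of k] that unfolding compatible_seq_iff[OF d] by blast
  have Qinj: "inj (Q k)" for k by (rule compatible_seq_inj[OF d Q(1)])
  have Qord2: "Q k i < Q k j \<longleftrightarrow> Q l i < Q l j" for k l i j
    using Qord[of i "Suc (max i j)" j k] Qord[of i "Suc (max i j)" j l] by (simp add: less_Suc_eq_le)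
  have suppQ: "i \<notin> Q k ` {n. f n \<noteq> 0} \<Longrightarrow> y k i = 0" for k i
    using Q(2)[of k] Q(3)[of i k] by (cases "i \<in> range (Q k)") auto
  \<comment> \<open>A nonzero coefficient exists because a basic sequence has no zero terms. It
    makes the intermediate vectors nonzero when the order is chained below, and keeps the
    truncations nonzero.\<close>
  obtain n0 where n0: "f n0 \<noteq> 0"
  proof -
    obtain r where r: "y 0 r \<noteq> 0" using nz[of 0] by (auto simp: fun_eq_iff)
    then obtain n where "r = Q 0 n" using Q(3)[of r 0] by blast
    then show thesis using that r Q(2) by auto
  qed
  have succ: "successive y"
    unfolding successive_def
  proof (intro allI impI)
    fix k l i j assume kl: "k < l" and i: "y k i \<noteq> 0" and j: "y l j \<noteq> 0"
    have step: "i < j" if "y k i \<noteq> 0" "y (Suc k) j \<noteq> 0" for k i j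
      using gen that unfolding generated_on_Q_def by blast
    from kl i j show "i < j"
    proof (induct arbitrary: i j rule: less_Suc_induct)
      case (1 k)
      then show ?case using step by blast
    next
      case (2 k l m)
      have "y l (Q l n0) \<noteq> 0" using Q(2) n0 by simp
      then show ?case using 2 by (meson less_trans)
    qed
  qed
  obtain \<tau> :: "nat \<Rightarrow> real" where \<tau>: "\<And>j. 0 < \<tau> j" and pert: "\<And>x y :: nat \<Rightarrow> rat \<Rightarrow> 'k.
     (\<And>j. gpow (x j) < top) \<Longrightarrow> (\<And>j. gpow (y j) < top) \<Longrightarrow> away_from_zero x \<Longrightarrow>
     (\<And>j. gpow (x j - y j) \<le> ennreal (\<tau> j)) \<Longrightarrow> equivalent_seqs gspace x gspace y"
    using ex_perturbation_tolerance by metis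
  \<comment> \<open>The truncation goes beyond \<open>n0\<close>, so coordinate \<open>n0\<close>
    survives in every block.\<close>
  have "\<exists>m. n0 < m \<and> (\<forall>n\<ge>m. gpow (seed_vec f d n n - seed_vec f d m n) \<le> ennreal (\<tau> k))" for k
  proof -
    obtain m where m: "\<And>n. m \<le> n \<Longrightarrow> gpow (seed_vec f d n n - seed_vec f d m n) \<le> ennreal (\<tau> k)"
      using tail \<tau>[of k] unfolding seed_tail_inf_eq_0_iff by blast
    have "gpow (seed_vec f d n n - seed_vec f d (max m (Suc n0)) n) \<le> ennreal (\<tau> k)" if "max m (Suc n0) \<le> n" for n
      using gpow_seed_vec_diff_antimono[of m "max m (Suc n0)" n f d] m[of n] that by (simp add: order_trans)
    then show ?thesis by (intro exI[of _ "max m (Suc n0)"]) auto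
  qed
  then obtain m where m: "\<And>k. n0 < m k"
    "\<And>k n. m k \<le> n \<Longrightarrow> gpow (seed_vec f d n n - seed_vec f d (m k) n) \<le> ennreal (\<tau> k)" by metis
  define y' where "y' = (\<lambda>k r. if r \<in> Q k ` {..<m k} then y k r else 0)"
  have fin': "gpow (y' k) < top" for k
    by (rule le_less_trans[OF _ fin[of k]], rule gpow_mono) (simp add: y'_def)
  have close: "gpow (y k - y' k) \<le> ennreal (\<tau> k)" for k
  proof -
    have eq: "y k - y' k = (\<lambda>r. if r \<in> Q k ` {..<m k} then 0 else y k r)" by (auto simp: y'_def)
    show ?thesis
      unfolding eq by (rule gpow_seed_remainder[OF d Q(1), where f = f]) (use Q(2,3) m(2) in auto)
  qed
  \<comment> \<open>All \<open>y k\<close> realize one pattern, so their norms agree and are bounded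
    away from 0.\<close>
  have const: "gpow (y k) = gpow (y 0)" for k
  proof (rule gpow_order_iso[where U = "{n. f n \<noteq> 0}" and \<alpha> = "Q k" and \<beta> = "Q 0"])
    show "norm (y k (Q k u)) = norm (y 0 (Q 0 u))" for u by (simp add: Q(2))
  qed (use Qord2 suppQ in auto)
  have away: "away_from_zero y"
  proof -
    have y0: "gpow (y 0) \<noteq> 0" using nz[of 0] gpow_eq_0_iff by blast
    have e: "ennreal (enn2real (gpow (y 0))) = gpow (y 0)" using fin[of 0] by simp
    have "0 < enn2real (gpow (y 0))" using y0 fin[of 0] by (simp add: enn2real_positive_iff zero_less_iff_neq_zero)
    moreover have "ennreal (enn2real (gpow (y 0))) \<le> gpow (y j)" for j
      unfolding e const[of j] by (rule order.refl)
    ultimately show ?thesis unfolding away_from_zero_def by (meson always_eventually)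
  qed
  have yy': "equivalent_seqs gspace y gspace y'" by (rule pert[OF fin fin' away close])
  \<comment> \<open>Zeros of \<open>f\<close> are left out: points carrying them are not ordered
    relative to the other vectors.\<close>
  define T where "T = (\<lambda>k. {n. n < m k \<and> f n \<noteq> 0})"
  \<comment> \<open>Block \<open>k\<close> occupies the \<open>m k\<close> places after all earlier
    blocks, arranged within by the positioning.\<close>
  define \<beta> where "\<beta> = (\<lambda>k n. (\<Sum>i<k. m i) + pos_perm d (m k) n)"
  define z where "z = (\<lambda>k. place (\<beta> k) (T k) f)"
  have binj: "inj_on (\<beta> k) (T k)" for k
    using inj_onD[OF inj_on_pos_perm[of d "m k"]] by (auto simp: \<beta>_def T_def intro!: inj_onI)
  have bless: "\<beta> k s < \<beta> l t" if "k < l" "s \<in> T k" for k l s t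
  proof -
    have "pos_perm d (m k) s < m k" using that by (intro pos_perm_less d) (auto simp: T_def)
    then have "\<beta> k s < (\<Sum>i<Suc k. m i)" by (simp add: \<beta>_def)
    also have "\<dots> \<le> (\<Sum>i<l. m i)" using that by (intro sum_mono2) auto
    finally show ?thesis by (simp add: \<beta>_def)
  qed
  have Qless: "Q k s < Q l t" if "k < l" "f s \<noteq> 0" "f t \<noteq> 0" for k l s t
    using successiveD[OF succ that(1)] Q(2) that by simp
  have y'z: "equivalent_seqs gspace y' gspace z" and finz: "gpow (z k) = gpow (y' k)" for k
  proof -
    have 1: "y' k (Q k t) = z k (\<beta> k t)" if "t \<in> T k" for k t
      using that by (simp add: y'_def Q(2) z_def place_at[OF binj]) (simp add: T_def)
    have 2: "Q k s < Q l t \<longleftrightarrow> \<beta> k s < \<beta> l t" if st: "s \<in> T k" "t \<in> T l" for k l s t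
    proof (cases rule: linorder_cases[of k l])
      case less
      then show ?thesis using bless[OF less st(1), of t] Qless[OF less, of s t] st by (simp add: T_def)
    next
      case equal
      then show ?thesis using Qord[of s "m k" t k] st by (simp add: T_def \<beta>_def)
    next
      case greater
      then show ?thesis using bless[OF greater st(2), of s] Qless[OF greater, of t s] st by (simp add: T_def)
    qed
    have 3: "y' k i = 0" if "i \<notin> Q k ` T k" for k i
    proof (cases "i \<in> Q k ` {..<m k}")
      case True
      then obtain n where "i = Q k n" "n < m k" by blast
      then show ?thesis using that Q(2)[of k n] by (auto simp: y'_def T_def)
    qed (simp add: y'_def)
    have 4: "z k i = 0" if "i \<notin> \<beta> k ` T k" for k i unfolding z_def by (rule place_off[OF that])
    show "equivalent_seqs gspace y' gspace z"
      by (rule equivalent_order_iso(1)[where \<alpha> = Q and \<beta> = \<beta> and T = T]) (fact 1 2 3 4 fin')+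
    show "gpow (z k) = gpow (y' k)"
      by (rule equivalent_order_iso(2)[where \<alpha> = Q and \<beta> = \<beta> and T = T and y = y']) (fact 1 2 3 4 fin')+
  qed
  have spread: "equivalent_seqs gspace (z \<circ> \<phi>) gspace z" if \<phi>: "strict_mono \<phi>" for \<phi>
  proof -
    have yz: "equivalent_seqs gspace y gspace z" by (rule equivalent_seqs_trans[OF yy' y'z])
    have "equivalent_seqs gspace (z \<circ> \<phi>) gspace (y \<circ> \<phi>)"
      by (rule equivalent_seqs_subseq[OF _ _ \<phi> equivalent_seqs_sym[OF yz]]) (simp_all add: vector_space_fscl)
    also have "equivalent_seqs gspace (y \<circ> \<phi>) gspace y"
    proof (rule equivalent_order_iso(1)[where \<alpha> = "\<lambda>k. Q (\<phi> k)" and \<beta> = Q and T = "\<lambda>_. {n. f n \<noteq> 0}"])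
      fix k l s t assume st: "s \<in> {n. f n \<noteq> 0}" "t \<in> {n. f n \<noteq> 0}"
      show "Q (\<phi> k) s < Q (\<phi> l) t \<longleftrightarrow> Q k s < Q l t"
      proof (cases rule: linorder_cases[of k l])
        case less
        then show ?thesis using Qless[OF less] Qless[of "\<phi> k" "\<phi> l"] st strict_monoD[OF \<phi>] by simp
      next
        case equal
        then show ?thesis using Qord2 by simp
      next
        case greater
        then have "Q l t < Q k s" "Q (\<phi> l) t < Q (\<phi> k) s"
          using Qless[OF greater, of t s] Qless[of "\<phi> l" "\<phi> k" t s] st strict_monoD[OF \<phi>] by auto
        then show ?thesis by simp
      qed
    qed (use fin suppQ Q(2) in auto)
    also note yz
    finally show ?thesis .
  qed
  have "subsymmetric gspace z"
  proof (rule subsymmetric_disjoint[OF _ _ _ spread])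
    show "z j \<noteq> 0" for j
    proof
      assume "z j = 0"
      then have "z j (\<beta> j n0) = 0" by simp
      moreover have "n0 \<in> T j" using m(1)[of j] n0 by (simp add: T_def)
      ultimately show False using place_at[OF binj, of n0 j f] n0 by (simp add: z_def)
    qed
    show "gpow (z j) < top" for j using finz fin' by simp
    have "successive z"
      unfolding successive_def
    proof (intro allI impI)
      fix k l i j assume kl: "k < l" "z k i \<noteq> 0" "z l j \<noteq> 0"
      then obtain s t where "i = \<beta> k s" "s \<in> T k" "j = \<beta> l t"
        using place_off[of i "\<beta> k" "T k" f] place_off[of j "\<beta> l" "T l" f] unfolding z_def by blast
      then show "i < j" using bless kl by simp
    qed
    then show "disjoint_supp z" by (rule successive_imp_disjoint)
  qed
  with equivalent_seqs_trans[OF yy' y'z] show ?thesis by blast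
qed

end

section \<open>Coordinatewise null models and blocks\<close>

lemma ex_pointwise_convergent_subseq:
  fixes s :: "nat \<Rightarrow> nat \<Rightarrow> 'a::heine_borel"
  assumes bd: "\<And>n. bounded (range (\<lambda>j. s j n))"
  shows "\<exists>\<phi> l. strict_mono (\<phi>::nat \<Rightarrow> nat) \<and> (\<forall>n. (\<lambda>j. s (\<phi> j) n) \<longlonglongrightarrow> l n)"
proof -
  interpret subseqs "\<lambda>n r. convergent (\<lambda>j. s (r j) n)"
  proof
    fix n and r :: "nat \<Rightarrow> nat" assume "strict_mono r"
    have "bounded (range (\<lambda>j. s (r j) n))" by (rule bounded_subset[OF bd[of n]]) auto
    then obtain l r' where "strict_mono r'" "((\<lambda>j. s (r j) n) \<circ> r') \<longlonglongrightarrow> l"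
      using bounded_imp_convergent_subsequence by blast
    then show "\<exists>r'. strict_mono r' \<and> convergent (\<lambda>j. s ((r \<circ> r') j) n)"
      by (auto simp: o_def convergent_def)
  qed
  have "convergent (\<lambda>j. s (diagseq j) n)" for n
  proof -
    \<comment> \<open>From its \<open>n + 1\<close>-st entry on, the diagonal sequence is a
      subsequence of an extraction that settles coordinate \<open>n\<close>; the shift is undone
      afterwards.\<close>
    have "convergent (\<lambda>j. s ((diagseq \<circ> (+) (Suc n)) j) n)"
    proof (rule diagseq_holds)
      fix r s' :: "nat \<Rightarrow> nat" and m assume "strict_mono r" "convergent (\<lambda>j. s (s' j) m)"
      then show "convergent (\<lambda>j. s ((s' \<circ> r) j) m)"
        using convergent_subseq_convergent[of "\<lambda>j. s (s' j) m" r] by (simp add: o_def)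
    qed
    then obtain l where "(\<lambda>j. s (diagseq (j + Suc n)) n) \<longlonglongrightarrow> l"
      by (auto simp: convergent_def o_def add.commute)
    then have "(\<lambda>j. s (diagseq j) n) \<longlonglongrightarrow> l" by (rule LIMSEQ_offset)
    then show ?thesis by (auto simp: convergent_def)
  qed
  then show ?thesis
    by (intro exI[of _ diagseq] exI[of _ "\<lambda>n. lim (\<lambda>j. s (diagseq j) n)"] conjI allI subseq_diagseq)
       (simp add: convergent_LIMSEQ_iff)
qed

lemma fscl_minus: "fscl (- c) x = - fscl c x"
  by (simp add: fscl_def fun_eq_iff)

context quasi_banach_space
begin

lemma qsums_constant:
  fixes a :: "nat \<Rightarrow> 'k"
  assumes "summable a" "v \<in> V"
  shows "qsums X a (\<lambda>_. v) (sc (suminf a) v)"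
proof -
  have "N ((\<Sum>j<n. sc (a j) v) - sc (suminf a) v) = norm ((\<Sum>j<n. a j) - suminf a) * N v" for n
    using N_scale[OF assms(2)] by (simp flip: scale_sum_left scale_left_diff_distrib)
  moreover have "(\<lambda>n. norm ((\<Sum>j<n. a j) - suminf a) * N v) \<longlonglongrightarrow> norm (suminf a - suminf a) * N v"
    by (intro tendsto_intros summable_LIMSEQ assms)
  ultimately have "(\<lambda>n. N ((\<Sum>j<n. sc (a j) v) - sc (suminf a) v)) \<longlonglongrightarrow> 0" by simp
  moreover have "(\<Sum>j<n. sc (a j) v) \<in> V" for n using assms(2) by (intro V_simps)
  ultimately show ?thesis
    unfolding qsums_def qlim_def using V_simps(4)[OF assms(2)] by blast
qed

end

context garling
begin

text \<open>With \<open>v\<close> the coordinatewise limit, subtracting \<open>v\<close> preserves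
  convergence as soon as convergence of either series forces convergence of the scalar series of the
  \<open>a j\<close>. For \<open>z\<close> a coordinate where \<open>v\<close> is nonzero shows
  this; for \<open>z - v\<close> it comes from \<open>far_from_tails\<close>.\<close>

lemma coordinatewise_null_equivalent:
  fixes z :: "nat \<Rightarrow> nat \<Rightarrow> 'k::{real_normed_field, euclidean_space}"
  assumes basic: "basic_seq gspace z"
    and spread: "\<And>\<phi>. strict_mono \<phi> \<Longrightarrow> equivalent_seqs gspace (z \<circ> \<phi>) gspace z"
  shows "\<exists>\<phi> b B c. strict_mono (\<phi>::nat \<Rightarrow> nat) \<and> 0 < c \<and> 0 \<le> B \<and>
    (\<forall>j. ennreal c \<le> gpow (b j) \<and> gpow (b j) \<le> ennreal B) \<and>
    (\<forall>i. (\<lambda>j. b j i) \<longlonglongrightarrow> 0) \<and> equivalent_seqs gspace (z \<circ> \<phi>) gspace (b :: nat \<Rightarrow> nat \<Rightarrow> 'k)"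
proof -
  let ?X = "gspace :: ('k, nat \<Rightarrow> 'k) qspace"
  interpret g: quasi_banach_space ?X by (rule quasi_banach_space_gspace)
  have zr: "range z \<subseteq> g.V" by (rule g.basic_seq_V[OF basic])
  then have zV: "z j \<in> g.V" for j by blast
  have nz: "z j \<noteq> 0" for j by (rule g.basic_seq_nonzero[OF basic])
  obtain c where c: "0 < c" "\<And>j. c \<le> g.N (z j)"
    using g.spreading_bounded_below[OF zr nz spread] by blast
  obtain B where B: "\<And>j. g.N (z j) \<le> B"
    using g.spreading_bounded_above[OF zr nz spread] by blast
  have B0: "0 \<le> B" using B[of 0] c(2)[of 0] c(1) by linarith
  have finz: "gpow (z j) < top" for j using zV[of j] by simp
  have "norm (z j i) \<le> B" for i j
    using norm_le_qnorm[OF finz, of j i] B[of j] by simp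
  then have "bounded (range (\<lambda>j. z j i))" for i by (intro boundedI) auto
  from ex_pointwise_convergent_subseq[of z, OF this] obtain \<phi>0 v
    where \<phi>0: "strict_mono (\<phi>0::nat \<Rightarrow> nat)" and v: "\<And>i. (\<lambda>j. z (\<phi>0 j) i) \<longlonglongrightarrow> v i" by blast
  have toG: "gpow u \<le> ennreal (r powr p)" if "g.N u \<le> r" "u \<in> g.V" "0 \<le> r" for u r
    using qnorm_le_iff[of u r] that by simp
  have toG': "ennreal (r powr p) \<le> gpow u" if "r \<le> g.N u" "u \<in> g.V" "0 \<le> r" for u r
    using qnorm_ge_iff[of u r] that by simp
  show ?thesis
  proof (cases "v = 0")
    case True
    have "(\<forall>j. ennreal (c powr p) \<le> gpow ((z \<circ> \<phi>0) j) \<and> gpow ((z \<circ> \<phi>0) j) \<le> ennreal (B powr p))"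
      using toG[OF B zV B0] toG'[OF c(2) zV] c(1) by auto
    moreover have "(\<lambda>j. (z \<circ> \<phi>0) j i) \<longlonglongrightarrow> 0" for i using v[of i] True by simp
    moreover have "equivalent_seqs gspace (z \<circ> \<phi>0) gspace (z \<circ> \<phi>0)" by (simp add: equivalent_seqs_def)
    ultimately show ?thesis
      using \<phi>0 c(1) by (intro exI[of _ \<phi>0] exI[of _ "z \<circ> \<phi>0"] exI[of _ "B powr p"] exI[of _ "c powr p"] conjI allI) auto
  next
    case False
    have "gpow v \<le> ennreal (B powr p)"
      by (rule gpow_fatou[OF v]) (intro always_eventually allI toG B zV B0)
    then have "gpow v < top" by (rule le_less_trans) simp
    then have vV: "v \<in> g.V" by simp
    obtain n0 \<delta> where \<delta>: "0 < \<delta>" and far: "\<And>F a. finite F \<Longrightarrow> F \<subseteq> {n0..} \<Longrightarrow>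
        \<delta> \<le> g.N (v - (\<Sum>j\<in>F. g.sc (a j) (z j)))"
      using g.far_from_tails[OF basic vV False] by blast
    \<comment> \<open>At this coordinate the subsequence is chosen to converge geometrically, so
      that the scalar series can be separated from the coordinate of the vector series.\<close>
    obtain i0 where i0: "v i0 \<noteq> 0" using False by (auto simp: fun_eq_iff)
    have "\<forall>\<^sub>F j in sequentially. norm (z (\<phi>0 j) i0 - v i0) < (1 / 2) ^ k \<and> n0 \<le> j" for k
    proof (rule eventually_conj)
      have lim: "(\<lambda>j. norm (z (\<phi>0 j) i0 - v i0)) \<longlonglongrightarrow> norm (v i0 - v i0)" by (intro tendsto_intros v)
      show "\<forall>\<^sub>F j in sequentially. norm (z (\<phi>0 j) i0 - v i0) < (1 / 2) ^ k"
        by (rule order_tendstoD(2)[OF lim]) simp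
    qed (rule eventually_ge_at_top)
    from ex_strict_mono_selection[of "\<lambda>k j. norm (z (\<phi>0 j) i0 - v i0) < (1 / 2) ^ k \<and> n0 \<le> j", OF this]
    obtain \<psi> where \<psi>: "strict_mono (\<psi>::nat \<Rightarrow> nat)"
      "\<And>k. norm (z (\<phi>0 (\<psi> k)) i0 - v i0) < (1 / 2) ^ k" "\<And>k. n0 \<le> \<psi> k" by blast
    define \<phi> where "\<phi> = \<phi>0 \<circ> \<psi>"
    have \<phi>: "strict_mono \<phi>" unfolding \<phi>_def by (rule strict_mono_o[OF \<phi>0 \<psi>(1)])
    have \<phi>n0: "n0 \<le> \<phi> k" for k
      using \<psi>(3)[of k] strict_mono_imp_increasing[OF \<phi>0, of "\<psi> k"] by (simp add: \<phi>_def)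
    have \<phi>i0: "norm (z (\<phi> k) i0 - v i0) < (1 / 2) ^ k" for k using \<psi>(2) by (simp add: \<phi>_def)
    define b where "b = (\<lambda>j. z (\<phi> j) - v)"
    have bV: "b j \<in> g.V" for j unfolding b_def by (intro g.V_simps zV vV)
    have br: "range b \<subseteq> g.V" using bV by blast
    have zr': "range (z \<circ> \<phi>) \<subseteq> g.V" using zV by auto
    have b_null: "(\<lambda>j. b j i) \<longlonglongrightarrow> 0" for i
    proof -
      have "(\<lambda>j. z (\<phi>0 (\<psi> j)) i) \<longlonglongrightarrow> v i"
        using LIMSEQ_subseq_LIMSEQ[OF v[of i] \<psi>(1)] by (simp add: o_def)
      then have "(\<lambda>j. z (\<phi>0 (\<psi> j)) i - v i) \<longlonglongrightarrow> v i - v i" by (intro tendsto_intros)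
      then show ?thesis by (simp add: b_def \<phi>_def)
    qed
    have b_lower: "\<delta> \<le> g.N (b j)" for j
    proof -
      have "\<delta> \<le> g.N (v - (\<Sum>j\<in>{\<phi> j}. g.sc 1 (z j)))"
        by (rule far) (use \<phi>n0 in auto)
      also have "(\<Sum>j\<in>{\<phi> j}. g.sc 1 (z j)) = z (\<phi> j)"
        by (simp only: sum.insert[OF finite.emptyI] empty_iff not_False_eq_True sum.empty add_0_right g.scale_one)
      finally show ?thesis unfolding b_def using g.N_minus_commute[OF zV vV] by metis
    qed
    have b_upper: "g.N (b j) \<le> g.C * (B + g.N v)" for j
      unfolding b_def by (intro g.N_diff_le zV vV B order_refl)
    have b_upper0: "0 \<le> g.C * (B + g.N v)"
      using b_upper[of 0] g.N_nonneg[OF bV, of 0] by linarith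
    have "equivalent_seqs gspace (z \<circ> \<phi>) gspace b"
      unfolding equivalent_seqs_def
    proof (intro allI iffI)
      fix a assume "\<exists>u. qsums ?X a (z \<circ> \<phi>) u"
      then obtain u where u: "qsums ?X a (z \<circ> \<phi>) u" by blast
      obtain n1 where n1: "\<And>j. n1 \<le> j \<Longrightarrow> g.N (g.sc (a j) ((z \<circ> \<phi>) j)) < c"
        using g.convergent_terms[OF zr' u c(1)] by blast
      have a1: "norm (a j) \<le> 1" if "n1 \<le> j" for j
      proof -
        have "norm (a j) * c \<le> norm (a j) * g.N (z (\<phi> j))" using c(2) by (intro mult_left_mono) auto
        also have "\<dots> < c" using n1[OF that] g.N_scale[OF zV, of "a j" "\<phi> j"] by (simp only: o_def)
        finally show ?thesis using c(1) by simp
      qed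
      have s1: "summable (\<lambda>j. a j * z (\<phi> j) i0)"
        using qsums_coord[OF u, of i0] by (auto simp: summable_iff_convergent convergent_def)
      \<comment> \<open>The coefficients are eventually at most 1, and the deviations at
        \<open>i0\<close> decay geometrically.\<close>
      have s2: "summable (\<lambda>j. a j * (z (\<phi> j) i0 - v i0))"
      proof (rule summable_comparison_test')
        show "summable (\<lambda>j. (1 / 2 :: real) ^ j)" by (rule summable_geometric) simp
        show "norm (a j * (z (\<phi> j) i0 - v i0)) \<le> (1 / 2) ^ j" if "n1 \<le> j" for j
          using mult_mono[OF a1[OF that] less_imp_le[OF \<phi>i0[of j]]] by (simp add: norm_mult)
      qed
      have "summable (\<lambda>j. (a j * z (\<phi> j) i0 - a j * (z (\<phi> j) i0 - v i0)) / v i0)"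
        by (intro summable_divide summable_diff s1 s2)
      then have sa: "summable a" using i0 by (simp add: algebra_simps)
      have "qsums ?X a (\<lambda>_. - v) (g.sc (suminf a) (- v))"
        by (intro g.qsums_constant sa g.V_simps vV)
      from g.qsums_add_vectors[OF u this]
      have "qsums ?X a (\<lambda>j. (z \<circ> \<phi>) j + - v) (u + g.sc (suminf a) (- v))" .
      then have "qsums ?X a b (u + g.sc (suminf a) (- v))" by (simp only: b_def o_def diff_conv_add_uminus)
      then show "\<exists>u. qsums ?X a b u" by blast
    next
      fix a assume ex: "\<exists>u. qsums ?X a b u"
      then obtain u where u: "qsums ?X a b u" by blast
      \<comment> \<open>With \<open>s\<close> the sum of the \<open>a j\<close>, the combination
        equals \<open>- s\<close> times the difference of \<open>v\<close> and a combination of late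
        terms of \<open>z\<close>, which has quasi-norm at least \<delta>.\<close>
      have le: "norm (\<Sum>j\<in>{m..<n}. a j) * \<delta> \<le> g.N (\<Sum>j\<in>{m..<n}. g.sc (a j) (b j))" for m n
      proof (cases "(\<Sum>j\<in>{m..<n}. a j) = 0")
        case True
        then show ?thesis using g.N_nonneg[OF g.partial_sum_in_V[OF br]] by simp
      next
        case False
        define s where "s = (\<Sum>j\<in>{m..<n}. a j)"
        have s: "s \<noteq> 0" using False by (simp add: s_def)
        have inj: "inj_on \<phi> {m..<n}" using strict_mono_imp_inj_on[OF \<phi>] inj_on_subset by blast
        define F where "F = \<phi> ` {m..<n}"
        have F: "(\<Sum>j\<in>F. g.sc (a (inv \<phi> j) / s) (z j)) = (\<Sum>j\<in>{m..<n}. g.sc (a j / s) (z (\<phi> j)))"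
          unfolding F_def sum.reindex[OF inj] using strict_mono_imp_inj_on[OF \<phi>] by simp
        have FV: "(\<Sum>j\<in>F. g.sc (a (inv \<phi> j) / s) (z j)) \<in> g.V" by (rule g.partial_sum_in_V[OF zr])
        have "(\<Sum>j\<in>{m..<n}. g.sc (a j) (b j)) = (\<Sum>j\<in>{m..<n}. g.sc (a j) (z (\<phi> j))) - g.sc s v"
          unfolding b_def s_def g.scale_right_diff_distrib sum_subtractf g.scale_sum_left ..
        also have "\<dots> = g.sc (- s) (v - (\<Sum>j\<in>F. g.sc (a (inv \<phi> j) / s) (z j)))"
          unfolding F g.scale_right_diff_distrib g.scale_sum_right g.scale_scale g.scale_minus_left using s
          by (simp add: sum_negf fscl_minus)
        finally have eq: "(\<Sum>j\<in>{m..<n}. g.sc (a j) (b j)) = g.sc (- s) (v - (\<Sum>j\<in>F. g.sc (a (inv \<phi> j) / s) (z j)))" .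
        have "norm s * \<delta> \<le> norm s * g.N (v - (\<Sum>j\<in>F. g.sc (a (inv \<phi> j) / s) (z j)))"
          by (intro mult_left_mono far) (use \<phi>n0 in \<open>auto simp: F_def\<close>)
        also have "\<dots> = g.N (\<Sum>j\<in>{m..<n}. g.sc (a j) (b j))"
          unfolding eq using g.N_scale[OF g.V_simps(3)[OF vV FV], of "- s"] by (simp only: norm_minus_cancel)
        finally show ?thesis by (simp only: s_def)
      qed
      have "summable a"
        unfolding summable_Cauchy
      proof (intro allI impI)
        fix \<epsilon> :: real assume e: "0 < \<epsilon>"
        then have "0 < \<delta> * \<epsilon>" using \<delta> by simp
        with ex obtain n1 where n1: "\<And>m n. n1 \<le> m \<Longrightarrow> m \<le> n \<Longrightarrow> g.N (\<Sum>j\<in>{m..<n}. g.sc (a j) (b j)) < \<delta> * \<epsilon>"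
          unfolding g.convergent_series_iff[OF br] by blast
        have "norm (sum a {m..<n}) < \<epsilon>" if "n1 \<le> m" for m n
        proof (cases "m \<le> n")
          case True
          have "norm (sum a {m..<n}) * \<delta> < \<delta> * \<epsilon>" using le[of m n] n1[OF that True] by linarith
          then show ?thesis using \<delta> by (simp add: mult.commute)
        qed (use e in simp)
        then show "\<exists>N. \<forall>m\<ge>N. \<forall>n. norm (sum a {m..<n}) < \<epsilon>" by blast
      qed
      from g.qsums_add_vectors[OF u g.qsums_constant[OF this vV]]
      have "qsums ?X a (\<lambda>j. b j + v) (u + g.sc (suminf a) v)" .
      then have "qsums ?X a (z \<circ> \<phi>) (u + g.sc (suminf a) v)" by (simp only: b_def o_def diff_add_cancel)
      then show "\<exists>u. qsums ?X a (z \<circ> \<phi>) u" by blast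
    qed
    moreover have "\<forall>j. ennreal (\<delta> powr p) \<le> gpow (b j) \<and> gpow (b j) \<le> ennreal ((g.C * (B + g.N v)) powr p)"
      using toG[OF b_upper bV b_upper0] toG'[OF b_lower bV] \<delta> by simp
    ultimately show ?thesis
      using \<phi> \<delta> b_null
      by (intro exI[of _ \<phi>] exI[of _ b] exI[of _ "(g.C * (B + g.N v)) powr p"] exI[of _ "\<delta> powr p"] conjI) auto
  qed
qed

text \<open>Coordinatewise convergence makes the head of a late vector small, and
  \<open>gpow_tail\<close> makes the far tail of a fixed vector small. Choosing index and window in
  turn leaves only errors within the tolerance outside successive windows.\<close>

lemma ex_block_equivalent:
  fixes b :: "nat \<Rightarrow> nat \<Rightarrow> 'k::{real_normed_field, banach}"
  assumes c: "0 < c" "\<And>j. ennreal c \<le> gpow (b j)" and B: "\<And>j. gpow (b j) \<le> ennreal B"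
    and null: "\<And>i. (\<lambda>j. b j i) \<longlonglongrightarrow> 0"
  shows "\<exists>\<psi> y. strict_mono (\<psi>::nat \<Rightarrow> nat) \<and> successive y \<and> (\<forall>j. finite {i. y j i \<noteq> 0}) \<and>
    (\<forall>j. gpow (y j) \<le> ennreal B) \<and> away_from_zero y \<and>
    equivalent_seqs gspace (b \<circ> \<psi>) gspace (y :: nat \<Rightarrow> nat \<Rightarrow> 'k)"
proof -
  obtain \<tau> :: "nat \<Rightarrow> real" where \<tau>: "\<And>j. 0 < \<tau> j" and pert: "\<And>x y :: nat \<Rightarrow> nat \<Rightarrow> 'k.
     (\<And>j. gpow (x j) < top) \<Longrightarrow> (\<And>j. gpow (y j) < top) \<Longrightarrow> away_from_zero x \<Longrightarrow>
     (\<And>j. gpow (x j - y j) \<le> ennreal (\<tau> j)) \<Longrightarrow> equivalent_seqs gspace x gspace y \<and> away_from_zero y"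
    using ex_perturbation_tolerance by metis
  have fin: "gpow (b j) < top" for j by (rule le_less_trans[OF B]) simp
  \<comment> \<open>The part of \<open>b j\<close> outside the window from \<open>L\<close> to
    \<open>L' - 1\<close>, which is to be discarded.\<close>
  define out where "out = (\<lambda>j L L' i. if L \<le> i \<and> i < L' then 0 else b j i)"
  have step: "\<exists>j>j0. \<exists>L'\<ge>L. gpow (out j L L') \<le> ennreal (\<tau> k)" for j0 L k
  proof -
    have "(\<lambda>j. \<Sum>i<L. norm (b j i) powr p) \<longlonglongrightarrow> (\<Sum>i<L. norm (0::'k) powr p)"
      using p_pos by (intro tendsto_sum tendsto_powr' tendsto_norm null tendsto_const) auto
    then have "(\<lambda>j. \<Sum>i<L. norm (b j i) powr p) \<longlonglongrightarrow> 0" by simp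
    from order_tendstoD(2)[OF this, of "\<tau> k / 2"] \<tau>[of k]
    have "\<forall>\<^sub>F j in sequentially. (\<Sum>i<L. norm (b j i) powr p) < \<tau> k / 2 \<and> j0 < j"
      by (intro eventually_conj eventually_gt_at_top) simp
    then obtain j where j: "(\<Sum>i<L. norm (b j i) powr p) < \<tau> k / 2" "j0 < j"
      using eventually_happens by fastforce
    have "0 < \<tau> k / 2" using \<tau>[of k] by simp
    from gpow_tail[OF fin this, of j] have "\<forall>\<^sub>F L' in sequentially. gpow (\<lambda>i. if L' \<le> i then b j i else 0) \<le> ennreal (\<tau> k / 2) \<and> L \<le> L'"
      by (intro eventually_conj eventually_ge_at_top)
    then obtain L' where L': "gpow (\<lambda>i. if L' \<le> i then b j i else 0) \<le> ennreal (\<tau> k / 2)" "L \<le> L'"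
      using eventually_happens by fastforce
    have "out j L L' = (\<lambda>i. if i < L then b j i else 0) + (\<lambda>i. if L' \<le> i then b j i else 0)"
      using L'(2) by (auto simp: out_def fun_eq_iff)
    then have "gpow (out j L L') \<le> gpow (\<lambda>i. if i < L then b j i else 0) + gpow (\<lambda>i. if L' \<le> i then b j i else 0)"
      using L'(2) by (simp only:) (rule gpow_add_disjoint_le, auto)
    also have "gpow (\<lambda>i. if i < L then b j i else 0) \<le> ennreal (\<Sum>i<L. norm (if i < L then b j i else 0) powr p)"
      by (rule gpow_le_sum_support) auto
    also have "(\<Sum>i<L. norm (if i < L then b j i else 0) powr p) = (\<Sum>i<L. norm (b j i) powr p)"
      by (intro sum.cong) auto
    also have "ennreal \<dots> \<le> ennreal (\<tau> k / 2)" using j by (intro ennreal_leI) simp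
    also note L'(1)
    also have "ennreal (\<tau> k / 2) + ennreal (\<tau> k / 2) = ennreal (\<tau> k)"
      using \<tau>[of k] by (simp flip: ennreal_plus)
    finally show ?thesis using j(2) L'(2) by (auto simp: add_right_mono add_left_mono)
  qed
  \<comment> \<open>Each state consists of the index of the vector and the two ends of its window;
    every window starts where the preceding one stops.\<close>
  have "\<exists>s. \<forall>k. (fst (snd (s k)) \<le> snd (snd (s k)) \<and> gpow (out (fst (s k)) (fst (snd (s k))) (snd (snd (s k)))) \<le> ennreal (\<tau> k)) \<and>
     (fst (s k) < fst (s (Suc k)) \<and> fst (snd (s (Suc k))) = snd (snd (s k)))"
  proof (rule dependent_nat_choice)
    obtain j L' where "gpow (out j 0 L') \<le> ennreal (\<tau> 0)" using step by blast
    then show "\<exists>s. fst (snd s) \<le> snd (snd s) \<and> gpow (out (fst s) (fst (snd s)) (snd (snd s))) \<le> ennreal (\<tau> 0)"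
      by (intro exI[of _ "(j, 0, L')"]) simp
    fix s :: "nat \<times> nat \<times> nat" and k
    have "\<exists>j>fst s. \<exists>L'\<ge>snd (snd s). gpow (out j (snd (snd s)) L') \<le> ennreal (\<tau> (Suc k))"
      by (rule step)
    then obtain j L' where "fst s < j" "snd (snd s) \<le> L'" "gpow (out j (snd (snd s)) L') \<le> ennreal (\<tau> (Suc k))"
      by blast
    then show "\<exists>t. (fst (snd t) \<le> snd (snd t) \<and> gpow (out (fst t) (fst (snd t)) (snd (snd t))) \<le> ennreal (\<tau> (Suc k))) \<and>
       fst s < fst t \<and> fst (snd t) = snd (snd s)"
      by (intro exI[of _ "(j, snd (snd s), L')"]) simp
  qed
  then obtain s where s: "\<And>k. fst (snd (s k)) \<le> snd (snd (s k))"
    "\<And>k. gpow (out (fst (s k)) (fst (snd (s k))) (snd (snd (s k)))) \<le> ennreal (\<tau> k)"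
    "\<And>k. fst (s k) < fst (s (Suc k))" "\<And>k. fst (snd (s (Suc k))) = snd (snd (s k))" by blast
  define \<psi> where "\<psi> = (\<lambda>k. fst (s k))"
  define L where "L = (\<lambda>k. fst (snd (s k)))"
  have \<psi>: "strict_mono \<psi>" using s(3) by (simp add: \<psi>_def strict_mono_Suc_iff)
  have LS: "snd (snd (s k)) = L (Suc k)" for k by (simp add: L_def s(4))
  have L: "mono L" using s(1) LS by (simp add: mono_iff_le_Suc L_def)
  define y where "y = (\<lambda>k i. if L k \<le> i \<and> i < L (Suc k) then b (\<psi> k) i else 0)"
  have close: "gpow ((b \<circ> \<psi>) k - y k) \<le> ennreal (\<tau> k)" for k
  proof -
    have "(b \<circ> \<psi>) k - y k = out (\<psi> k) (L k) (L (Suc k))" by (auto simp: y_def out_def fun_eq_iff)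
    then show ?thesis using s(2)[of k] LS[of k] by (simp only: \<psi>_def L_def)
  qed
  have yB: "gpow (y k) \<le> ennreal B" for k
    by (rule order_trans[OF gpow_mono B[of "\<psi> k"]]) (simp add: y_def)
  have fy: "gpow (y k) < top" for k by (rule le_less_trans[OF yB]) simp
  have away: "away_from_zero (b \<circ> \<psi>)" unfolding away_from_zero_def using c by (intro exI[of _ c]) simp
  have "successive y"
    unfolding successive_def
  proof (intro allI impI)
    fix k l i j assume kl: "k < l" "y k i \<noteq> 0" "y l j \<noteq> 0"
    then have "i < L (Suc k)" "L l \<le> j" by (auto simp: y_def split: if_splits)
    moreover have "L (Suc k) \<le> L l" using kl(1) by (intro monoD[OF L]) simp
    ultimately show "i < j" by simp
  qed
  moreover have "finite {i. y j i \<noteq> 0}" for j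
    by (rule finite_subset[of _ "{..<L (Suc j)}"]) (auto simp: y_def split: if_splits)
  moreover have "equivalent_seqs gspace (b \<circ> \<psi>) gspace y \<and> away_from_zero y"
    by (rule pert[OF _ fy away close]) (simp add: fin)
  ultimately show ?thesis using \<psi> yB by blast
qed

end

section \<open>Decreasing enumerations and convergence to a seed\<close>

lemma pos_perm_cong:
  "(\<And>k. k < n \<Longrightarrow> d k = d' k) \<Longrightarrow> pos_perm d n = pos_perm d' n"
  by (induct n) (simp_all add: fun_eq_iff)

text \<open>Taking \<open>d n\<close> as the rank of \<open>\<rho> n\<close> among the earlier
  values turns the recursion of \<open>pos_perm\<close> into insertion sort.\<close>

lemma pos_perm_card:
  fixes \<rho> :: "nat \<Rightarrow> 'i::linorder"
  assumes inj: "inj \<rho>" and d: "\<And>n. d n = card {i. i < n \<and> \<rho> i < \<rho> n}"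
  shows "j < n \<Longrightarrow> pos_perm d n j = card {i. i < n \<and> \<rho> i < \<rho> j}"
proof (induct n)
  case (Suc n)
  show ?case
  proof (cases "j = n")
    case True
    have "{i. i < Suc n \<and> \<rho> i < \<rho> n} = {i. i < n \<and> \<rho> i < \<rho> n}" by (auto simp: less_Suc_eq)
    then show ?thesis using True d by simp
  next
    case False
    then have j: "j < n" using Suc by simp
    define R where "R = {i. i < n \<and> \<rho> i < \<rho> j}"
    have fin: "finite {i. i < n \<and> \<rho> i < t}" for t by simp
    have IH: "pos_perm d n j = card R" using Suc(1)[OF j] by (simp add: R_def)
    show ?thesis
    proof (cases "\<rho> j < \<rho> n")
      case True
      have "R \<subset> {i. i < n \<and> \<rho> i < \<rho> n}" unfolding R_def using True j by (auto intro: less_trans)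
      then have "card R < d n" unfolding d by (rule psubset_card_mono[OF fin])
      moreover have "{i. i < Suc n \<and> \<rho> i < \<rho> j} = R"
        unfolding R_def using True by (auto simp: less_Suc_eq)
      ultimately show ?thesis using IH False by simp
    next
      case False
      then have lt: "\<rho> n < \<rho> j" using inj j by (metis inj_eq less_irrefl linorder_neqE)
      have "{i. i < n \<and> \<rho> i < \<rho> n} \<subseteq> R" unfolding R_def using lt by (auto intro: less_trans)
      then have "d n \<le> card R" unfolding d by (rule card_mono[rotated]) (simp add: R_def)
      moreover have "{i. i < Suc n \<and> \<rho> i < \<rho> j} = insert n R"
        unfolding R_def using lt by (auto simp: less_Suc_eq)
      moreover have "card (insert n R) = Suc (card R)" by (rule card_insert_disjoint) (simp_all add: R_def)
      ultimately show ?thesis using IH \<open>j \<noteq> n\<close> by simp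
    qed
  qed
qed simp

lemma pos_perm_card_order:
  fixes \<rho> :: "nat \<Rightarrow> 'i::linorder"
  assumes "inj \<rho>" "\<And>n. d n = card {i. i < n \<and> \<rho> i < \<rho> n}" "i < n" "j < n"
  shows "\<rho> i < \<rho> j \<longleftrightarrow> pos_perm d n i < pos_perm d n j"
proof -
  have "card {k. k < n \<and> \<rho> k < \<rho> t} = idx (\<rho> ` {..<n}) (\<rho> t)" for t
  proof -
    have "{b \<in> \<rho> ` {..<n}. b < \<rho> t} = \<rho> ` {k. k < n \<and> \<rho> k < \<rho> t}" by auto
    then show ?thesis unfolding idx_def by (simp add: card_image inj_on_subset[OF assms(1)])
  qed
  then show ?thesis
    using pos_perm_card[OF assms(1,2)] assms(3,4) idx_less_iff[of "\<rho> ` {..<n}" "\<rho> i" "\<rho> j"] by simp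
qed

text \<open>It suffices to compare each point with its predecessors at the moment of insertion,
  since later insertions do not change the order.\<close>

lemma pos_perm_order_ext:
  fixes q :: "nat \<Rightarrow> 'i::linorder"
  assumes q: "\<And>m i. m < n \<Longrightarrow> i < m \<Longrightarrow> (q i < q m \<longleftrightarrow> pos_perm d (Suc m) i < pos_perm d (Suc m) m) \<and> q i \<noteq> q m"
    and ij: "i < n" "j < n"
  shows "q i < q j \<longleftrightarrow> pos_perm d n i < pos_perm d n j"
proof -
  have step: "(q i < q j \<longleftrightarrow> pos_perm d n i < pos_perm d n j) \<and> q i \<noteq> q j \<and> pos_perm d n i \<noteq> pos_perm d n j"
    if "i < j" "j < n" for i j
  proof -
    have "pos_perm d (Suc j) i < pos_perm d (Suc j) j \<longleftrightarrow> pos_perm d n i < pos_perm d n j"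
      by (rule pos_perm_order_mono[symmetric]) (use that in auto)
    moreover have "pos_perm d n i \<noteq> pos_perm d n j"
    proof
      assume "pos_perm d n i = pos_perm d n j"
      from inj_onD[OF inj_on_pos_perm this] that show False by simp
    qed
    ultimately show ?thesis using q[OF that(2,1)] by blast
  qed
  show ?thesis
  proof (cases rule: linorder_cases[of i j])
    case less
    then show ?thesis using step ij by blast
  next
    case greater
    from step[OF this ij(1)] show ?thesis by (metis less_asym linorder_neqE)
  qed simp
qed

text \<open>Density of the rationals supplies a point in the gap where the next one has to go.
  Confinement to the unit interval allows successive copies by integer translations.\<close>

lemma ex_compatible_seq:
  assumes d: "positioning d"
  shows "\<exists>q. compatible_seq d q \<and> (\<forall>n. 0 < q n \<and> q n < 1)"
proof -
  define lt where "lt = (\<lambda>i n. pos_perm d (Suc n) i < pos_perm d (Suc n) n)"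
  have "\<exists>q::nat \<Rightarrow> rat. \<forall>n. 0 < q n \<and> q n < 1 \<and> (\<forall>i<n. (q i < q n \<longleftrightarrow> lt i n) \<and> q i \<noteq> q n)"
  proof (rule dependent_wellorder_choice)
    fix q q' :: "nat \<Rightarrow> rat" and n r
    assume "\<And>i. i < n \<Longrightarrow> q i = q' i"
    then show "(0 < r \<and> r < 1 \<and> (\<forall>i<n. (q i < r \<longleftrightarrow> lt i n) \<and> q i \<noteq> r)) =
      (0 < r \<and> r < 1 \<and> (\<forall>i<n. (q' i < r \<longleftrightarrow> lt i n) \<and> q' i \<noteq> r))" by auto
  next
    fix n and q :: "nat \<Rightarrow> rat"
    assume q: "\<And>m. m < n \<Longrightarrow> 0 < q m \<and> q m < 1 \<and> (\<forall>i<m. (q i < q m \<longleftrightarrow> lt i m) \<and> q i \<noteq> q m)"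
    have order: "q i < q j \<longleftrightarrow> pos_perm d n i < pos_perm d n j" if "i < n" "j < n" for i j
      by (rule pos_perm_order_ext[OF _ that]) (use q in \<open>simp add: lt_def del: pos_perm.simps(2)\<close>)
    \<comment> \<open>Points that must lie below the new one; the set \<open>B\<close> holds those
      above. The endpoints 0 and 1 keep both sets nonempty and the new point inside the
      interval.\<close>
    define A where "A = insert 0 (q ` {i. i < n \<and> lt i n})"
    define B where "B = insert 1 (q ` {i. i < n \<and> \<not> lt i n})"
    have lt_iff: "lt i n \<longleftrightarrow> pos_perm d n i < d n" if "i < n" for i using that by (simp add: lt_def)
    have AB: "a < b" if "a \<in> A" "b \<in> B" for a b
      using that q order lt_iff unfolding A_def B_def by (auto simp: zero_less_one intro: less_le_trans)
    have fin: "finite A" "A \<noteq> {}" "finite B" "B \<noteq> {}" by (auto simp: A_def B_def)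
    have "Max A < Min B" using AB fin by simp
    then obtain r where r: "Max A < r" "r < Min B" using dense by blast
    then have rA: "a < r" if "a \<in> A" for a using that fin Max_less_iff by blast
    have rB: "r < b" if "b \<in> B" for b using that r fin Min_gr_iff by blast
    have cmp: "(q i < r \<longleftrightarrow> lt i n) \<and> q i \<noteq> r" if i: "i < n" for i
    proof (cases "lt i n")
      case True
      then have "q i \<in> A" using i by (simp add: A_def)
      with True rA[OF this] show ?thesis by simp
    next
      case False
      then have "q i \<in> B" using i by (simp add: B_def)
      with False rB[OF this] show ?thesis by simp
    qed
    have "0 < r" by (rule rA) (simp add: A_def)
    moreover have "r < 1" by (rule rB) (simp add: B_def)
    ultimately show "\<exists>r. 0 < r \<and> r < 1 \<and> (\<forall>i<n. (q i < r \<longleftrightarrow> lt i n) \<and> q i \<noteq> r)"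
      using cmp by (intro exI[of _ r]) simp
  qed
  then obtain q :: "nat \<Rightarrow> rat" where q01: "\<And>n. 0 < q n" "\<And>n. q n < 1"
    and q: "\<And>n i. i < n \<Longrightarrow> q i < q n \<longleftrightarrow> lt i n" "\<And>n i. i < n \<Longrightarrow> q i \<noteq> q n" by blast
  have "q i < q j \<longleftrightarrow> pos_perm d n i < pos_perm d n j" if "i < n" "j < n" for i j n
    by (rule pos_perm_order_ext[OF _ that]) (use q in \<open>simp add: lt_def del: pos_perm.simps(2)\<close>)
  then have "compatible_seq d q" unfolding compatible_seq_iff[OF d] by blast
  with q01 show ?thesis by blast
qed

text \<open>The enumeration is infinite although the support is finite: once the support is
  exhausted it lists places where \<open>x\<close> is zero, so that no vector stops early.\<close>

lemma ex_decreasing_enumeration: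
  fixes x :: "nat \<Rightarrow> 'k::real_normed_vector"
  assumes fin: "finite {i. x i \<noteq> 0}"
  shows "\<exists>\<rho>. inj \<rho> \<and> decseq (\<lambda>n. norm (x (\<rho> n))) \<and> {i. x i \<noteq> 0} \<subseteq> range \<rho>"
proof -
  have "\<exists>\<rho>::nat \<Rightarrow> nat. \<forall>n. \<rho> n \<notin> \<rho> ` {..<n} \<and> (\<forall>i. i \<notin> \<rho> ` {..<n} \<longrightarrow> norm (x i) \<le> norm (x (\<rho> n)))"
  proof (rule dependent_wellorder_choice)
    fix \<rho> \<rho>' :: "nat \<Rightarrow> nat" and n r
    assume "\<And>i. i < n \<Longrightarrow> \<rho> i = \<rho>' i"
    then have "\<rho> ` {..<n} = \<rho>' ` {..<n}" by (intro image_cong) auto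
    then show "(r \<notin> \<rho> ` {..<n} \<and> (\<forall>i. i \<notin> \<rho> ` {..<n} \<longrightarrow> norm (x i) \<le> norm (x r))) =
      (r \<notin> \<rho>' ` {..<n} \<and> (\<forall>i. i \<notin> \<rho>' ` {..<n} \<longrightarrow> norm (x i) \<le> norm (x r)))" by simp
  next
    fix n and \<rho> :: "nat \<Rightarrow> nat"
    define D where "D = {i. x i \<noteq> 0} - \<rho> ` {..<n}"
    show "\<exists>r. r \<notin> \<rho> ` {..<n} \<and> (\<forall>i. i \<notin> \<rho> ` {..<n} \<longrightarrow> norm (x i) \<le> norm (x r))"
    proof (cases "D = {}")
      case True
      obtain r where "r \<notin> \<rho> ` {..<n}" using ex_new_if_finite[of "\<rho> ` {..<n}"] by auto
      moreover have "x i = 0" if "i \<notin> \<rho> ` {..<n}" for i using True that unfolding D_def by blast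
      ultimately show ?thesis by (intro exI[of _ r]) simp
    next
      case False
      have "finite D" using fin by (simp add: D_def)
      then have "Max ((\<lambda>i. norm (x i)) ` D) \<in> (\<lambda>i. norm (x i)) ` D" using False by (intro Max_in) auto
      then obtain r where "r \<in> D" "Max ((\<lambda>i. norm (x i)) ` D) = norm (x r)" by blast
      then have r: "r \<in> D" "\<forall>i\<in>D. norm (x i) \<le> norm (x r)"
        using Max_ge[of "(\<lambda>i. norm (x i)) ` D"] \<open>finite D\<close> by auto
      have "norm (x i) \<le> norm (x r)" if "i \<notin> \<rho> ` {..<n}" for i
        using r(2) that by (cases "x i = 0") (auto simp: D_def)
      with r(1) show ?thesis by (auto simp: D_def)
    qed
  qed
  then obtain \<rho> :: "nat \<Rightarrow> nat" where \<rho>: "\<And>n. \<rho> n \<notin> \<rho> ` {..<n}"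
    "\<And>n i. i \<notin> \<rho> ` {..<n} \<Longrightarrow> norm (x i) \<le> norm (x (\<rho> n))" by blast
  have ne: "\<rho> i \<noteq> \<rho> j" if "i < j" for i j using \<rho>(1)[of j] that by (metis imageI lessThan_iff)
  have inj: "inj \<rho>"
  proof (rule injI)
    show "i = j" if "\<rho> i = \<rho> j" for i j
      using ne[of i j] ne[of j i] that by (cases rule: linorder_cases[of i j]) auto
  qed
  have dec: "decseq (\<lambda>n. norm (x (\<rho> n)))"
    unfolding decseq_Suc_iff
  proof
    fix n
    have "\<rho> (Suc n) \<notin> \<rho> ` {..<n}" using inj by (auto simp: inj_eq)
    then show "norm (x (\<rho> (Suc n))) \<le> norm (x (\<rho> n))" by (rule \<rho>(2))
  qed
  have "i \<in> range \<rho>" if i: "x i \<noteq> 0" for i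
  proof (rule ccontr)
    assume out: "i \<notin> range \<rho>"
    have "x (\<rho> n) \<noteq> 0" for n
    proof -
      have "i \<notin> \<rho> ` {..<n}" using out by blast
      from \<rho>(2)[OF this] i show ?thesis by auto
    qed
    then have "range \<rho> \<subseteq> {i. x i \<noteq> 0}" by blast
    then have "finite (range \<rho>)" using fin by (rule finite_subset)
    then show False using inj finite_imageD by blast
  qed
  with inj dec show ?thesis by blast
qed

lemma nat_limit_eventually_const:
  assumes "(\<lambda>j. real (g j)) \<longlonglongrightarrow> l"
  shows "\<exists>d. \<forall>\<^sub>F j in sequentially. g j = d"
proof -
  have "Cauchy (\<lambda>j. real (g j))" using assms by (rule LIMSEQ_imp_Cauchy)
  from metric_CauchyD[OF this, of 1] obtain n0
    where n0: "\<And>m n. n0 \<le> m \<Longrightarrow> n0 \<le> n \<Longrightarrow> dist (real (g m)) (real (g n)) < 1" by auto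
  have "g j = g n0" if "n0 \<le> j" for j using n0[OF that order.refl] by (simp add: dist_real_def)
  then show ?thesis by (intro exI[of _ "g n0"] eventually_sequentiallyI[of n0])
qed

definition remainder :: "(nat \<Rightarrow> 'i) \<Rightarrow> ('i \<Rightarrow> 'k::zero) \<Rightarrow> nat \<Rightarrow> 'i \<Rightarrow> 'k" where
  "remainder \<rho> x m = (\<lambda>i. if i \<in> \<rho> ` {..<m} then 0 else x i)"

text \<open>A sequence of vectors whose coordinates, listed by decreasing modulus, converge to the seed
  \<open>(f, d)\<close> both in value and in relative position.\<close>

definition converges_to_seed ::
  "(nat \<Rightarrow> nat \<Rightarrow> 'k::real_normed_field) \<Rightarrow> (nat \<Rightarrow> nat \<Rightarrow> nat) \<Rightarrow> (nat \<Rightarrow> 'k) \<Rightarrow> (nat \<Rightarrow> nat) \<Rightarrow> bool" where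
  "converges_to_seed x \<rho> f d \<longleftrightarrow> positioning d \<and>
     (\<forall>j. inj (\<rho> j) \<and> decseq (\<lambda>n. norm (x j (\<rho> j n))) \<and> {i. x j i \<noteq> 0} \<subseteq> range (\<rho> j)) \<and>
     (\<forall>n. (\<lambda>j. x j (\<rho> j n)) \<longlonglongrightarrow> f n) \<and>
     (\<forall>n. \<forall>\<^sub>F j in sequentially. \<forall>i<n. \<forall>k<n. \<rho> j i < \<rho> j k \<longleftrightarrow> pos_perm d n i < pos_perm d n k)"

section \<open>Passing to a limit seed, and the case of large remainders\<close>

context garling
begin

lemma ex_converges_to_seed:
  fixes y :: "nat \<Rightarrow> nat \<Rightarrow> 'k::{real_normed_field, euclidean_space}"
  assumes fin: "\<And>j. finite {i. y j i \<noteq> 0}" and B: "\<And>j. gpow (y j) \<le> ennreal B"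
  shows "\<exists>\<phi> \<rho> f d. strict_mono (\<phi>::nat \<Rightarrow> nat) \<and> converges_to_seed (y \<circ> \<phi>) \<rho> f d"
proof -
  have "\<exists>\<rho>. inj \<rho> \<and> decseq (\<lambda>n. norm (y j (\<rho> n))) \<and> {i. y j i \<noteq> 0} \<subseteq> range \<rho>" for j
    by (rule ex_decreasing_enumeration[OF fin])
  then obtain r where r: "\<And>j. inj (r j) \<and> decseq (\<lambda>n. norm (y j (r j n))) \<and> {i. y j i \<noteq> 0} \<subseteq> range (r j)"
    by metis
  define dd where "dd = (\<lambda>j n. card {i. i < n \<and> r j i < r j n})"
  have dd: "dd j n \<le> n" for j n
    unfolding dd_def using card_mono[of "{..<n}" "{i. i < n \<and> r j i < r j n}"] by auto
  \<comment> \<open>Values and ranks are paired, the ranks as reals, so that one diagonal extraction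
    handles both; convergent ranks are then eventually constant.\<close>
  define s where "s = (\<lambda>j n. (y j (r j n), real (dd j n)))"
  have "bounded (range (\<lambda>j. s j n))" for n
  proof -
    have "norm (y j i) \<le> (max B 0) powr (1 / p)" for j i
    proof -
      have fin: "gpow (y j) < top" by (rule le_less_trans[OF B]) simp
      have "gpow (y j) \<le> ennreal (((max B 0) powr (1 / p)) powr p)"
        using order_trans[OF B[of j], of "ennreal (max B 0)"] p_pos by (simp add: powr_powr ennreal_leI)
      then have "enn2real (gpow (y j)) powr (1 / p) \<le> (max B 0) powr (1 / p)"
        by (rule iffD2[OF qnorm_le_iff[OF fin powr_ge_zero]])
      with norm_le_qnorm[OF fin] show ?thesis by (rule order_trans)
    qed
    then have "range (\<lambda>j. s j n) \<subseteq> cball 0 ((max B 0) powr (1 / p)) \<times> cball 0 (real n)"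
      using dd by (auto simp: s_def)
    then show ?thesis by (rule bounded_subset[OF bounded_Times[OF bounded_cball bounded_cball]])
  qed
  from ex_pointwise_convergent_subseq[of s, OF this] obtain \<phi> l
    where \<phi>: "strict_mono (\<phi>::nat \<Rightarrow> nat)" and l: "\<And>n. (\<lambda>j. s (\<phi> j) n) \<longlonglongrightarrow> l n" by blast
  have f: "(\<lambda>j. y (\<phi> j) (r (\<phi> j) n)) \<longlonglongrightarrow> fst (l n)" for n
    using tendsto_fst[OF l[of n]] by (simp add: s_def)
  have "\<exists>d. \<forall>\<^sub>F j in sequentially. dd (\<phi> j) n = d" for n
    using tendsto_snd[OF l[of n]] by (intro nat_limit_eventually_const) (simp add: s_def)
  then obtain d where d: "\<And>n. \<forall>\<^sub>F j in sequentially. dd (\<phi> j) n = d n" by metis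
  have "positioning d"
    unfolding positioning_def
  proof
    fix n
    obtain j where "dd (\<phi> j) n = d n" using eventually_happens[OF d[of n]] by auto
    then show "d n \<le> n" using dd[of "\<phi> j" n] by simp
  qed
  moreover have "\<forall>\<^sub>F j in sequentially. \<forall>i<n. \<forall>k<n. r (\<phi> j) i < r (\<phi> j) k \<longleftrightarrow> pos_perm d n i < pos_perm d n k" for n
  proof -
    have "\<forall>\<^sub>F j in sequentially. \<forall>k\<in>{..<n}. dd (\<phi> j) k = d k"
      by (intro eventually_ball_finite) (simp_all add: d)
    then show ?thesis
    proof eventually_elim
      case (elim j)
      have "pos_perm d n = pos_perm (dd (\<phi> j)) n" using elim by (intro pos_perm_cong) simp
      moreover have "r (\<phi> j) i < r (\<phi> j) k \<longleftrightarrow> pos_perm (dd (\<phi> j)) n i < pos_perm (dd (\<phi> j)) n k"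
        if "i < n" "k < n" for i k
        by (rule pos_perm_card_order) (use r that in \<open>auto simp: dd_def\<close>)
      ultimately show ?case by simp
    qed
  qed
  ultimately have "converges_to_seed (y \<circ> \<phi>) (r \<circ> \<phi>) (\<lambda>n. fst (l n)) d"
    unfolding converges_to_seed_def using r f by simp
  with \<phi> show ?thesis by blast
qed

text \<open>A coordinate of the remainder is dominated by the first \<open>m + 1\<close> listed
  ones, which together contribute at least its p-th power times the sum of as many weights, wherever
  they sit.\<close>

lemma remainder_coord_le:
  fixes x :: "nat \<Rightarrow> 'k::real_normed_field"
  assumes "inj \<rho>" "decseq (\<lambda>n. norm (x (\<rho> n)))" "{i. x i \<noteq> 0} \<subseteq> range \<rho>"
    and B: "gpow x \<le> ennreal B" "0 \<le> B"
  shows "norm (remainder \<rho> x m i) powr p \<le> B / (\<Sum>i<Suc m. w i)"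
proof (cases "remainder \<rho> x m i = 0")
  case True
  then show ?thesis using B W_pos[of m] by simp
next
  case False
  then have i: "x i \<noteq> 0" "i \<notin> \<rho> ` {..<m}" "remainder \<rho> x m i = x i"
    by (auto simp: remainder_def split: if_splits)
  obtain n where n1: "i = \<rho> n" using assms(3) i(1) by blast
  then have "\<not> n < m" using i(2) by auto
  with n1 have n: "i = \<rho> n" "m \<le> n" by auto
  let ?A = "\<rho> ` {..<Suc m}"
  have card: "card ?A = Suc m" using assms(1) by (simp add: card_image inj_on_subset)
  have "norm (x (\<rho> n)) powr p \<le> norm (x a) powr p" if a: "a \<in> ?A" for a
  proof -
    obtain t where t: "a = \<rho> t" "t \<le> m" using a by auto
    then show ?thesis using decseqD[OF assms(2), of t n] n p_pos by (intro powr_mono2) auto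
  qed
  then have "norm (x (\<rho> n)) powr p * (\<Sum>i<card ?A. w i) \<le> gsum x ?A" by (intro gsum_ge_const) auto
  moreover have "gsum x ?A \<le> B"
    using order_trans[OF gsum_le_gpow[of ?A x] B(1)] B(2) by (simp add: ennreal_le_iff)
  ultimately have "norm (x i) powr p * (\<Sum>i<Suc m. w i) \<le> B" unfolding card n(1) by linarith
  then show ?thesis unfolding i(3) using W_pos[of m] by (simp only: pos_le_divide_eq)
qed

text \<open>The \<open>k\<close>-th selected vector drops its first \<open>k\<close> coordinates, so
  the remainders are flat by \<open>remainder_coord_le\<close>. They give the lower estimate for the
  full vectors, which dominate them; the upper one needs only disjointness and a common
  bound.\<close>

lemma large_remainders_imp_lp:
  fixes x :: "nat \<Rightarrow> nat \<Rightarrow> 'k::{real_normed_field, euclidean_space}"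
  assumes succ: "successive x" and B: "\<And>j. gpow (x j) \<le> ennreal B" "0 \<le> B"
    and conv: "converges_to_seed x \<rho> f d"
    and \<delta>: "0 < \<delta>" and large: "\<And>m. \<exists>\<^sub>F j in sequentially. ennreal \<delta> < gpow (remainder (\<rho> j) (x j) m)"
  shows "\<exists>\<psi>. strict_mono (\<psi>::nat \<Rightarrow> nat) \<and> equivalent_seqs gspace (x \<circ> \<psi>) (lp_space p :: ('k, nat \<Rightarrow> 'k) qspace) unit_vec"
proof -
  have "\<exists>j>m. ennreal \<delta> < gpow (remainder (\<rho> j) (x j) k)" for k m
    using large[of k] unfolding frequently_sequentially by (metis Suc_le_lessD)
  from ex_strict_mono_frequently[of "\<lambda>k j. ennreal \<delta> < gpow (remainder (\<rho> j) (x j) k)", OF this]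
  obtain \<psi> where \<psi>: "strict_mono (\<psi>::nat \<Rightarrow> nat)" and big: "\<And>k. ennreal \<delta> < gpow (remainder (\<rho> (\<psi> k)) (x (\<psi> k)) k)"
    by blast
  define v where "v = (\<lambda>k. remainder (\<rho> (\<psi> k)) (x (\<psi> k)) k)"
  have vx: "v k i = 0 \<or> v k i = x (\<psi> k) i" for k i by (simp add: v_def remainder_def)
  have succ\<psi>: "successive (x \<circ> \<psi>)" by (rule successive_subseq[OF succ \<psi>])
  have succv: "successive v"
    unfolding successive_def
  proof (intro allI impI)
    fix k l i j assume kl: "k < l" "v k i \<noteq> 0" "v l j \<noteq> 0"
    then have "(x \<circ> \<psi>) k i \<noteq> 0" "(x \<circ> \<psi>) l j \<noteq> 0" using vx[of k i] vx[of l j] by auto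
    then show "i < j" by (rule successiveD[OF succ\<psi> kl(1)])
  qed
  have flat: "\<forall>\<^sub>F k in sequentially. \<forall>i. norm (v k i) powr p \<le> \<epsilon>" if e: "0 < \<epsilon>" for \<epsilon>
  proof -
    obtain n0 where n0: "\<And>n. n0 \<le> n \<Longrightarrow> B / \<epsilon> < (\<Sum>i<n. w i)" using W_unbounded by blast
    have "norm (v k i) powr p \<le> \<epsilon>" if k: "n0 \<le> k" for k i
    proof -
      have "norm (v k i) powr p \<le> B / (\<Sum>i<Suc k. w i)"
        unfolding v_def by (rule remainder_coord_le) (use conv B in \<open>auto simp: converges_to_seed_def\<close>)
      also have "\<dots> \<le> \<epsilon>"
      proof -
        have "B / \<epsilon> < (\<Sum>i<Suc k. w i)" using n0[of "Suc k"] k by simp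
        then have "B < \<epsilon> * (\<Sum>i<Suc k. w i)" using e by (simp only: pos_divide_less_eq mult.commute)
        then show ?thesis using W_pos[of k] by (simp only: pos_divide_le_eq less_imp_le)
      qed
      finally show ?thesis .
    qed
    then show ?thesis by (auto intro: eventually_sequentiallyI)
  qed
  have bigv: "ennreal \<delta> < gpow (v k)" for k using big by (simp add: v_def)
  obtain \<theta> :: "nat \<Rightarrow> nat" where \<theta>: "strict_mono \<theta>" and lower: "\<And>F a. finite F \<Longrightarrow>
      ennreal (\<delta> / 2 * (\<Sum>k\<in>F. norm (a k) powr p)) \<le> gpow (\<Sum>k\<in>F. fscl (a k) (v (\<theta> k)))"
    using lp_lower_estimate[OF succv \<delta> bigv flat] by blast
  have dis: "disjoint_supp (x \<circ> \<psi> \<circ> \<theta>)"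
    by (rule successive_imp_disjoint[OF successive_subseq[OF succ\<psi> \<theta>]])
  have "equivalent_seqs gspace (x \<circ> \<psi> \<circ> \<theta>) (lp_space p :: ('k, nat \<Rightarrow> 'k) qspace) unit_vec"
  proof (rule equivalent_lp[where c = "\<delta> / 2" and B = B])
    show "gpow ((x \<circ> \<psi> \<circ> \<theta>) j) < top" for j using B(1)[of "\<psi> (\<theta> j)"] by (simp add: le_less_trans)
    show "0 < \<delta> / 2" using \<delta> by simp
    fix F :: "nat set" and a :: "nat \<Rightarrow> 'k" assume F: "finite F"
    show "gpow (\<Sum>k\<in>F. fscl (a k) ((x \<circ> \<psi> \<circ> \<theta>) k)) \<le> ennreal (B * (\<Sum>k\<in>F. norm (a k) powr p))"
      by (rule gpow_disjoint_upper[OF dis]) (use B in simp_all)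
    have "gpow (\<Sum>k\<in>F. fscl (a k) (v (\<theta> k))) \<le> gpow (\<Sum>k\<in>F. fscl (a k) ((x \<circ> \<psi> \<circ> \<theta>) k))"
      by (rule gpow_disjoint_mono[OF dis F]) (use vx in simp)
    with lower[OF F, of a]
    show "ennreal (\<delta> / 2 * (\<Sum>k\<in>F. norm (a k) powr p)) \<le> gpow (\<Sum>k\<in>F. fscl (a k) ((x \<circ> \<psi> \<circ> \<theta>) k))"
      by (rule order_trans)
  qed
  then show ?thesis using strict_mono_o[OF \<psi> \<theta>] by (intro exI[of _ "\<psi> \<circ> \<theta>"]) (simp add: o_assoc)
qed

end

section \<open>The case of small remainders, and the choice between the two cases\<close>

context garling
begin

lemma away_from_zero_subseq: "away_from_zero x \<Longrightarrow> strict_mono \<phi> \<Longrightarrow> away_from_zero (x \<circ> \<phi>)"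
  unfolding away_from_zero_def using eventually_subseq by fastforce

text \<open>Eventually the coordinates listed from \<open>m\<close> to \<open>n - 1\<close> have the
  order of the seed, so they form part of the remainder; \<open>gpow_fatou\<close> passes to the
  limit of their values.\<close>

lemma seed_tail_le:
  fixes x :: "nat \<Rightarrow> nat \<Rightarrow> 'k::real_normed_field"
  assumes conv: "converges_to_seed x \<rho> f d"
    and small: "\<forall>\<^sub>F j in sequentially. gpow (remainder (\<rho> j) (x j) m) \<le> c" and mn: "m \<le> n"
  shows "gpow (seed_vec f d n n - seed_vec f d m n) \<le> c"
proof (rule gpow_fatou)
  fix i
  have "(\<lambda>j. \<Sum>k\<in>{m..<n}. x j (\<rho> j k) * unit_vec (pos_perm d n k) i) \<longlonglongrightarrow>
      (\<Sum>k\<in>{m..<n}. f k * unit_vec (pos_perm d n k) i)"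
    using conv unfolding converges_to_seed_def by (intro tendsto_intros) blast
  then show "(\<lambda>j. (seed_vec (\<lambda>k. x j (\<rho> j k)) d n n - seed_vec (\<lambda>k. x j (\<rho> j k)) d m n) i) \<longlonglongrightarrow>
      (seed_vec f d n n - seed_vec f d m n) i"
    unfolding seed_vec_diff[OF mn] sum_fscl_apply .
next
  have "\<forall>\<^sub>F j in sequentially. \<forall>i<n. \<forall>k<n. \<rho> j i < \<rho> j k \<longleftrightarrow> pos_perm d n i < pos_perm d n k"
    using conv unfolding converges_to_seed_def by blast
  then show "\<forall>\<^sub>F j in sequentially. gpow (seed_vec (\<lambda>k. x j (\<rho> j k)) d n n - seed_vec (\<lambda>k. x j (\<rho> j k)) d m n) \<le> c"
    using small
  proof eventually_elim
    case (elim j)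
    have inj: "inj (\<rho> j)" using conv unfolding converges_to_seed_def by blast
    have "gpow (seed_vec (\<lambda>k. x j (\<rho> j k)) d n n - seed_vec (\<lambda>k. x j (\<rho> j k)) d m n) =
        gpow (\<lambda>i. if i \<in> \<rho> j ` {m..<n} then x j i else 0)"
      by (rule gpow_seed_vec_diff[OF mn, where q = "\<rho> j", symmetric]) (use elim(1) in auto)
    also have "\<dots> \<le> gpow (remainder (\<rho> j) (x j) m)"
      by (rule gpow_mono) (auto simp: remainder_def inj_image_mem_iff[OF inj] inj_eq[OF inj])
    finally show ?case using elim(2) by (rule order_trans)
  qed
qed

text \<open>Three moves: truncate each block to its first \<open>m k\<close> coordinates, copy the
  result into the rationals, then replace the coefficients by those of the seed and append its
  infinite tail. The first and last are perturbations, the middle one is an order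
  isomorphism.\<close>

lemma small_remainders_imp_generated:
  fixes x :: "nat \<Rightarrow> nat \<Rightarrow> 'k::{real_normed_field, euclidean_space}"
  assumes succ: "successive x" and fin: "\<And>j. gpow (x j) < top" and away: "away_from_zero x"
    and conv: "converges_to_seed x \<rho> f d"
    and small: "\<And>\<delta>. 0 < \<delta> \<Longrightarrow> \<exists>m. \<forall>\<^sub>F j in sequentially. gpow (remainder (\<rho> j) (x j) m) \<le> ennreal \<delta>"
  shows "\<exists>\<psi> y. strict_mono (\<psi>::nat \<Rightarrow> nat) \<and> seed_tail_inf w p f d = 0 \<and> generated_on_Q f d y \<and>
    basic_seq gspace y \<and> equivalent_seqs gspace (x \<circ> \<psi>) gspace y"
proof -
  have d: "positioning d" and inj: "\<And>j. inj (\<rho> j)" and supp: "\<And>j i. x j i \<noteq> 0 \<Longrightarrow> i \<in> range (\<rho> j)"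
    and lim: "\<And>n. (\<lambda>j. x j (\<rho> j n)) \<longlonglongrightarrow> f n"
    and order: "\<And>n. \<forall>\<^sub>F j in sequentially. \<forall>i<n. \<forall>k<n. \<rho> j i < \<rho> j k \<longleftrightarrow> pos_perm d n i < pos_perm d n k"
    using conv unfolding converges_to_seed_def by blast+
  have tail: "seed_tail_inf w p f d = 0"
    unfolding seed_tail_inf_eq_0_iff
  proof (intro allI impI)
    fix \<epsilon> :: real assume "0 < \<epsilon>"
    from small[OF this] obtain m where "\<forall>\<^sub>F j in sequentially. gpow (remainder (\<rho> j) (x j) m) \<le> ennreal \<epsilon>" by blast
    from seed_tail_le[OF conv this] show "\<exists>m. \<forall>n\<ge>m. gpow (seed_vec f d n n - seed_vec f d m n) \<le> ennreal \<epsilon>" by blast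
  qed
  obtain q where q: "compatible_seq d q" "\<And>n. 0 < q n" "\<And>n. q n < 1" using ex_compatible_seq[OF d] by blast
  have q_order: "q i < q k \<longleftrightarrow> pos_perm d n i < pos_perm d n k" if "i < n" "k < n" for i k n
    using q(1) that unfolding compatible_seq_iff[OF d] by blast
  \<comment> \<open>The \<open>k\<close>-th copy lies between the integers \<open>k\<close> and
    \<open>k + 1\<close>, so different copies are successive.\<close>
  define Q where "Q = (\<lambda>k n. q n + of_nat k)"
  have Q_less: "Q k s < Q l t" if kl: "k < l" for k l s t
  proof -
    have "Q k s < 1 + of_nat k" unfolding Q_def using q(3)[of s] by simp
    also have "\<dots> \<le> of_nat l" using kl by (metis Suc_leI of_nat_Suc of_nat_le_iff)
    also have "\<dots> < Q l t" unfolding Q_def using q(2)[of t] by simp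
    finally show ?thesis .
  qed
  have Q_compat: "compatible_seq d (Q k)" for k
    unfolding compatible_seq_iff[OF d] Q_def using q_order by simp
  have Q_inj: "inj (Q k)" for k by (rule compatible_seq_inj[OF d Q_compat])
  obtain \<tau> :: "nat \<Rightarrow> real" where \<tau>: "\<And>j. 0 < \<tau> j" and pert: "\<And>x y :: nat \<Rightarrow> nat \<Rightarrow> 'k.
     (\<And>j. gpow (x j) < top) \<Longrightarrow> (\<And>j. gpow (y j) < top) \<Longrightarrow> away_from_zero x \<Longrightarrow>
     (\<And>j. gpow (x j - y j) \<le> ennreal (\<tau> j)) \<Longrightarrow> equivalent_seqs gspace x gspace y \<and> away_from_zero y"
    using ex_perturbation_tolerance by metis
  obtain \<sigma> :: "nat \<Rightarrow> real" where \<sigma>: "\<And>j. 0 < \<sigma> j" and pertQ: "\<And>x y :: nat \<Rightarrow> rat \<Rightarrow> 'k.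
     (\<And>j. gpow (x j) < top) \<Longrightarrow> (\<And>j. gpow (y j) < top) \<Longrightarrow> away_from_zero x \<Longrightarrow>
     (\<And>j. gpow (x j - y j) \<le> ennreal (\<sigma> j)) \<Longrightarrow> equivalent_seqs gspace x gspace y \<and> away_from_zero y"
    using ex_perturbation_tolerance by metis
  \<comment> \<open>Serves both perturbations; in the second one two errors are combined at the cost
    of the factor \<open>K\<close>, hence the division by \<open>2 * K\<close>.\<close>
  define \<eta> where "\<eta> = (\<lambda>k. min (\<tau> k) (\<sigma> k / (2 * K)))"
  have \<eta>: "0 < \<eta> k" "\<eta> k \<le> \<tau> k" "\<eta> k \<le> \<sigma> k / (2 * K)" for k
    using \<tau>[of k] \<sigma>[of k] K_gt_1 by (auto simp: \<eta>_def)
  have "\<exists>m. \<forall>\<^sub>F j in sequentially. gpow (remainder (\<rho> j) (x j) m) \<le> ennreal (\<eta> k)" for k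
    by (rule small[OF \<eta>(1)])
  then obtain m where m: "\<And>k. \<forall>\<^sub>F j in sequentially. gpow (remainder (\<rho> j) (x j) (m k)) \<le> ennreal (\<eta> k)"
    by metis
  \<comment> \<open>One index must satisfy three things at once: a small remainder, the order of the
    seed on the first \<open>m k\<close> coordinates, and coefficients close to those of the
    seed.\<close>
  define good where "good = (\<lambda>k j. gpow (remainder (\<rho> j) (x j) (m k)) \<le> ennreal (\<eta> k) \<and>
     (\<forall>i<m k. \<forall>l<m k. \<rho> j i < \<rho> j l \<longleftrightarrow> pos_perm d (m k) i < pos_perm d (m k) l) \<and>
     (\<Sum>n<m k. norm (x j (\<rho> j n) - f n) powr p) < \<eta> k)"
  have "\<forall>\<^sub>F j in sequentially. good k j" for k
  proof -
    have "(\<lambda>j. \<Sum>n<m k. norm (x j (\<rho> j n) - f n) powr p) \<longlonglongrightarrow> (\<Sum>n<m k. norm (f n - f n) powr p)"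
      using p_pos by (intro tendsto_sum tendsto_powr' tendsto_norm tendsto_diff lim tendsto_const) auto
    then have "(\<lambda>j. \<Sum>n<m k. norm (x j (\<rho> j n) - f n) powr p) \<longlonglongrightarrow> 0" by simp
    from order_tendstoD(2)[OF this \<eta>(1)] m order show ?thesis
      unfolding good_def by (intro eventually_conj)
  qed
  from ex_strict_mono_selection[of good, OF this] obtain \<psi>
    where \<psi>: "strict_mono (\<psi>::nat \<Rightarrow> nat)" and good: "\<And>k. good k (\<psi> k)" by blast
  define r where "r = (\<lambda>k. \<rho> (\<psi> k))"
  define u where "u = (\<lambda>k. x (\<psi> k))"
  have rem: "gpow (remainder (r k) (u k) (m k)) \<le> ennreal (\<eta> k)"
    and r_order: "\<And>i l. i < m k \<Longrightarrow> l < m k \<Longrightarrow> r k i < r k l \<longleftrightarrow> pos_perm d (m k) i < pos_perm d (m k) l"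
    and near: "(\<Sum>n<m k. norm (u k (r k n) - f n) powr p) < \<eta> k" for k
    using good[of k] unfolding good_def r_def u_def by blast+
  have r_inj: "inj (r k)" for k by (simp add: r_def inj)
  have u_succ: "successive u" using successive_subseq[OF succ \<psi>] by (simp add: u_def o_def)
  define b where "b = (\<lambda>k i. if i \<in> r k ` {..<m k} then u k i else 0)"
  have b_fin: "gpow (b k) < top" for k
    by (rule le_less_trans[OF gpow_mono fin[of "\<psi> k"]]) (simp add: b_def u_def)
  have "equivalent_seqs gspace (x \<circ> \<psi>) gspace b \<and> away_from_zero b"
  proof (rule pert[OF _ b_fin away_from_zero_subseq[OF away \<psi>]])
    show "gpow ((x \<circ> \<psi>) j) < top" for j by (simp add: fin)
    have "(x \<circ> \<psi>) j - b j = remainder (r j) (u j) (m j)" for j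
      by (auto simp: b_def u_def remainder_def fun_eq_iff)
    then show "gpow ((x \<circ> \<psi>) j - b j) \<le> ennreal (\<tau> j)" for j
      using order_trans[OF rem ennreal_leI[OF \<eta>(2)], of j] by (simp only:)
  qed
  then have xb: "equivalent_seqs gspace (x \<circ> \<psi>) gspace b" and b_away: "away_from_zero b" by blast+
  \<comment> \<open>Restricted to nonzero values, since the order relative to other blocks is known
    only on the supports.\<close>
  define T where "T = (\<lambda>k. {n. n < m k \<and> u k (r k n) \<noteq> 0})"
  define b' where "b' = (\<lambda>k. place (Q k) {..<m k} (\<lambda>n. u k (r k n)))"
  have Q_inj': "inj_on (Q k) A" for k A using Q_inj inj_on_subset by blast
  have iso: "equivalent_seqs gspace b gspace b'" "gpow (b' k) = gpow (b k)" for k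
  proof -
    have 1: "b k (r k n) = b' k (Q k n)" if "n \<in> T k" for k n
      using that by (simp add: b'_def T_def place_at[OF Q_inj'] b_def)
    have 2: "r k s < r l t \<longleftrightarrow> Q k s < Q l t" if st: "s \<in> T k" "t \<in> T l" for k l s t
    proof (cases rule: linorder_cases[of k l])
      case less
      then show ?thesis using successiveD[OF u_succ less] Q_less[OF less] st by (simp add: T_def)
    next
      case equal
      then show ?thesis using r_order[of s k t] q_order[of s "m k" t] st by (simp add: T_def Q_def)
    next
      case greater
      have "r l t < r k s" using successiveD[OF u_succ greater] st by (simp add: T_def)
      moreover have "Q l t < Q k s" by (rule Q_less[OF greater])
      ultimately show ?thesis by simp
    qed
    have 3: "b k i = 0" if "i \<notin> r k ` T k" for k i
      using that by (auto simp: b_def T_def)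
    have 4: "b' k i = 0" if "i \<notin> Q k ` T k" for k i
    proof (cases "i \<in> Q k ` {..<m k}")
      case True
      then obtain n where n: "i = Q k n" "n < m k" by blast
      then have "b' k i = u k (r k n)" by (simp add: b'_def place_at[OF Q_inj'])
      then show ?thesis using that n by (auto simp: T_def)
    qed (simp add: b'_def place_off)
    show "equivalent_seqs gspace b gspace b'"
      by (rule equivalent_order_iso(1)[where \<alpha> = r and \<beta> = Q and T = T]) (fact 1 2 3 4 b_fin)+
    show "gpow (b' k) = gpow (b k)"
      by (rule equivalent_order_iso(2)[where \<alpha> = r and \<beta> = Q and T = T and y = b]) (fact 1 2 3 4 b_fin)+
  qed
  have b'_fin: "gpow (b' k) < top" for k using iso(2) b_fin by simp
  have b'_away: "away_from_zero b'" using b_away unfolding away_from_zero_def iso(2) .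
  define y where "y = (\<lambda>k. place (Q k) UNIV f)"
  have yQ: "y k (Q k n) = f n" for k n by (simp add: y_def place_at[OF Q_inj'])
  have y_off: "t \<notin> range (Q k) \<Longrightarrow> y k t = 0" for k t by (simp add: y_def place_off)
  have close: "gpow (b' k - y k) \<le> ennreal (\<sigma> k)" for k
  proof -
    \<comment> \<open>The distance to \<open>y k\<close> consists of the coefficient errors on the
      first \<open>m k\<close> places, collected in \<open>D\<close>, and the tail of the seed,
      collected in \<open>E\<close>.\<close>
    define D where "D = place (Q k) {..<m k} (\<lambda>n. u k (r k n) - f n)"
    define E where "E = (\<lambda>t. if t \<in> Q k ` {..<m k} then 0 else y k t)"
    have DE: "b' k - y k = D - E"
    proof
      fix t
      show "(b' k - y k) t = (D - E) t"
      proof (cases "t \<in> Q k ` {..<m k}")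
        case True
        then obtain n where "t = Q k n" "n < m k" by blast
        then show ?thesis using True by (simp add: b'_def D_def E_def place_at[OF Q_inj'] yQ)
      qed (simp add: b'_def D_def E_def place_off)
    qed
    have D: "gpow D \<le> ennreal (\<sigma> k / (2 * K))"
    proof -
      have "gpow D \<le> ennreal (\<Sum>t\<in>Q k ` {..<m k}. norm (D t) powr p)"
        by (rule gpow_le_sum_support) (auto simp: D_def place_off)
      also have "(\<Sum>t\<in>Q k ` {..<m k}. norm (D t) powr p) = (\<Sum>n<m k. norm (u k (r k n) - f n) powr p)"
        unfolding sum.reindex[OF Q_inj'] by (simp add: D_def place_at[OF Q_inj'])
      also have "ennreal \<dots> \<le> ennreal (\<sigma> k / (2 * K))"
        using near[of k] \<eta>(3)[of k] by (intro ennreal_leI) simp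
      finally show ?thesis .
    qed
    have E: "gpow E \<le> ennreal (\<sigma> k / (2 * K))"
      unfolding E_def
    proof (rule gpow_seed_remainder[OF d Q_compat[of k], where f = f])
      show "y k (Q k n) = f n" for n by (rule yQ)
      show "y k t = 0" if "t \<notin> range (Q k)" for t by (rule y_off[OF that])
      fix n assume "m k \<le> n"
      then have "gpow (seed_vec f d n n - seed_vec f d (m k) n) \<le> ennreal (\<eta> k)"
        by (rule seed_tail_le[OF conv m])
      then show "gpow (seed_vec f d n n - seed_vec f d (m k) n) \<le> ennreal (\<sigma> k / (2 * K))"
        using \<eta>(3)[of k] ennreal_leI order_trans by blast
    qed
    have "gpow (b' k - y k) \<le> ennreal K * (gpow D + gpow E)"
      unfolding DE by (rule gpow_diff_le)
    also have "\<dots> \<le> ennreal K * (ennreal (\<sigma> k / (2 * K)) + ennreal (\<sigma> k / (2 * K)))"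
      by (intro mult_left_mono add_mono D E) simp
    also have "\<dots> = ennreal (K * (\<sigma> k / (2 * K) + \<sigma> k / (2 * K)))"
    proof -
      have "0 \<le> \<sigma> k / (2 * K)" using \<sigma>[of k] K_gt_1 by simp
      then show ?thesis using K_gt_1 by (simp only: ennreal_mult[symmetric] ennreal_plus[symmetric] add_nonneg_nonneg less_imp_le less_trans[OF zero_less_one])
    qed
    also have "K * (\<sigma> k / (2 * K) + \<sigma> k / (2 * K)) = \<sigma> k" using K_gt_1 by simp
    finally show ?thesis .
  qed
  \<comment> \<open>Membership in the space is needed before the perturbation result applies; it
    follows from closeness to a vector of the space.\<close>
  have y_fin: "gpow (y k) < top" for k
  proof -
    have "gpow (b' k - y k) < top" by (rule le_less_trans[OF close]) simp
    then have "gpow (b' k - (b' k - y k)) < top"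
      by (rule gpow_diff_less_top[OF b'_fin])
    then show ?thesis by (simp only: diff_diff_eq2 add_diff_cancel_left')
  qed
  have b'y: "equivalent_seqs gspace b' gspace y" and y_away: "away_from_zero y"
    using pertQ[OF b'_fin y_fin b'_away close] by blast+
  \<comment> \<open>The seed is nonzero because \<open>y\<close> stays away from zero; hence no
    \<open>y k\<close> vanishes and \<open>y\<close> is basic.\<close>
  obtain n0 where n0: "f n0 \<noteq> 0"
  proof -
    obtain c where c: "0 < c" "\<forall>\<^sub>F j in sequentially. ennreal c \<le> gpow (y j)" using y_away unfolding away_from_zero_def by blast
    then obtain j where j: "ennreal c \<le> gpow (y j)" using eventually_happens[OF c(2)] by auto
    have "y j \<noteq> 0"
    proof
      assume "y j = 0"
      then have "gpow (y j) = 0" by (simp only: gpow_0)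
      then show False using j c(1) by (simp add: ennreal_eq_0_iff)
    qed
    then obtain t where "y j t \<noteq> 0" by (auto simp: fun_eq_iff)
    then obtain n where "t = Q j n" "f n \<noteq> 0" using y_off[of t j] yQ by (cases "t \<in> range (Q j)") auto
    then show thesis using that by blast
  qed
  have y_nz: "y k \<noteq> 0" for k
  proof
    assume "y k = 0"
    then have "y k (Q k n0) = 0" by simp
    then show False using yQ n0 by simp
  qed
  have y_succ: "successive y"
    unfolding successive_def
  proof (intro allI impI)
    fix k l s t assume kl: "k < l" "y k s \<noteq> 0" "y l t \<noteq> 0"
    then have "s \<in> range (Q k)" "t \<in> range (Q l)" using y_off by blast+
    then show "s < t" using Q_less[OF kl(1)] by blast
  qed
  have "generated_on_Q f d y"
    unfolding generated_on_Q_def compatible_vec_def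
  proof (intro conjI allI impI)
    show "\<exists>q. compatible_seq d q \<and> (\<forall>n. y k (q n) = f n) \<and> (\<forall>r. r \<notin> range q \<longrightarrow> y k r = 0)" for k
      by (intro exI[of _ "Q k"]) (simp add: Q_compat yQ y_off)
    show "y k s \<noteq> 0 \<Longrightarrow> y (Suc k) t \<noteq> 0 \<Longrightarrow> s < t" for k s t
      by (rule successiveD[OF y_succ]) simp_all
  qed
  moreover have "basic_seq gspace y"
    by (rule basic_seq_disjoint[OF successive_imp_disjoint[OF y_succ] y_nz y_fin])
  moreover have "equivalent_seqs gspace (x \<circ> \<psi>) gspace y"
    by (rule equivalent_seqs_trans[OF xb equivalent_seqs_trans[OF iso(1) b'y]])
  ultimately show ?thesis using \<psi> tail by blast
qed

lemma subsymmetric_imp_generated_or_lp: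
  fixes z :: "nat \<Rightarrow> nat \<Rightarrow> 'k::{real_normed_field, euclidean_space}"
  assumes z: "subsymmetric gspace z"
  shows "(\<exists>f d y. positioning d \<and> seed_tail_inf w p f d = 0 \<and> generated_on_Q f d y \<and>
       basic_seq gspace y \<and> equivalent_seqs gspace z gspace (y :: nat \<Rightarrow> rat \<Rightarrow> 'k)) \<or>
    equivalent_seqs gspace z (lp_space p :: ('k, nat \<Rightarrow> 'k) qspace) unit_vec"
proof -
  have basic: "basic_seq gspace z"
    and spread: "\<And>\<phi>. strict_mono \<phi> \<Longrightarrow> equivalent_seqs gspace (z \<circ> \<phi>) gspace z"
    using z by (simp_all add: subsymmetric_def)
  have vs: "vector_space (scl (gspace :: ('k, nat \<Rightarrow> 'k) qspace))" by (simp add: vector_space_fscl)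
  obtain \<phi> B c and b :: "nat \<Rightarrow> nat \<Rightarrow> 'k" where \<phi>: "strict_mono (\<phi>::nat \<Rightarrow> nat)" and c: "0 < c" and B: "0 \<le> B"
    and b: "\<And>j. ennreal c \<le> gpow (b j)" "\<And>j. gpow (b j) \<le> ennreal B" "\<And>i. (\<lambda>j. b j i) \<longlonglongrightarrow> 0"
    and zb: "equivalent_seqs gspace (z \<circ> \<phi>) gspace b"
    using coordinatewise_null_equivalent[OF basic spread] by blast
  obtain \<psi> and y :: "nat \<Rightarrow> nat \<Rightarrow> 'k" where \<psi>: "strict_mono (\<psi>::nat \<Rightarrow> nat)" and succ: "successive y"
    and y: "\<And>j. finite {i. y j i \<noteq> 0}" "\<And>j. gpow (y j) \<le> ennreal B" "away_from_zero y"
    and b_y: "equivalent_seqs gspace (b \<circ> \<psi>) gspace y"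
    using ex_block_equivalent[OF c b] by blast
  \<comment> \<open>Spreading of \<open>z\<close> absorbs every extraction made on the way, so any
    further subsequence of the blocks remains a model of \<open>z\<close>.\<close>
  have zy: "equivalent_seqs gspace z gspace (y \<circ> \<theta>)" if \<theta>: "strict_mono \<theta>" for \<theta>
  proof -
    have "equivalent_seqs gspace z gspace (z \<circ> (\<phi> \<circ> \<psi> \<circ> \<theta>))"
      by (rule equivalent_seqs_sym[OF spread]) (intro strict_mono_o \<phi> \<psi> \<theta>)
    also have "z \<circ> (\<phi> \<circ> \<psi> \<circ> \<theta>) = (z \<circ> \<phi>) \<circ> \<psi> \<circ> \<theta>" by (simp add: o_assoc)
    also have "equivalent_seqs gspace ((z \<circ> \<phi>) \<circ> \<psi> \<circ> \<theta>) gspace (b \<circ> \<psi> \<circ> \<theta>)"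
      by (intro equivalent_seqs_subseq vs \<theta> \<psi> zb)
    also have "equivalent_seqs gspace (b \<circ> \<psi> \<circ> \<theta>) gspace (y \<circ> \<theta>)"
      by (intro equivalent_seqs_subseq vs \<theta> b_y)
    finally show ?thesis .
  qed
  obtain \<theta> \<rho> f d where \<theta>: "strict_mono (\<theta>::nat \<Rightarrow> nat)" and conv: "converges_to_seed (y \<circ> \<theta>) \<rho> f d"
    using ex_converges_to_seed[of y, OF y(1,2)] by blast
  define x where "x = y \<circ> \<theta>"
  have x: "successive x" "\<And>j. gpow (x j) \<le> ennreal B" "away_from_zero x" "converges_to_seed x \<rho> f d"
    using successive_subseq[OF succ \<theta>] y(2) away_from_zero_subseq[OF y(3) \<theta>] conv by (simp_all add: x_def)
  have x_fin: "gpow (x j) < top" for j by (rule le_less_trans[OF x(2)]) simp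
  have zx: "equivalent_seqs gspace z gspace (x \<circ> \<psi>)" if "strict_mono \<psi>" for \<psi>
    using zy[OF strict_mono_o[OF \<theta> that]] by (simp add: x_def o_assoc)
  show ?thesis
  proof (cases "\<forall>\<delta>>0. \<exists>m. \<forall>\<^sub>F j in sequentially. gpow (remainder (\<rho> j) (x j) m) \<le> ennreal \<delta>")
    case True
    then have "\<And>\<delta>. 0 < \<delta> \<Longrightarrow> \<exists>m. \<forall>\<^sub>F j in sequentially. gpow (remainder (\<rho> j) (x j) m) \<le> ennreal \<delta>" by blast
    from small_remainders_imp_generated[OF x(1) x_fin x(3,4) this]
    obtain \<psi> y' where "strict_mono (\<psi>::nat \<Rightarrow> nat)" "seed_tail_inf w p f d = 0" "generated_on_Q f d y'"
      "basic_seq gspace y'" "equivalent_seqs gspace (x \<circ> \<psi>) gspace y'" by blast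
    moreover have "positioning d" using conv by (simp add: converges_to_seed_def)
    ultimately show ?thesis using equivalent_seqs_trans[OF zx] by blast
  next
    case False
    then obtain \<delta> where \<delta>: "0 < \<delta>"
      and "\<And>m. \<exists>\<^sub>F j in sequentially. \<not> gpow (remainder (\<rho> j) (x j) m) \<le> ennreal \<delta>"
      by (auto simp: not_eventually)
    then have large: "\<And>m. \<exists>\<^sub>F j in sequentially. ennreal \<delta> < gpow (remainder (\<rho> j) (x j) m)"
      by (simp add: not_le)
    from large_remainders_imp_lp[OF x(1,2) B x(4) \<delta> large]
    show ?thesis using equivalent_seqs_trans[OF zx] by blast
  qed
qed

end

theorem theorem3p8:
  fixes p :: real
    and w :: "nat \<Rightarrow> real"
    and X :: "('k::{real_normed_field, euclidean_space}, 'v::ab_group_add) qspace"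
    and x :: "nat \<Rightarrow> 'v"
  assumes "0 < p"
    and "garling_weight w"
    and "quasi_banach X"
    and "basic_seq X x"
  shows "(\<exists>z. subsymmetric (garling_space w p :: ('k, nat \<Rightarrow> 'k) qspace) z \<and>
              equivalent_seqs X x (garling_space w p) z)
         \<longleftrightarrow>
         (\<exists>f d y. positioning d \<and> seed_tail_inf w p f d = 0 \<and> generated_on_Q f d y \<and>
                  basic_seq (garlingQ_space w p :: ('k, rat \<Rightarrow> 'k) qspace) y \<and>
                  equivalent_seqs X x (garlingQ_space w p) y)
         \<or> equivalent_seqs X x (lp_space p :: ('k, nat \<Rightarrow> 'k) qspace) unit_vec"
proof -
  interpret garling w p by (rule garling.intro[OF assms(2,1)])
  show ?thesis
    unfolding garling_space_eq garlingQ_space_eq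
  proof (intro iffI; (elim disjE exE conjE)?)
    fix z :: "nat \<Rightarrow> nat \<Rightarrow> 'k"
    assume z: "subsymmetric gspace z" and xz: "equivalent_seqs X x gspace z"
    show "(\<exists>f d y. positioning d \<and> seed_tail_inf w p f d = 0 \<and> generated_on_Q f d y \<and>
        basic_seq gspace (y :: nat \<Rightarrow> rat \<Rightarrow> 'k) \<and> equivalent_seqs X x gspace y) \<or>
      equivalent_seqs X x (lp_space p :: ('k, nat \<Rightarrow> 'k) qspace) unit_vec"
      using subsymmetric_imp_generated_or_lp[OF z]
    proof (elim disjE exE conjE)
      fix f d and y :: "nat \<Rightarrow> rat \<Rightarrow> 'k"
      assume "positioning d" "seed_tail_inf w p f d = 0" "generated_on_Q f d y" "basic_seq gspace y"
        and "equivalent_seqs gspace z gspace y"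
      moreover from equivalent_seqs_trans[OF xz this(5)] have "equivalent_seqs X x gspace y" .
      ultimately show ?thesis by blast
    next
      assume "equivalent_seqs gspace z (lp_space p :: ('k, nat \<Rightarrow> 'k) qspace) unit_vec"
      from equivalent_seqs_trans[OF xz this] show ?thesis by (rule disjI2)
    qed
  next
    fix f d and y :: "nat \<Rightarrow> rat \<Rightarrow> 'k"
    assume "positioning d" "seed_tail_inf w p f d = 0" "generated_on_Q f d y" "basic_seq gspace y"
      and xy: "equivalent_seqs X x gspace y"
    then obtain z :: "nat \<Rightarrow> nat \<Rightarrow> 'k" where z: "subsymmetric gspace z" "equivalent_seqs gspace y gspace z"
      using generated_imp_subsymmetric by blast
    show "\<exists>z :: nat \<Rightarrow> nat \<Rightarrow> 'k. subsymmetric gspace z \<and> equivalent_seqs X x gspace z"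
      by (intro exI[of _ z] conjI z(1) equivalent_seqs_trans[OF xy z(2)])
  next
    assume lp: "equivalent_seqs X x (lp_space p :: ('k, nat \<Rightarrow> 'k) qspace) unit_vec"
    obtain z :: "nat \<Rightarrow> nat \<Rightarrow> 'k" where z: "subsymmetric gspace z"
      "equivalent_seqs gspace z (lp_space p :: ('k, nat \<Rightarrow> 'k) qspace) unit_vec"
      using lp_subsymmetric_in_garling by blast
    show "\<exists>z :: nat \<Rightarrow> nat \<Rightarrow> 'k. subsymmetric gspace z \<and> equivalent_seqs X x gspace z"
      by (intro exI[of _ z] conjI z(1) equivalent_seqs_trans[OF lp equivalent_seqs_sym[OF z(2)]])
  qed
qed

end
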